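(* Let $d\ge1$ and $\nu>1$, and set $\nu':=\nu-1$. For $0<\lambda<\infty$, $k\ge1$ and $s\ge0$ let $\rho_{\lambda,k}(s):=\frac{\lambda+k}{2}\log\!\big(\frac{\lambda+s}{\lambda}\big)$ and $u_{\lambda,k}(s):=\frac{\lambda+k}{\lambda+s}$. Let $P$ be a law on $\mathbb{R}^d$, $T_1(y):=(y',1)'\in\mathbb{R}^{d+1}$, and $Q:=P\circ T_1^{-1}$. For $A\in\mathcal{P}_{d+1}$ define $$Qh(A):=\tfrac12\log\det A+\int\big[\rho_{\nu',d+1}(z'A^{-1}z)-\rho_{\nu',d+1}(z'z)\big]\,dQ(z),$$ regarded as a function of the entries $A_{ij}$, $1\le i\le j\le d+1$. For $\mu\in\mathbb{R}^d$, $\Sigma\in\mathcal{P}_d$ let $A(\Sigma,\mu,1):=\begin{bmatrix}\Sigma+\mu\mu'&\mu\\ \mu'&1\end{bmatrix}\in\mathcal{P}_{d+1}$ (this is a bijection from $\mathbb{R}^d\times\mathcal{P}_d$ onto $\{A\in\mathcal{P}_{d+1}:A_{d+1,d+1}=1\}$). For $y\in\mathbb{R}^d$ let $$h(y,(\mu,\Sigma)):=\tfrac12\log\det\Sigma+\rho_{\nu,d}\big((y-\mu)'\Sigma^{-1}(y-\mu)\big)-\rho_{\nu,d}(y'y),\qquad Ph(\mu,\Sigma):=\int h(y,(\mu,\Sigma))\,dP(y).$$ Assuming $P\in\mathcal{V}_{d,\nu+d}$ in parts (a)–(e): (a) $A\mapsto Qh(A)$ on $\mathcal{P}_{d+1}$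 has a unique critical point $A(\nu')=A_{\nu'}(Q)$, which is an absolute minimum; (b) $A(\nu')_{d+1,d+1}=\int u_{\nu',d+1}(z'A(\nu')^{-1}z)\,dQ(z)=1$; (c) for any $\mu\in\mathbb{R}^d$, $\Sigma\in\mathcal{P}_d$, with $A=A(\Sigma,\mu,1)$, for every $y\in\mathbb{R}^d$ and $z:=(y',1)'$, $u_{\nu',d+1}(z'A^{-1}z)=u_{\nu,d}((y-\mu)'\Sigma^{-1}(y-\mu))$; in particular this holds for $A=A(\nu')$ and its corresponding $\mu=\mu_\nu\in\mathbb{R}^d$, $\Sigma=\Sigma_\nu\in\mathcal{P}_d$ (i.e. $A(\nu')=A(\Sigma_\nu,\mu_\nu,1)$); (d) $\int u_{\nu,d}\big((y-\mu_\nu)'\Sigma_\nu^{-1}(y-\mu_\nu)\big)\,dP(y)=1$; (e) $(\mu_\nu,\Sigma_\nu)$ is the M-functional for $P$ with respect to $h$: $Ph(\mu,\Sigma)$ is defined and in $(-\infty,+\infty]$ for all $(\mu,\Sigma)\in\mathbb{R}^d\times\mathcal{P}_d$ and is minimized uniquely at $(\mu_\nu,\Sigma_\nu)$. (f) If, on the other hand, $P\notin\mathcal{V}_{d,\nu+d}$, then $(\mu,\Sigma)\mapsto Ph(\mu,\Sigma)$ has no critical points (no point of $\mathbb{R}^d\times\mathcal{P}_d$ where its gradient with respect to $\mu$ and the entries $\Sigma_{ij}$, $i\le j$, vanishes).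
   Context: A law is a Borel probability measure. $\mathcal{P}_k$ is the set of $k\times k$ strictly positive definite symmetric matrices. For $a_0>0$, $\mathcal{V}_{d,a_0}$ is the set of all laws $P$ on $\mathbb{R}^d$ such that $P(J)<1-(d-q)/a_0$ for every affine hyperplane $J\subset\mathbb{R}^d$ of dimension $q<d$. A critical point is a point where the gradient vanishes. Symmetric matrices are parametrized by their entries with $i\le j$ (so varying $A_{ij}$ also varies $A_{ji}$). *)

theory Defs
  imports "HOL-Analysis.Analysis" "HOL-Probability.Probability"
begin

definition pos_def :: "real^'n::finite^'n \<Rightarrow> bool" where
  "pos_def A \<longleftrightarrow> transpose A = A \<and> (\<forall>x. x \<noteq> 0 \<longrightarrow> x \<bullet> (A *v x) > 0)"

definition inV :: "(real^'d::finite) measure \<Rightarrow> real \<Rightarrow> bool" where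
  "inV P a0 \<longleftrightarrow> (\<forall>J. affine J \<and> J \<noteq> {} \<and> aff_dim J < int CARD('d) \<longrightarrow>
      measure P J < 1 - (real CARD('d) - real_of_int (aff_dim J)) / a0)"

definition rho :: "real \<Rightarrow> real \<Rightarrow> real \<Rightarrow> real" where
  "rho lam k s = (lam + k) / 2 * ln ((lam + s) / lam)"

definition uw :: "real \<Rightarrow> real \<Rightarrow> real \<Rightarrow> real" where
  "uw lam k s = (lam + k) / (lam + s)"

definition ext_int :: "'a measure \<Rightarrow> ('a \<Rightarrow> real) \<Rightarrow> ereal" where
  "ext_int M f = enn2ereal (\<integral>\<^sup>+ x. ennreal (f x) \<partial>M) - enn2ereal (\<integral>\<^sup>+ x. ennreal (- f x) \<partial>M)"

text \<open>The embedding T_1(y) = (y',1)', the coordinate None being the (d+1)-st one.\<close>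
definition T1 :: "real^'d::finite \<Rightarrow> real^('d::finite option)" where
  "T1 y = (\<chi> i. case i of Some j \<Rightarrow> y $ j | None \<Rightarrow> 1)"

definition Qh :: "real \<Rightarrow> (real^('d::finite option)) measure \<Rightarrow> real^('d option)^('d option) \<Rightarrow> ereal" where
  "Qh nu' Q A = ereal (ln (det A) / 2) +
     ext_int Q (\<lambda>z. rho nu' (real CARD('d option)) (z \<bullet> (matrix_inv A *v z))
                   - rho nu' (real CARD('d option)) (z \<bullet> z))"

definition hfun :: "real \<Rightarrow> real^'d::finite \<Rightarrow> real^'d \<Rightarrow> real^'d^'d \<Rightarrow> real" where
  "hfun nu y mu S = ln (det S) / 2 + rho nu (real CARD('d)) ((y - mu) \<bullet> (matrix_inv S *v (y - mu)))
      - rho nu (real CARD('d)) (y \<bullet> y)"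

definition Ph :: "real \<Rightarrow> (real^'d::finite) measure \<Rightarrow> real^'d \<Rightarrow> real^'d^'d \<Rightarrow> ereal" where
  "Ph nu P mu S = ext_int P (\<lambda>y. hfun nu y mu S)"

definition Amat :: "real^'d::finite^'d \<Rightarrow> real^'d \<Rightarrow> real^('d::finite option)^('d option)" where
  "Amat S mu = (\<chi> i j. case (i, j) of
       (Some a, Some b) \<Rightarrow> S $ a $ b + mu $ a * mu $ b
     | (Some a, None) \<Rightarrow> mu $ a
     | (None, Some b) \<Rightarrow> mu $ b
     | (None, None) \<Rightarrow> 1)"

text \<open>Symmetric unit direction: varying the entry A_ij (i \<le> j) also varies A_ji.\<close>
definition sym_unit :: "'n::finite \<Rightarrow> 'n \<Rightarrow> real^'n^'n" where
  "sym_unit i j = (\<chi> k l. if (k = i \<and> l = j) \<or> (k = j \<and> l = i) then 1 else 0)"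

definition crit_point :: "('a::real_vector \<Rightarrow> ereal) \<Rightarrow> 'a set \<Rightarrow> 'a \<Rightarrow> bool" where
  "crit_point f D x \<longleftrightarrow> (\<forall>v\<in>D. \<exists>g. (\<forall>\<^sub>F t in nhds 0. f (x + t *\<^sub>R v) = ereal (g t))
        \<and> (g has_real_derivative 0) (at 0))"

definition mat_dirs :: "(real^'n::finite^'n) set" where
  "mat_dirs = {sym_unit i j | i j. True}"

definition loc_scat_dirs :: "((real^'d::finite) \<times> (real^'d^'d)) set" where
  "loc_scat_dirs = {(axis k 1, 0) | k. True} \<union> {(0, sym_unit i j) | i j. True}"

end

theory Submission
  imports Defs
begin

text \<open>
  Critical points of the scatter objective on \<open>d + 1\<close> dimensions are the solutions of
  \<open>A = \<integral> u(z'A\<inverse>z) zz' dQ\<close>. Such a solution is unique by a fixed-point argument of Kent and Tyler: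
  if the largest eigenvalue \<open>c\<close> of \<open>B\<close> relative to \<open>A\<close> exceeded 1, then \<open>u(s/c) < c u(s)\<close> would
  contradict the equations for \<open>A\<close> and \<open>B\<close> in the corresponding eigendirection. A minimiser exists
  when \<open>Q(H) < 1 - (d + 1 - dim H)/a0\<close> for all proper linear subspaces \<open>H\<close>, because these inequalities,
  uniform over orthonormal frames by compactness, make the objective coercive in the logarithms of the
  eigenvalues; being critical, the minimiser is the unique solution. Conversely, taking the trace of the critical
  equation over the orthogonal complement of \<open>H\<close> yields these inequalities, and they are equivalent to
  \<open>P \<in> V\<^bsub>d,\<nu>+d\<^esub>\<close>. The trace of the whole equation gives \<open>\<integral> u = 1\<close>, hence
  \<open>A\<^bsub>d+1,d+1\<^esub> = 1\<close>. Finally \<open>Ph(\<mu>,\<Sigma>) = Qh(A(\<Sigma>,\<mu>,1))\<close>, and a critical point of \<open>Ph\<close>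
  lifts to a solution of the critical equation in \<open>d + 1\<close> dimensions.
\<close>

section \<open>Quadratic forms\<close>

text \<open>No moment of the law is assumed, so only bounded functions may be integrated: a
  difference of logarithms of two comparable forms is bounded, and
  \<open>u(s) = a0 / (lam + s)\<close> keeps \<open>u(s) * s\<close> below \<open>a0\<close>.
  Derivatives are taken along single lines \<open>A + t V\<close>. In a basis orthonormal for
  \<open>A\<close> and diagonalising \<open>V\<close>, the determinant and the inverse form are
  explicit in the numbers \<open>1 + t * v i\<close>, so one-variable calculus and dominated
  convergence suffice. The constants fit because \<open>(nu - 1) + (d + 1) = nu + d\<close>, while
  lifting adds exactly 1 to the quadratic form. The obstacle in part (f) is that a critical point of
  \<open>Ph\<close> only sees directions tangent to the surface where the last diagonal entry is 1,
  so the scalar equation \<integral> u = 1 is missing. The scatter equations supply it: they form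
  the full critical equation, in dimension \<open>d\<close> with parameter \<open>nu\<close>, of the
  law of \<open>y - mu\<close>, and its trace is the missing identity. For this reason the theory is
  developed for a general law and parameter and used twice.\<close>

lemma sym_form_commute:
  fixes V :: "real^'n::finite^'n"
  assumes "transpose V = V"
  shows "x \<bullet> (V *v y) = y \<bullet> (V *v x)"
  by (metis assms dot_lmul_matrix inner_commute transpose_matrix_vector)

lemmas form_simps = matrix_vector_right_distrib matrix_vector_mult_diff_distrib
  matrix_vector_mult_scaleR inner_add_left inner_add_right inner_diff_left inner_diff_right

lemma pos_def_sym: "pos_def A \<Longrightarrow> transpose A = A"
  and pos_def_pos: "pos_def A \<Longrightarrow> x \<noteq> 0 \<Longrightarrow> 0 < x \<bullet> (A *v x)"
  unfolding pos_def_def by auto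

lemma pos_def_nonneg: "pos_def A \<Longrightarrow> 0 \<le> x \<bullet> (A *v x)"
  using pos_def_pos[of A x] by (cases "x = 0") auto

lemma pos_def_invertible:
  assumes "pos_def A" shows "invertible A"
proof -
  have "\<forall>x. A *v x = 0 \<longrightarrow> x = 0"
    using pos_def_pos[OF assms] by fastforce
  then show ?thesis
    using invertible_left_inverse matrix_left_invertible_ker by blast
qed

lemma invertible_inv_left: "invertible A \<Longrightarrow> matrix_inv A ** A = mat 1"
  and invertible_inv_right: "invertible A \<Longrightarrow> A ** matrix_inv A = mat 1"
  for A :: "real^'n::finite^'n"
  unfolding invertible_def matrix_inv_def by (metis (mono_tags, lifting) someI_ex)+

lemma matrix_inv_eqI:
  fixes A B :: "real^'n::finite^'n"
  assumes "A ** B = mat 1" shows "matrix_inv A = B"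
proof -
  have "invertible A" using assms invertible_right_inverse by blast
  then have "matrix_inv A ** (A ** B) = B"
    by (simp add: matrix_mul_assoc invertible_inv_left)
  then show ?thesis using assms by simp
qed

lemma pos_def_inv_mult [simp]:
  assumes "pos_def A"
  shows "A *v (matrix_inv A *v x) = x" "matrix_inv A *v (A *v x) = x"
  using pos_def_invertible[OF assms]
  by (simp_all add: matrix_vector_mul_assoc invertible_inv_left invertible_inv_right)

lemma pos_def_inv:
  assumes "pos_def A" shows "pos_def (matrix_inv A)"
proof -
  have "A ** transpose (matrix_inv A) = mat 1"
    by (metis assms invertible_inv_left matrix_transpose_mul pos_def_invertible pos_def_sym transpose_mat)
  then have sym: "transpose (matrix_inv A) = matrix_inv A"
    using matrix_inv_eqI by metis
  have "0 < x \<bullet> (matrix_inv A *v x)" if "x \<noteq> 0" for x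
  proof -
    have "matrix_inv A *v x \<noteq> 0"
      using that assms pos_def_inv_mult(1)[OF assms, of x] by fastforce
    then show ?thesis
      using pos_def_pos[OF assms, of "matrix_inv A *v x"] assms by (simp add: inner_commute)
  qed
  with sym show ?thesis unfolding pos_def_def by blast
qed

lemma pos_def_inv_inv: "pos_def A \<Longrightarrow> matrix_inv (matrix_inv A) = A"
  by (intro matrix_inv_eqI invertible_inv_left pos_def_invertible)

lemma pos_def_mat1: "pos_def (mat 1)"
  unfolding pos_def_def by simp

text \<open>Dual (Legendre) characterisation of the inverse form; it makes inversion antitone.\<close>
lemma inverse_form_ge:
  assumes "pos_def A"
  shows "2 * (x \<bullet> z) - x \<bullet> (A *v x) \<le> z \<bullet> (matrix_inv A *v z)"
proof -
  let ?w = "matrix_inv A *v z"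
  have "0 \<le> (x - ?w) \<bullet> (A *v (x - ?w))" by (rule pos_def_nonneg[OF assms])
  moreover have "?w \<bullet> (A *v x) = x \<bullet> z"
    using sym_form_commute[OF pos_def_sym[OF assms], of ?w x] assms by simp
  ultimately show ?thesis using assms by (simp add: form_simps inner_commute)
qed

text \<open>Polarisation: the form at \<open>x + y\<close> recovers the bilinear form, because both
  matrices are symmetric.\<close>

lemma sym_eq_by_form:
  fixes A B :: "real^'k::finite^'k"
  assumes "transpose A = A" "transpose B = B" "\<And>x. x \<bullet> (A *v x) = x \<bullet> (B *v x)"
  shows "A = B"
proof -
  have "x \<bullet> (A *v y) = x \<bullet> (B *v y)" for x y
    using assms(3)[of "x + y"] assms(3)[of x] assms(3)[of y]
      sym_form_commute[OF assms(1), of x y] sym_form_commute[OF assms(2), of x y]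
    by (simp add: form_simps)
  then have "A *v y = B *v y" for y by (metis vector_eq_ldot)
  then show ?thesis by (simp add: matrix_eq)
qed

text \<open>Obtained from \<open>inverse_form_ge\<close> by choosing the best multiple of
  \<open>x\<close>. It lets the inverse form, which sits inside the weight, control every
  \<open>(x \<bullet> z)\<^sup>2\<close>.\<close>

lemma form_Cauchy_Schwarz:
  assumes "pos_def A"
  shows "(x \<bullet> z)\<^sup>2 \<le> (x \<bullet> (A *v x)) * (z \<bullet> (matrix_inv A *v z))"
proof (cases "x = 0")
  case False
  define a where "a = x \<bullet> (A *v x)"
  have a: "a > 0" unfolding a_def using pos_def_pos[OF assms False] .
  define t where "t = (x \<bullet> z) / a"
  have "2 * (t * (x \<bullet> z)) - t * (t * a) \<le> z \<bullet> (matrix_inv A *v z)"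
    using inverse_form_ge[OF assms, of "t *\<^sub>R x" z] by (simp add: form_simps a_def)
  then have "a * (2 * (t * (x \<bullet> z)) - t * (t * a)) \<le> a * (z \<bullet> (matrix_inv A *v z))"
    using a by simp
  moreover have "t * a = x \<bullet> z" using a by (simp add: t_def)
  then have "a * (2 * (t * (x \<bullet> z)) - t * (t * a)) = (x \<bullet> z)\<^sup>2"
    by (simp add: power2_eq_square algebra_simps)
  ultimately show ?thesis by (simp add: a_def)
qed simp

lemma continuous_form [continuous_intros]:
  "continuous_on S (\<lambda>x. x \<bullet> (A *v x))" for A :: "real^'n::finite^'n"
  by (intro continuous_intros linear_continuous_on linear_conv_bounded_linear[THEN iffD1]) auto

text \<open>Extreme values on the compact unit sphere, extended by homogeneity of degree
  two.\<close>

lemma form_bounds: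
  fixes A :: "real^'n::finite^'n"
  assumes "pos_def A"
  obtains r R where "0 < r" "\<And>x. r * (x \<bullet> x) \<le> x \<bullet> (A *v x)" "\<And>x. x \<bullet> (A *v x) \<le> R * (x \<bullet> x)"
proof -
  let ?S = "sphere (0::real^'n) 1"
  have ne: "?S \<noteq> {}" by simp
  have cont: "continuous_on ?S (\<lambda>x. x \<bullet> (A *v x))" by (rule continuous_form)
  obtain a where a: "a \<in> ?S" "\<And>x. x \<in> ?S \<Longrightarrow> a \<bullet> (A *v a) \<le> x \<bullet> (A *v x)"
    using continuous_attains_inf[OF compact_sphere ne cont] by blast
  obtain b where b: "b \<in> ?S" "\<And>x. x \<in> ?S \<Longrightarrow> x \<bullet> (A *v x) \<le> b \<bullet> (A *v b)"
    using continuous_attains_sup[OF compact_sphere ne cont] by blast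
  have scale: "(x \<bullet> (A *v x)) = (x \<bullet> x) * ((x /\<^sub>R norm x) \<bullet> (A *v (x /\<^sub>R norm x)))" if "x \<noteq> 0" for x
    using that by (simp add: form_simps power2_norm_eq_inner[symmetric] power2_eq_square field_simps)
  show ?thesis
  proof
    show "0 < a \<bullet> (A *v a)" using a(1) by (intro pos_def_pos[OF assms]) auto
    show "a \<bullet> (A *v a) * (x \<bullet> x) \<le> x \<bullet> (A *v x)" for x
    proof (cases "x = 0")
      case False
      then have "a \<bullet> (A *v a) \<le> (x /\<^sub>R norm x) \<bullet> (A *v (x /\<^sub>R norm x))" by (intro a(2)) simp
      then show ?thesis unfolding scale[OF False] 
        by (metis inner_ge_zero mult.commute mult_left_mono)
    qed simp
    show "x \<bullet> (A *v x) \<le> b \<bullet> (A *v b) * (x \<bullet> x)" for x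
    proof (cases "x = 0")
      case False
      then have "(x /\<^sub>R norm x) \<bullet> (A *v (x /\<^sub>R norm x)) \<le> b \<bullet> (A *v b)" by (intro b(2)) simp
      then show ?thesis unfolding scale[OF False] 
        by (metis inner_ge_zero mult.commute mult_left_mono)
    qed simp
  qed
qed

section \<open>Simultaneous diagonalisation\<close>

text \<open>The first-order condition at a maximum in algebraic form: for small \<open>t\<close>
  with the sign of \<open>b\<close>, the linear term beats the quadratic one.\<close>

lemma quadratic_nonpos_imp_zero:
  fixes b c :: real
  assumes "\<And>t. 2 * t * b + t\<^sup>2 * c \<le> 0"
  shows "b = 0"
proof (rule ccontr)
  assume b: "b \<noteq> 0"
  define t where "t = b / (\<bar>c\<bar> + 1)"
  have "t * (2 * b + t * c) \<le> 0" using assms[of t] by (simp add: power2_eq_square algebra_simps)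
  moreover have "t * b > 0" 
  proof -
    have "0 < b\<^sup>2 / (\<bar>c\<bar> + 1)" using b by (intro divide_pos_pos) auto
    then show ?thesis by (simp add: t_def power2_eq_square)
  qed
  moreover have "t * t * \<bar>c\<bar> \<le> t * b"
  proof -
    have "t * (\<bar>c\<bar> + 1) = b" by (simp add: t_def)
    then have "t * b = t * t * (\<bar>c\<bar> + 1)" by (metis mult.assoc)
    then show ?thesis by (simp only: distrib_left) simp
  qed
  moreover have "- (t * t * \<bar>c\<bar>) \<le> t * t * c"
    by (metis abs_ge_minus_self abs_mult abs_mult_self_eq minus_le_iff mult.assoc neg_le_iff_le)
  ultimately show False by (simp add: algebra_simps)
qed

text \<open>Each maximiser of the generalised Rayleigh quotient is \<open>V\<close>-orthogonal to its
  \<open>A\<close>-orthogonal complement.\<close>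
lemma simultaneous_diagonal_subspace:
  fixes A V :: "real^'n::finite^'n"
  assumes A: "pos_def A" and V: "transpose V = V" and "subspace S"
  shows "\<exists>B\<subseteq>S. finite B \<and> card B = dim S \<and> (\<forall>b\<in>B. b \<bullet> (A *v b) = 1)
     \<and> (\<forall>b\<in>B. \<forall>c\<in>B. b \<noteq> c \<longrightarrow> b \<bullet> (A *v c) = 0 \<and> b \<bullet> (V *v c) = 0)"
  using \<open>subspace S\<close>
proof (induction "dim S" arbitrary: S)
  case 0
  then show ?case by (intro exI[of _ "{}"]) auto
next
  case (Suc n)
  note subS = \<open>subspace S\<close>
  let ?K = "{x \<in> S. x \<bullet> (A *v x) = 1}"
  obtain r R where r: "0 < r" "\<And>x. r * (x \<bullet> x) \<le> x \<bullet> (A *v x)"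
    using form_bounds[OF A] by metis
  have "closed ({x. x \<bullet> (A *v x) = 1} \<inter> S)"
    using continuous_form[of UNIV A] closed_subspace[OF subS]
    by (intro closed_Int closed_Collect_eq) (auto intro: continuous_intros)
  moreover have "{x. x \<bullet> (A *v x) = 1} \<inter> S = ?K" by auto
  moreover have "bounded ?K"
  proof (rule boundedI)
    fix x assume "x \<in> ?K"
    then have "r * (norm x)\<^sup>2 \<le> 1" using r(2)[of x] by (simp add: power2_norm_eq_inner)
    then have "(norm x)\<^sup>2 \<le> 1 / r" using r(1) by (simp add: field_simps)
    then show "norm x \<le> sqrt (1 / r)" using real_le_rsqrt by blast
  qed
  ultimately have comp: "compact ?K" by (metis compact_eq_bounded_closed)
  have scaled: "x /\<^sub>R sqrt (x \<bullet> (A *v x)) \<in> ?K" if "x \<in> S" "x \<noteq> 0" for x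
    using that subS pos_def_pos[OF A, of x]
    by (auto simp: form_simps subspace_scale field_simps power2_eq_square[symmetric])
  obtain x0 where x0: "x0 \<in> S" "x0 \<noteq> 0"
    using Suc.hyps(2) by (metis dim_eq_0 nat.distinct(1) subsetI singletonI)
  have ne: "?K \<noteq> {}" using scaled[OF x0] by blast
  obtain v where v: "v \<in> ?K" and vmax: "\<And>x. x \<in> ?K \<Longrightarrow> x \<bullet> (V *v x) \<le> v \<bullet> (V *v v)"
    using continuous_attains_sup[OF comp ne continuous_form[of ?K V]] by blast
  define \<alpha> where "\<alpha> = v \<bullet> (V *v v)"
  have le: "x \<bullet> (V *v x) \<le> \<alpha> * (x \<bullet> (A *v x))" if "x \<in> S" for x
  proof (cases "x = 0")
    case False
    have "x \<bullet> (V *v x) / (x \<bullet> (A *v x)) \<le> \<alpha>"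
      using vmax[OF scaled[OF that False]] pos_def_pos[OF A False]
      by (simp add: form_simps \<alpha>_def field_simps power2_eq_square[symmetric])
    then show ?thesis using pos_def_pos[OF A False] by (simp add: field_simps)
  qed simp
  define S' where "S' = {x \<in> S. v \<bullet> (A *v x) = 0}"
  have subS': "subspace S'"
    using subS unfolding S'_def subspace_def by (auto simp: form_simps)
  have V0: "v \<bullet> (V *v w) = 0" if "w \<in> S'" for w
  \<comment> \<open>First variation: \<open>le\<close> at \<open>v + t *\<^sub>R w\<close>, where
    the value at \<open>v\<close> is attained with equality, leaves a polynomial in \<open>t\<close>
    that is never positive and has linear coefficient
    \<open>2 * (v \<bullet> (V *v w))\<close>.\<close>
  proof (rule quadratic_nonpos_imp_zero[of _ "w \<bullet> (V *v w) - \<alpha> * (w \<bullet> (A *v w))"])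
    fix t
    have w: "w \<in> S" "v \<bullet> (A *v w) = 0" using that by (auto simp: S'_def)
    have "v + t *\<^sub>R w \<in> S" using v w subS by (auto intro: subspace_add subspace_scale)
    from le[OF this] show "2 * t * (v \<bullet> (V *v w)) + t\<^sup>2 * (w \<bullet> (V *v w) - \<alpha> * (w \<bullet> (A *v w))) \<le> 0"
      using v w sym_form_commute[OF V, of w v] sym_form_commute[OF pos_def_sym[OF A], of w v]
      by (simp add: form_simps \<alpha>_def power2_eq_square algebra_simps)
  qed
  have vS: "v \<in> S" and vA: "v \<bullet> (A *v v) = 1" using v by auto
  have "v \<notin> S'" using vA by (simp add: S'_def)
  have "S' \<subseteq> S" by (auto simp: S'_def)
  \<comment> \<open>Removing the \<open>v\<close>-component in the \<open>A\<close>-inner product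
    sends \<open>S\<close> into \<open>S'\<close>, so the dimension drops by exactly one.\<close>
  have "S \<subseteq> span (insert v S')"
  proof
    fix x assume "x \<in> S"
    have "x - (v \<bullet> (A *v x)) *\<^sub>R v \<in> S'"
      using \<open>x \<in> S\<close> vS vA subS by (auto simp: S'_def form_simps intro: subspace_diff subspace_scale)
    then show "x \<in> span (insert v S')" by (metis span_base span_breakdown_eq)
  qed
  then have "dim S \<le> dim (insert v S')" by (metis dim_span dim_subset)
  moreover have "v \<notin> span S'" using \<open>v \<notin> S'\<close> subS' span_eq_iff by metis
  moreover have "insert v S' \<subseteq> S" using vS \<open>S' \<subseteq> S\<close> by auto
  then have "dim (insert v S') \<le> dim S" by (rule dim_subset)
  ultimately have "dim S = Suc (dim S')" by (simp add: dim_insert)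
  then have "n = dim S'" using Suc.hyps(2) by simp
  from Suc.hyps(1)[OF this subS'] obtain B where B: "B \<subseteq> S'" "finite B" "card B = dim S'"
    "\<forall>b\<in>B. b \<bullet> (A *v b) = 1" "\<forall>b\<in>B. \<forall>c\<in>B. b \<noteq> c \<longrightarrow> b \<bullet> (A *v c) = 0 \<and> b \<bullet> (V *v c) = 0"
    by blast
  have "v \<notin> B" using B(1) \<open>v \<notin> S'\<close> by blast
  have orth: "v \<bullet> (A *v c) = 0 \<and> v \<bullet> (V *v c) = 0 \<and> c \<bullet> (A *v v) = 0 \<and> c \<bullet> (V *v v) = 0" if "c \<in> B" for c
    using that B(1) V0[of c] sym_form_commute[OF V, of c v] sym_form_commute[OF pos_def_sym[OF A], of c v]
    by (auto simp: S'_def)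
  show ?case
  proof (intro exI[of _ "insert v B"] conjI)
    show "insert v B \<subseteq> S" using B(1) \<open>S' \<subseteq> S\<close> vS by auto
    show "card (insert v B) = dim S" using B(2,3) \<open>v \<notin> B\<close> \<open>dim S = Suc (dim S')\<close> by simp
    show "\<forall>b\<in>insert v B. b \<bullet> (A *v b) = 1" using B(4) vA by simp
    show "\<forall>b\<in>insert v B. \<forall>c\<in>insert v B. b \<noteq> c \<longrightarrow> b \<bullet> (A *v c) = 0 \<and> b \<bullet> (V *v c) = 0"
      using B(5) orth by auto
  qed (use B in auto)
qed

text \<open>The basis is indexed by the coordinate type itself, so that its vectors can serve as the
  columns of a square matrix.\<close>

lemma simultaneous_diagonal:
  fixes A V :: "real^'n::finite^'n"
  assumes "pos_def A" "transpose V = V"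
  obtains e :: "'n \<Rightarrow> real^'n" and v :: "'n \<Rightarrow> real"
  where "\<And>i j. e i \<bullet> (A *v e j) = (if i = j then 1 else 0)"
    "\<And>i j. e i \<bullet> (V *v e j) = (if i = j then v i else 0)"
proof -
  obtain B :: "(real^'n) set" where B: "finite B" "card B = CARD('n)" "\<forall>b\<in>B. b \<bullet> (A *v b) = 1"
    "\<forall>b\<in>B. \<forall>c\<in>B. b \<noteq> c \<longrightarrow> b \<bullet> (A *v c) = 0 \<and> b \<bullet> (V *v c) = 0"
    using simultaneous_diagonal_subspace[OF assms subspace_UNIV] by auto
  then obtain e where e: "bij_betw e (UNIV::'n set) B"
    by (metis finite_same_card_bij finite_class.finite_UNIV)
  then have "e i \<in> B" for i by (auto simp: bij_betw_def)
  moreover have "e i \<noteq> e j" if "i \<noteq> j" for i j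
    using e that by (auto simp: bij_betw_def inj_on_def)
  ultimately show ?thesis
    using B by (intro that[of e "\<lambda>i. e i \<bullet> (V *v e i)"]) auto
qed

section \<open>Congruence of symmetric matrices to diagonal form\<close>

text \<open>Neither independence of \<open>e\<close> nor a sign of \<open>b\<close> is built in: the
  same vectors serve a positive definite and an indefinite matrix at once, and independence comes
  from the determinant identity when all \<open>b i\<close> are nonzero.\<close>

definition frame :: "real^'n^'n \<Rightarrow> ('n \<Rightarrow> real^'n) \<Rightarrow> ('n::finite \<Rightarrow> real) \<Rightarrow> bool" where
  "frame B e b \<longleftrightarrow> (\<forall>i j. e i \<bullet> (B *v e j) = (if i = j then b i else 0))"

definition cols :: "('n::finite \<Rightarrow> real^'n) \<Rightarrow> real^'n^'n" where
  "cols e = (\<chi> i j. e j $ i)"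

lemma frame_matrix:
  "frame B e b \<longleftrightarrow> transpose (cols e) ** B ** cols e = (\<chi> i j. if i = j then b i else 0)"
proof -
  have "(transpose (cols e) ** B ** cols e) $ i $ j = e i \<bullet> (B *v e j)" for i j
    unfolding cols_def
    by (simp add: matrix_matrix_mult_def transpose_def matrix_vector_mult_def inner_vec_def
        sum_distrib_left sum_distrib_right)
      (subst sum.swap, simp add: mult.assoc)
  then show ?thesis by (simp add: frame_def vec_eq_iff)
qed

lemma frame_det:
  assumes "frame B e b" shows "(det (cols e))\<^sup>2 * det B = (\<Prod>i\<in>UNIV. b i)"
proof -
  have "det (transpose (cols e) ** B ** cols e) = (\<Prod>i\<in>UNIV. b i)"
    using assms unfolding frame_matrix by (simp add: det_diagonal)
  then show ?thesis by (simp add: det_mul power2_eq_square mult_ac)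
qed

lemma frame_inverse_form:
  fixes B :: "real^'n::finite^'n"
  assumes fr: "frame B e b" and b: "\<And>i. b i \<noteq> 0" and "transpose B = B"
  shows "z \<bullet> (matrix_inv B *v z) = (\<Sum>i\<in>UNIV. (e i \<bullet> z)\<^sup>2 / b i)"
    and "matrix_inv B = cols e ** (\<chi> i j. if i = j then 1 / b i else 0) ** transpose (cols e)"
proof -
  let ?N = "cols e"
  define D :: "real^'n^'n" where "D = (\<chi> i j. if i = j then 1 / b i else 0)"
  have "(\<chi> i j. if i = j then b i else 0) ** D = mat 1"
    using b by (auto simp: D_def matrix_matrix_mult_def mat_def vec_eq_iff if_distrib[of "\<lambda>x. x * _"]
        sum.delta' cong: if_cong)
  then have "transpose ?N ** (B ** (?N ** D)) = mat 1"
    using fr unfolding frame_matrix by (metis matrix_mul_assoc)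
  \<comment> \<open>A one-sided inverse of a square matrix is two-sided; this moves the transposed
    factor to the right.\<close>
  then have "(B ** (?N ** D)) ** transpose ?N = mat 1"
    by (rule matrix_left_right_inverse[THEN iffD1])
  then have "B ** (?N ** D ** transpose ?N) = mat 1"
    by (simp add: matrix_mul_assoc)
  then have inv: "matrix_inv B = ?N ** D ** transpose ?N" by (rule matrix_inv_eqI)
  then show "matrix_inv B = ?N ** (\<chi> i j. if i = j then 1 / b i else 0) ** transpose ?N"
    by (simp add: D_def)
  from inv have "z \<bullet> (matrix_inv B *v z) = (transpose ?N *v z) \<bullet> (D *v (transpose ?N *v z))"
    by (simp add: matrix_vector_mul_assoc[symmetric] dot_lmul_matrix)
  also have "\<dots> = (\<Sum>i\<in>UNIV. ((transpose ?N *v z) $ i)\<^sup>2 / b i)"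
    unfolding inner_vec_def
    by (intro sum.cong refl)
      (simp add: D_def matrix_vector_mult_def if_distrib[of "\<lambda>x. x * _"] power2_eq_square cong: if_cong)
  also have "\<dots> = (\<Sum>i\<in>UNIV. (e i \<bullet> z)\<^sup>2 / b i)"
    by (simp only: matrix_vector_mult_def transpose_def inner_vec_def cols_def vec_lambda_beta)
      (simp add: inner_real_def)
  finally show "z \<bullet> (matrix_inv B *v z) = (\<Sum>i\<in>UNIV. (e i \<bullet> z)\<^sup>2 / b i)" .
qed

lemma cols_transpose_apply: "(transpose (cols e) *v z) $ i = e i \<bullet> z"
  unfolding matrix_vector_mult_def transpose_def inner_vec_def cols_def by (simp add: inner_real_def)

lemma diagonal_form:
  fixes x :: "real^'n::finite"
  shows "x \<bullet> ((\<chi> i j. if i = j then b i else 0) *v x) = (\<Sum>i\<in>UNIV. b i * (x $ i)\<^sup>2)"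
  unfolding inner_vec_def
  by (intro sum.cong refl)
    (simp add: matrix_vector_mult_def if_distrib[of "\<lambda>x. x * _"] power2_eq_square cong: if_cong)

lemma cols_form: "y \<bullet> ((transpose (cols e) ** B ** cols e) *v y) = (cols e *v y) \<bullet> (B *v (cols e *v y))"
  for B :: "real^'n::finite^'n"
  by (metis dot_lmul_matrix inner_commute matrix_vector_mul_assoc transpose_matrix_vector)

lemma frame_form: "frame B e b \<Longrightarrow> (cols e *v y) \<bullet> (B *v (cols e *v y)) = (\<Sum>i\<in>UNIV. b i * (y $ i)\<^sup>2)"
  unfolding frame_matrix cols_form[symmetric] by (simp add: diagonal_form)

text \<open>By \<open>frame_det\<close> the product of the \<open>b i\<close> is a multiple of
  \<open>det (cols e)\<close>, so \<open>cols e\<close> is invertible; in the resulting coordinates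
  the form is a positively weighted sum of squares.\<close>

lemma frame_pos_def:
  assumes fr: "frame B e b" and b: "\<And>i. b i > 0" and sym: "transpose B = B"
  shows "pos_def B"
  unfolding pos_def_def
proof (intro conjI sym allI impI)
  fix x :: "real^'a" assume x: "x \<noteq> 0"
  have "(det (cols e))\<^sup>2 * det B > 0"
    unfolding frame_det[OF fr] using b by (simp add: prod_pos)
  then have "det (cols e) \<noteq> 0" by auto
  then have "invertible (cols e)" by (simp add: invertible_det_nz)
  then obtain y where y: "x = cols e *v y"
    by (metis invertible_inv_right matrix_vector_mul_assoc matrix_vector_mul_lid)
  then have "y \<noteq> 0" using x by auto
  then obtain k where "y $ k \<noteq> 0" by (metis vec_eq_iff zero_index)
  have "x \<bullet> (B *v x) = (\<Sum>i\<in>UNIV. b i * (y $ i)\<^sup>2)" unfolding y by (rule frame_form[OF fr])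
  also have "\<dots> > 0"
    using b \<open>y $ k \<noteq> 0\<close> by (intro sum_pos2[of _ k] mult_nonneg_nonneg mult_pos_pos) (simp_all add: less_imp_le)
  finally show "0 < x \<bullet> (B *v x)" .
qed

text \<open>An \<open>A\<close>-orthonormal frame makes \<open>A\<close> congruent to the identity,
  so \<open>det A\<close> times a square equals 1.\<close>

lemma pos_def_det_pos:
  assumes "pos_def A" shows "det A > 0"
proof -
  obtain e where "frame A e (\<lambda>_. 1)"
    using simultaneous_diagonal[OF assms pos_def_sym[OF assms]] unfolding frame_def by metis
  from frame_det[OF this] have "(det (cols e))\<^sup>2 * det A = 1" by simp
  then show ?thesis by (metis mult_less_0_iff not_less_iff_gr_or_eq not_one_less_zero not_square_less_zero power2_eq_square zero_less_one mult_eq_0_iff zero_neq_one)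
qed

text \<open>All three identities come from \<open>matrix_inv A = N ** transpose N\<close> with
  \<open>N = cols e\<close>.\<close>

lemma frame_identity:
  assumes A: "pos_def A" and fA: "frame A e (\<lambda>_. 1)" and fV: "frame V e v"
  shows "z \<bullet> (matrix_inv A *v z) = (\<Sum>i\<in>UNIV. (e i \<bullet> z)\<^sup>2)"
    and "trace (matrix_inv A ** V) = (\<Sum>i\<in>UNIV. v i)"
    and "(matrix_inv A *v z) \<bullet> (V *v (matrix_inv A *v z)) = (\<Sum>i\<in>UNIV. v i * (e i \<bullet> z)\<^sup>2)"
proof -
  note inv = frame_inverse_form[OF fA _ pos_def_sym[OF A]]
  show "z \<bullet> (matrix_inv A *v z) = (\<Sum>i\<in>UNIV. (e i \<bullet> z)\<^sup>2)"
    by (subst inv(1)) auto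
  have "(\<chi> i j. if i = j then 1 / 1 else 0) = (mat 1 :: real^'a^'a)"
    unfolding mat_def by (simp only: div_by_1)
  then have C: "matrix_inv A = cols e ** transpose (cols e)"
    by (subst inv(2)) (simp_all only: matrix_mul_rid one_neq_zero not_False_eq_True)
  have "trace (matrix_inv A ** V) = trace (transpose (cols e) ** V ** cols e)"
    unfolding C by (metis matrix_mul_assoc trace_mul_sym)
  also have "\<dots> = (\<Sum>i\<in>UNIV. v i)"
    using fV unfolding frame_matrix by (simp add: trace_def)
  finally show "trace (matrix_inv A ** V) = (\<Sum>i\<in>UNIV. v i)" .
  have "matrix_inv A *v z = cols e *v (transpose (cols e) *v z)"
    unfolding C by (simp only: matrix_vector_mul_assoc)
  then show "(matrix_inv A *v z) \<bullet> (V *v (matrix_inv A *v z)) = (\<Sum>i\<in>UNIV. v i * (e i \<bullet> z)\<^sup>2)"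
    by (simp only: frame_form[OF fV] cols_transpose_apply)
qed

text \<open>The whole line \<open>A + t *\<^sub>R V\<close> is diagonal in one fixed frame, with
  entries \<open>1 + t * v i\<close>; no derivative of a determinant or of an inverse is needed
  beyond that.\<close>

lemma frame_perturb:
  assumes A: "pos_def A" and fA: "frame A e (\<lambda>_. 1)" and fV: "frame V e v" and V: "transpose V = V"
    and t: "\<And>i. 1 + t * v i > 0"
  shows "pos_def (A + t *\<^sub>R V)"
    and "z \<bullet> (matrix_inv (A + t *\<^sub>R V) *v z) = (\<Sum>i\<in>UNIV. (e i \<bullet> z)\<^sup>2 / (1 + t * v i))"
    and "det (A + t *\<^sub>R V) = det A * (\<Prod>i\<in>UNIV. 1 + t * v i)"
proof -
  have fr: "frame (A + t *\<^sub>R V) e (\<lambda>i. 1 + t * v i)"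
    using fA fV unfolding frame_def
    by (auto simp: matrix_vector_mult_add_rdistrib inner_add_right scaleR_matrix_vector_assoc[symmetric])
  have sym: "transpose (A + t *\<^sub>R V) = A + t *\<^sub>R V"
    using pos_def_sym[OF A] V by (simp add: transpose_def vec_eq_iff)
  show "pos_def (A + t *\<^sub>R V)" by (rule frame_pos_def[OF fr t sym])
  show "z \<bullet> (matrix_inv (A + t *\<^sub>R V) *v z) = (\<Sum>i\<in>UNIV. (e i \<bullet> z)\<^sup>2 / (1 + t * v i))"
    using t by (intro frame_inverse_form(1)[OF fr _ sym]) (metis less_irrefl)
  have "(det (cols e))\<^sup>2 * det A = 1" using frame_det[OF fA] by simp
  then show "det (A + t *\<^sub>R V) = det A * (\<Prod>i\<in>UNIV. 1 + t * v i)"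
    using frame_det[OF fr] by (metis mult.assoc mult.commute mult.left_neutral)
qed

section \<open>Differentiation under the integral\<close>

text \<open>With the relative error \<open>x\<close>, the second-order bound gives
  \<open>\<bar>ln (1 + x)\<bar> \<le> \<bar>x\<bar> + 2 * x\<^sup>2\<close>, and the last term is at
  most \<open>\<bar>x\<bar>\<close> for \<open>\<bar>x\<bar> \<le> 1 / 2\<close>; hence the factor
  2.\<close>

lemma abs_ln_ratio_le:
  fixes a b :: real
  assumes "a > 0" "\<bar>b - a\<bar> \<le> k * a" "k \<le> 1 / 2"
  shows "\<bar>ln b - ln a\<bar> \<le> 2 * k"
proof -
  define x where "x = (b - a) / a"
  have x: "\<bar>x\<bar> \<le> k" using assms by (simp add: x_def field_simps)
  then have x': "\<bar>x\<bar> \<le> 1 / 2" using assms(3) by simp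
  have "b = a * (1 + x)" using assms(1) by (simp add: x_def field_simps)
  moreover have "1 + x > 0" using x' by (simp add: abs_le_iff)
  ultimately have "ln b - ln a = ln (1 + x)" using assms(1) by (simp add: ln_mult)
  moreover have "\<bar>ln (1 + x) - x\<bar> \<le> 2 * x\<^sup>2" by (rule abs_ln_one_plus_x_minus_x_bound[OF x'])
  moreover have "2 * x\<^sup>2 \<le> \<bar>x\<bar>" 
  proof -
    have "\<bar>x\<bar> * \<bar>x\<bar> \<le> \<bar>x\<bar> * (1/2)" using x' by (intro mult_left_mono) auto
    then show ?thesis by (simp add: power2_eq_square)
  qed
  ultimately show ?thesis using x by linarith
qed

text \<open>The change of \<open>q\<close> is bounded relative to \<open>c + q 0 x\<close>, so the
  difference quotients of the logarithm stay below \<open>2 * K\<close> uniformly in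
  \<open>x\<close>, and a constant dominates them on a finite measure. The term \<open>r\<close>
  serves only to make the integrals finite; it cancels in the quotients.\<close>

lemma has_derivative_integral_ln:
  fixes q :: "real \<Rightarrow> 'a \<Rightarrow> real"
  assumes "finite_measure M" and "0 < c" "0 < d" "0 \<le> K"
    and meas: "\<And>t. \<bar>t\<bar> < d \<Longrightarrow> q t \<in> borel_measurable M"
    and meas': "q' \<in> borel_measurable M" "r \<in> borel_measurable M"
    and nn: "\<And>x. 0 \<le> q 0 x"
    and le: "\<And>t x. \<bar>t\<bar> < d \<Longrightarrow> \<bar>q t x - q 0 x\<bar> \<le> K * \<bar>t\<bar> * (c + q 0 x)"
    and der: "\<And>x. ((\<lambda>t. q t x) has_real_derivative q' x) (at 0)"
    and int: "integrable M (\<lambda>x. ln (c + q 0 x) - r x)"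
  shows "((\<lambda>t. \<integral>x. ln (c + q t x) - r x \<partial>M) has_real_derivative (\<integral>x. q' x / (c + q 0 x) \<partial>M)) (at 0)"
proof -
  interpret finite_measure M by fact
  \<comment> \<open>The second bound ensures \<open>K * \<bar>t\<bar> \<le> 1 / 2\<close>, as
    \<open>abs_ln_ratio_le\<close> requires.\<close>
  define \<delta> where "\<delta> = min d (1 / (2 * K + 2))"
  have \<delta>: "0 < \<delta>" using assms by (simp add: \<delta>_def)
  have pos: "0 < c + q 0 x" for x using nn[of x] \<open>0 < c\<close> by simp
  have q0[measurable]: "q 0 \<in> borel_measurable M" using meas[of 0] \<open>0 < d\<close> by simp
  note meas'[measurable]
  define D where "D t x = (ln (c + q t x) - ln (c + q 0 x)) / t" for t x
  have small: "\<bar>ln (c + q t x) - ln (c + q 0 x)\<bar> \<le> 2 * (K * \<bar>t\<bar>)" if "\<bar>t\<bar> < \<delta>" for t x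
  proof (rule abs_ln_ratio_le[OF pos])
    show "\<bar>c + q t x - (c + q 0 x)\<bar> \<le> K * \<bar>t\<bar> * (c + q 0 x)"
      using le[of t x] that by (simp add: \<delta>_def)
    have "K * \<bar>t\<bar> \<le> K * (1 / (2 * K + 2))"
      using that \<open>0 \<le> K\<close> by (intro mult_left_mono) (auto simp: \<delta>_def)
    also have "\<dots> \<le> 1 / 2" using \<open>0 \<le> K\<close> by (simp add: field_simps)
    finally show "K * \<bar>t\<bar> \<le> 1 / 2" .
  qed
  have Dmeas: "D t \<in> borel_measurable M" if "\<bar>t\<bar> < \<delta>" for t
  proof -
    have [measurable]: "q t \<in> borel_measurable M" using that by (intro meas) (simp add: \<delta>_def)
    show ?thesis unfolding D_def by measurable
  qed
  have Dle: "norm (D t x) \<le> 2 * K" if "\<bar>t\<bar> < \<delta>" for t x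
  proof (cases "t = 0")
    case True then show ?thesis using \<open>0 \<le> K\<close> by (simp add: D_def)
  next
    case False then show ?thesis using small[OF that, of x] by (simp add: D_def field_simps)
  qed
  have Dint: "integrable M (D t)" if "\<bar>t\<bar> < \<delta>" for t
    using Dle[OF that] Dmeas[OF that] by (intro integrable_const_bound[of _ "2 * K"]) auto
  have eq: "((\<integral>x. ln (c + q (0 + t) x) - r x \<partial>M) - (\<integral>x. ln (c + q 0 x) - r x \<partial>M)) / t = (\<integral>x. D t x \<partial>M)"
    if "\<bar>t\<bar> < \<delta>" "t \<noteq> 0" for t
  proof -
    \<comment> \<open>Integrability at \<open>t\<close> is inherited from \<open>t = 0\<close>, the
      difference being \<open>t\<close> times a bounded function.\<close>
    have "integrable M (\<lambda>x. t * D t x + (ln (c + q 0 x) - r x))"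
      using Dint[OF that(1)] int by auto
    then have "integrable M (\<lambda>x. ln (c + q t x) - r x)"
      using that by (simp add: D_def)
    then have "(\<integral>x. ln (c + q t x) - r x \<partial>M) - (\<integral>x. ln (c + q 0 x) - r x \<partial>M)
        = (\<integral>x. (ln (c + q t x) - r x) - (ln (c + q 0 x) - r x) \<partial>M)"
      using int by (simp only: Bochner_Integration.integral_diff)
    also have "\<dots> = (\<integral>x. t * D t x \<partial>M)"
      using that by (intro Bochner_Integration.integral_cong) (auto simp: D_def)
    finally show ?thesis using that by simp
  qed
  have lim: "((\<lambda>t. D t x) \<longlongrightarrow> q' x / (c + q 0 x)) (at 0)" for x
  proof -
    have "((\<lambda>t. ln (c + q t x)) has_real_derivative q' x / (c + q 0 x)) (at 0)"
      using der[of x] pos[of x] by (auto intro!: derivative_eq_intros)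
    then show ?thesis by (simp add: DERIV_def D_def)
  qed
  \<comment> \<open>Dominated convergence is applied along sequences inside the interval; since the
    interval is open, its limit at 0 is the unrestricted one.\<close>
  have "((\<lambda>t. \<integral>x. D t x \<partial>M) \<longlongrightarrow> (\<integral>x. q' x / (c + q 0 x) \<partial>M)) (at 0 within {-\<delta><..<\<delta>})"
    unfolding tendsto_at_iff_sequentially comp_def
  proof (intro allI impI)
    fix X :: "nat \<Rightarrow> real" assume X: "\<forall>i. X i \<in> {-\<delta><..<\<delta>} - {0}" and X0: "X \<longlonglongrightarrow> 0"
    have Xs: "\<bar>X i\<bar> < \<delta>" for i using X[rule_format, of i] by (simp add: abs_less_iff)
    show "(\<lambda>n. \<integral>x. D (X n) x \<partial>M) \<longlonglongrightarrow> (\<integral>x. q' x / (c + q 0 x) \<partial>M)"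
    proof (rule integral_dominated_convergence[where w = "\<lambda>_. 2 * K"])
      show "AE x in M. (\<lambda>n. D (X n) x) \<longlonglongrightarrow> q' x / (c + q 0 x)"
      proof (rule AE_I2)
        fix x
        have "filterlim X (at 0) sequentially"
          using X X0 by (auto simp: filterlim_at)
        then show "(\<lambda>n. D (X n) x) \<longlonglongrightarrow> q' x / (c + q 0 x)"
          by (rule filterlim_compose[OF lim])
      qed
    qed (use Dmeas Dle Xs in auto)
  qed
  then have "((\<lambda>t. \<integral>x. D t x \<partial>M) \<longlongrightarrow> (\<integral>x. q' x / (c + q 0 x) \<partial>M)) (at 0)"
    using \<delta> by (subst (asm) tendsto_within_open) auto
  moreover have "eventually (\<lambda>t. (\<integral>x. D t x \<partial>M)
      = ((\<integral>x. ln (c + q (0 + t) x) - r x \<partial>M) - (\<integral>x. ln (c + q 0 x) - r x \<partial>M)) / t) (at 0)"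
    unfolding eventually_at using eq \<delta> by (intro exI[of _ \<delta>]) (auto simp: dist_real_def)
  ultimately show ?thesis
    unfolding DERIV_def by (rule tendsto_cong[THEN iffD1, rotated])
qed

lemma ext_int_integrable:
  assumes "integrable M f" shows "ext_int M f = ereal (\<integral>x. f x \<partial>M)"
proof -
  have fin: "(\<integral>\<^sup>+ x. ennreal (f x) \<partial>M) \<noteq> \<infinity>" "(\<integral>\<^sup>+ x. ennreal (- f x) \<partial>M) \<noteq> \<infinity>"
    using assms unfolding real_integrable_def by auto
  then show ?thesis
    unfolding ext_int_def real_lebesgue_integral_def[OF assms]
    by (metis enn2ereal_ennreal enn2real_nonneg ennreal_enn2real infinity_ennreal_def ereal_minus(1) less_top)
qed

section \<open>The objective function of a law\<close>

text \<open>Because \<open>r \<le> 1\<close>, the factor can be applied to the constant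
  \<open>c\<close> as well, which makes the bound independent of \<open>s\<close>. The condition
  \<open>1 \<le> R\<close> plays the same part in \<open>ln_ratio_le\<close>.\<close>

lemma ln_ratio_ge:
  fixes f s c r :: real
  assumes "0 < c" "0 \<le> s" "0 < r" "r \<le> 1" "r * s \<le> f"
  shows "ln r \<le> ln (c + f) - ln (c + s)"
proof -
  have pos: "c + s > 0" "r * (c + s) > 0" using assms by auto
  have "r * c \<le> c" using assms by auto
  then have "r * (c + s) \<le> c + f" using assms(5) unfolding distrib_left by linarith
  then have "ln (r * (c + s)) \<le> ln (c + f)" using pos(2) by simp
  then show ?thesis using assms pos by (simp add: ln_mult)
qed

lemma ln_ratio_le:
  fixes f s c R :: real
  assumes "0 < c" "0 \<le> f" "0 \<le> s" "1 \<le> R" "f \<le> R * s"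
  shows "ln (c + f) - ln (c + s) \<le> ln R"
proof -
  have pos: "c + s > 0" "c + f > 0" using assms by auto
  have "c \<le> R * c" using assms by auto
  then have "c + f \<le> R * (c + s)" using assms(5) unfolding distrib_left by linarith
  then have "ln (c + f) \<le> ln (R * (c + s))" using pos(2) by simp
  then show ?thesis using assms pos by (simp add: ln_mult)
qed

text \<open>An off-diagonal direction moves two entries and a diagonal one only one; the nested
  conditionals keep the diagonal entry from being counted twice.\<close>

lemma sum_sym_unit:
  fixes f :: "'n::finite \<Rightarrow> 'n \<Rightarrow> real"
  assumes "f i j = f j i"
  shows "(\<Sum>k\<in>UNIV. \<Sum>l\<in>UNIV. sym_unit i j $ k $ l * f k l) = (if i = j then 1 else 2) * f i j"
proof -
  have "sym_unit i j $ k $ l * f k l = (if l = j then if k = i then f i j else 0 else 0)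
      + (if l = i then if k = j then if i = j then 0 else f j i else 0 else 0)" for k l
    by (auto simp: sym_unit_def)
  then show ?thesis using assms by (simp add: sum.distrib)
qed

lemma form_double_sum: "y \<bullet> (V *v y) = (\<Sum>k\<in>UNIV. \<Sum>l\<in>UNIV. V $ k $ l * (y $ k * y $ l))"
  for V :: "real^'n::finite^'n"
  unfolding inner_vec_def matrix_vector_mult_def vec_lambda_beta inner_real_def sum_distrib_left
  by (intro sum.cong refl) simp

lemma sym_unit_form: "y \<bullet> (sym_unit i j *v y) = (if i = j then 1 else 2) * (y $ i * y $ j)"
  unfolding form_double_sum by (rule sum_sym_unit) simp

lemma sym_unit_sym: "transpose (sym_unit i j) = sym_unit i j"
  by (auto simp: sym_unit_def transpose_def vec_eq_iff)

lemma trace_sym_unit: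
  assumes "transpose C = C"
  shows "trace (C ** sym_unit i j) = (if i = j then 1 else 2) * C $ i $ j"
proof -
  have C: "C $ k $ l = C $ l $ k" for k l using assms by (auto simp: transpose_def vec_eq_iff)
  have "trace (C ** sym_unit i j) = trace (sym_unit i j ** C)" by (rule trace_mul_sym)
  also have "\<dots> = (\<Sum>k\<in>UNIV. \<Sum>l\<in>UNIV. sym_unit i j $ k $ l * C $ l $ k)"
    by (simp add: trace_def matrix_matrix_mult_def)
  also have "\<dots> = (if i = j then 1 else 2) * C $ j $ i"
    by (rule sum_sym_unit[where f = "\<lambda>k l. C $ l $ k"]) (rule C)
  finally show ?thesis using C by metis
qed

text \<open>Used for two laws with the same \<open>a0 = nu + d\<close>: the lifted law in dimension
  \<open>d + 1\<close> with \<open>lam = nu - 1\<close>, and the law of \<open>y - mu\<close> in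
  dimension \<open>d\<close> with \<open>lam = nu\<close>.\<close>

locale law = prob_space M for M :: "(real^'n::finite) measure" +
  fixes lam a0 :: real
  assumes sets_M: "sets M = sets borel" and lam: "0 < lam" and a0: "a0 = lam + real CARD('n)"
begin

abbreviation wt :: "real^'n^'n \<Rightarrow> real^'n \<Rightarrow> real" where
  "wt A z \<equiv> uw lam (real CARD('n)) (z \<bullet> (matrix_inv A *v z))"

text \<open>A real-valued form of \<open>Qh\<close> on positive definite matrices: the integrand is
  bounded there, whatever the law.\<close>

definition obj :: "real^'n^'n \<Rightarrow> real" where
  "obj A = ln (det A) / 2
     + a0 / 2 * (\<integral>z. ln (lam + z \<bullet> (matrix_inv A *v z)) - ln (lam + z \<bullet> z) \<partial>M)"

text \<open>The matrix equation \<open>A = \<integral> u zz'\<close>, tested against each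
  \<open>x\<close> as a quadratic form so that only scalar integrals occur.\<close>

definition crit_eq :: "real^'n^'n \<Rightarrow> bool" where
  "crit_eq A \<longleftrightarrow> pos_def A \<and> (\<forall>x. x \<bullet> (A *v x) = (\<integral>z. wt A z * (x \<bullet> z)\<^sup>2 \<partial>M))"

text \<open>The candidate for the derivative of \<open>obj\<close> along \<open>V\<close>: the trace
  comes from \<open>ln (det A)\<close>, the integral from the derivative
  \<open>- A\<inverse> V A\<inverse>\<close> of the inverse.\<close>

definition dir_deriv :: "real^'n^'n \<Rightarrow> real^'n^'n \<Rightarrow> real" where
  "dir_deriv A V = (trace (matrix_inv A ** V)
     - (\<integral>z. wt A z * ((matrix_inv A *v z) \<bullet> (V *v (matrix_inv A *v z))) \<partial>M)) / 2"

lemma a0_pos: "0 < a0" using lam unfolding a0 by (simp add: add_pos_nonneg)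

lemma measurable_continuous: "continuous_on UNIV f \<Longrightarrow> f \<in> borel_measurable M"
  for f :: "real^'n \<Rightarrow> real"
  using borel_measurable_continuous_onI measurable_cong_sets[OF sets_M refl] by blast

lemma measurable_form [measurable]: "(\<lambda>z. z \<bullet> (C *v z)) \<in> borel_measurable M"
  by (intro measurable_continuous continuous_form)

lemma measurable_inner [measurable]: "(\<lambda>z. x \<bullet> z) \<in> borel_measurable M"
  by (intro measurable_continuous continuous_intros)

lemma measurable_self_inner [measurable]: "(\<lambda>z. z \<bullet> z) \<in> borel_measurable M"
  by (intro measurable_continuous continuous_intros)

lemma measurable_inv_form [measurable]:
  "(\<lambda>z. (C *v z) \<bullet> (V *v (C *v z))) \<in> borel_measurable M"
  by (intro measurable_continuous continuous_on_compose2[OF continuous_form[of UNIV V]])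
    (auto intro: linear_continuous_on linear_conv_bounded_linear[THEN iffD1])

lemma measurable_wt [measurable]: "wt A \<in> borel_measurable M"
  unfolding uw_def by measurable

lemma wt_pos: "pos_def A \<Longrightarrow> 0 < wt A z"
  using pos_def_nonneg[OF pos_def_inv, of A z] lam a0_pos unfolding uw_def a0
  by (intro divide_pos_pos) auto

text \<open>Clearing the denominator of \<open>u(s) = a0 / (lam + s)\<close>. Since
  \<open>u > 0\<close>, it yields the strict bound \<open>u(s) * s < a0\<close>, the source of
  integrability and of the strict inequality in \<open>spread\<close>.\<close>

lemma wt_form: "pos_def A \<Longrightarrow> wt A z * (z \<bullet> (matrix_inv A *v z)) = a0 - lam * wt A z"
  using pos_def_nonneg[OF pos_def_inv, of A z] lam unfolding uw_def a0
  by (simp add: field_simps add_pos_nonneg)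

lemma wt_form_less: "pos_def A \<Longrightarrow> wt A z * (z \<bullet> (matrix_inv A *v z)) < a0"
  using wt_form[of A z] wt_pos[of A z] lam by simp

text \<open>The weight decays like the reciprocal of the inverse form and so compensates the
  quadratic growth of \<open>g\<close>.\<close>

lemma integrable_wt_times:
  assumes "pos_def A" and [measurable]: "g \<in> borel_measurable M"
    and "\<And>z. \<bar>g z\<bar> \<le> K * (z \<bullet> (matrix_inv A *v z))"
  shows "integrable M (\<lambda>z. wt A z * g z)"
proof (rule integrable_const_bound[of _ "\<bar>K\<bar> * a0"])
  show "AE z in M. norm (wt A z * g z) \<le> \<bar>K\<bar> * a0"
  proof (rule AE_I2)
    fix z
    let ?s = "z \<bullet> (matrix_inv A *v z)"
    have "?s \<ge> 0" using pos_def_nonneg[OF pos_def_inv[OF assms(1)]] .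
    then have "K * ?s \<le> \<bar>K\<bar> * ?s" by (intro mult_right_mono) auto
    then have "\<bar>g z\<bar> \<le> \<bar>K\<bar> * ?s" using assms(3)[of z] by linarith
    then have "wt A z * \<bar>g z\<bar> \<le> wt A z * (\<bar>K\<bar> * ?s)"
      using wt_pos[OF assms(1), of z] by (intro mult_left_mono) auto
    also have "\<dots> = \<bar>K\<bar> * (wt A z * ?s)" by (simp add: mult_ac)
    also have "\<dots> \<le> \<bar>K\<bar> * a0"
      using wt_form_less[OF assms(1), of z] by (intro mult_left_mono) auto
    finally show "norm (wt A z * g z) \<le> \<bar>K\<bar> * a0"
      using wt_pos[OF assms(1), of z] by (simp add: abs_mult)
  qed
qed measurable

lemma integrable_wt_form: "pos_def A \<Longrightarrow> integrable M (\<lambda>z. wt A z * (z \<bullet> (matrix_inv A *v z)))"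
  using pos_def_nonneg[OF pos_def_inv] by (intro integrable_wt_times[of _ _ 1]) auto

lemma integrable_wt: "pos_def A \<Longrightarrow> integrable M (wt A)"
proof -
  assume A: "pos_def A"
  have "wt A z = (a0 - wt A z * (z \<bullet> (matrix_inv A *v z))) / lam" for z
    using wt_form[OF A, of z] lam by (simp add: field_simps)
  moreover have "integrable M (\<lambda>z. (a0 - wt A z * (z \<bullet> (matrix_inv A *v z))) / lam)"
    using integrable_wt_form[OF A] by (intro integrable_divide integrable_diff) auto
  ultimately show ?thesis by presburger
qed

lemma integrable_wt_sq: "pos_def A \<Longrightarrow> integrable M (\<lambda>z. wt A z * (x \<bullet> z)\<^sup>2)"
  using form_Cauchy_Schwarz[of A x] by (intro integrable_wt_times[of _ _ "x \<bullet> (A *v x)"]) auto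

lemma ln_form_bounded:
  assumes "pos_def C"
  obtains K where "\<And>z. \<bar>ln (lam + z \<bullet> (C *v z)) - ln (lam + z \<bullet> z)\<bar> \<le> K"
proof -
  obtain r R where r: "0 < r" "\<And>x. r * (x \<bullet> x) \<le> x \<bullet> (C *v x)"
    "\<And>x. x \<bullet> (C *v x) \<le> R * (x \<bullet> x)"
    using form_bounds[OF assms] by metis
  have 1: "min r 1 * (x \<bullet> x) \<le> x \<bullet> (C *v x)" for x
    using r(2)[of x] mult_right_mono[of "min r 1" r "x \<bullet> x"] by auto
  have 2: "x \<bullet> (C *v x) \<le> max R 1 * (x \<bullet> x)" for x
    using r(3)[of x] mult_right_mono[of R "max R 1" "x \<bullet> x"] by auto
  show ?thesis
  proof
    fix z
    have *: "ln (min r 1) \<le> ln (lam + z \<bullet> (C *v z)) - ln (lam + z \<bullet> z)"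
      "ln (lam + z \<bullet> (C *v z)) - ln (lam + z \<bullet> z) \<le> ln (max R 1)"
      using ln_ratio_ge[OF lam _ _ _ 1] ln_ratio_le[OF lam _ _ _ 2] r(1) pos_def_nonneg[OF assms]
      by auto
    then show "\<bar>ln (lam + z \<bullet> (C *v z)) - ln (lam + z \<bullet> z)\<bar> \<le> \<bar>ln (min r 1)\<bar> + \<bar>ln (max R 1)\<bar>"
      by linarith
  qed
qed

lemma integrable_ln_form:
  assumes "pos_def C"
  shows "integrable M (\<lambda>z. ln (lam + z \<bullet> (C *v z)) - ln (lam + z \<bullet> z))"
proof -
  obtain K where "\<And>z. \<bar>ln (lam + z \<bullet> (C *v z)) - ln (lam + z \<bullet> z)\<bar> \<le> K"
    using ln_form_bounded[OF assms] by blast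
  then show ?thesis by (intro integrable_const_bound[of _ K]) auto
qed

text \<open>In a frame for \<open>A\<close> and \<open>V\<close> the objective along the line is the
  explicit function \<open>F\<close> below: a sum of \<open>ln (1 + t * v i)\<close> plus an
  integral covered by \<open>has_derivative_integral_ln\<close>.\<close>

lemma obj_has_deriv:
  assumes A: "pos_def A" and V: "transpose V = V"
  obtains d where "0 < d" "\<And>t. \<bar>t\<bar> < d \<Longrightarrow> pos_def (A + t *\<^sub>R V)"
    and "((\<lambda>t. obj (A + t *\<^sub>R V)) has_real_derivative dir_deriv A V) (at 0)"
    and "integrable M (\<lambda>z. wt A z * ((matrix_inv A *v z) \<bullet> (V *v (matrix_inv A *v z))))"
proof -
  obtain e v where fA: "frame A e (\<lambda>_. 1)" and fV: "frame V e v"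
    using simultaneous_diagonal[OF A V] unfolding frame_def by metis
  note id = frame_identity[OF A fA fV]
  \<comment> \<open>The summand 1 keeps \<open>m\<close> positive even when all \<open>v i\<close>
    vanish.\<close>
  define m where "m = 1 + (\<Sum>i\<in>UNIV. \<bar>v i\<bar>)"
  have m: "\<bar>v i\<bar> \<le> m" for i
    using member_le_sum[of i UNIV "\<lambda>i. \<bar>v i\<bar>"] by (auto simp: m_def)
  have "m > 0" by (simp add: m_def add_pos_nonneg sum_nonneg)
  \<comment> \<open>For \<open>\<bar>t\<bar> < d\<close> every \<open>1 + t * v i\<close> is at
    least 1/2; its reciprocal is then at most 2, which produces the constant
    \<open>2 * m\<close>.\<close>
  define d where "d = 1 / (2 * m)"
  have d: "d > 0" using \<open>m > 0\<close> by (simp add: d_def)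
  have half: "\<bar>t * v i\<bar> \<le> 1 / 2" if "\<bar>t\<bar> < d" for t i
  proof -
    have "\<bar>t\<bar> * \<bar>v i\<bar> \<le> d * m" using that m \<open>d > 0\<close> by (intro mult_mono) auto
    also have "\<dots> = 1 / 2" using \<open>m > 0\<close> by (simp add: d_def)
    finally show ?thesis by (simp add: abs_mult)
  qed
  then have pos: "1 + t * v i > 0" if "\<bar>t\<bar> < d" for t i
    using half[OF that, of i] unfolding abs_le_iff by linarith
  note pert = frame_perturb[OF A fA fV V pos]
  define q where "q t z = (\<Sum>i\<in>UNIV. (e i \<bullet> z)\<^sup>2 / (1 + t * v i))" for t z
  define q' where "q' z = - (\<Sum>i\<in>UNIV. v i * (e i \<bullet> z)\<^sup>2)" for z
  have q0: "q 0 z = z \<bullet> (matrix_inv A *v z)" for z by (simp add: q_def id(1))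
  have deriv: "((\<lambda>t. \<integral>z. ln (lam + q t z) - ln (lam + z \<bullet> z) \<partial>M)
      has_real_derivative (\<integral>z. q' z / (lam + q 0 z) \<partial>M)) (at 0)"
  proof (rule has_derivative_integral_ln[where d = d and K = "2 * m"])
    show "finite_measure M" by unfold_locales
    show "q t \<in> borel_measurable M" for t unfolding q_def by measurable
    show "q' \<in> borel_measurable M" unfolding q'_def by measurable
    show "0 \<le> q 0 z" for z by (simp add: q_def sum_nonneg)
    show "integrable M (\<lambda>z. ln (lam + q 0 z) - ln (lam + z \<bullet> z))"
      unfolding q0 by (rule integrable_ln_form[OF pos_def_inv[OF A]])
    show "((\<lambda>t. q t z) has_real_derivative q' z) (at 0)" for z
      unfolding q_def q'_def
      by (auto intro!: derivative_eq_intros simp: sum_negf[symmetric] mult_ac)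
    show "\<bar>q t z - q 0 z\<bar> \<le> 2 * m * \<bar>t\<bar> * (lam + q 0 z)" if t: "\<bar>t\<bar> < d" for t z
    proof -
      have "\<bar>q t z - q 0 z\<bar> \<le> (\<Sum>i\<in>UNIV. \<bar>(e i \<bullet> z)\<^sup>2 / (1 + t * v i) - (e i \<bullet> z)\<^sup>2\<bar>)"
        unfolding q_def by (simp add: sum_subtractf[symmetric] sum_abs)
      also have "\<dots> \<le> (\<Sum>i\<in>UNIV. 2 * m * \<bar>t\<bar> * (e i \<bullet> z)\<^sup>2)"
      proof (rule sum_mono)
        fix i
        have p: "1 / 2 \<le> 1 + t * v i" using half[OF t, of i] by (simp add: abs_le_iff)
        have "(e i \<bullet> z)\<^sup>2 / (1 + t * v i) - (e i \<bullet> z)\<^sup>2 = - ((t * v i) / (1 + t * v i)) * (e i \<bullet> z)\<^sup>2"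
          using p by (simp add: field_simps)
        then have "\<bar>(e i \<bullet> z)\<^sup>2 / (1 + t * v i) - (e i \<bullet> z)\<^sup>2\<bar> = (\<bar>t * v i\<bar> / (1 + t * v i)) * (e i \<bullet> z)\<^sup>2"
          using p by (simp add: abs_mult)
        moreover have "\<bar>t * v i\<bar> / (1 + t * v i) \<le> 2 * m * \<bar>t\<bar>"
        proof -
          have "\<bar>t * v i\<bar> \<le> m * \<bar>t\<bar>" 
            using mult_left_mono[OF m[of i] abs_ge_zero[of t]] by (simp add: abs_mult mult.commute)
          moreover have "m * \<bar>t\<bar> * 1 \<le> m * \<bar>t\<bar> * (2 * (1 + t * v i))"
            using p \<open>m > 0\<close> by (intro mult_left_mono) auto
          ultimately have "\<bar>t * v i\<bar> \<le> 2 * m * \<bar>t\<bar> * (1 + t * v i)" by (simp add: mult_ac)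
          then show ?thesis using p by (subst pos_divide_le_eq) auto
        qed
        ultimately show "\<bar>(e i \<bullet> z)\<^sup>2 / (1 + t * v i) - (e i \<bullet> z)\<^sup>2\<bar> \<le> 2 * m * \<bar>t\<bar> * (e i \<bullet> z)\<^sup>2"
          by (metis mult_right_mono zero_le_power2)
      qed
      also have "\<dots> = 2 * m * \<bar>t\<bar> * q 0 z" by (simp add: q_def sum_distrib_left)
      also have "\<dots> \<le> 2 * m * \<bar>t\<bar> * (lam + q 0 z)"
        using lam \<open>m > 0\<close> by (intro mult_left_mono) auto
      finally show ?thesis .
    qed
  qed (use lam d \<open>m > 0\<close> in auto)
  define F where "F t = (ln (det A) + (\<Sum>i\<in>UNIV. ln (1 + t * v i))) / 2
      + a0 / 2 * (\<integral>z. ln (lam + q t z) - ln (lam + z \<bullet> z) \<partial>M)" for t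
  have objF: "obj (A + t *\<^sub>R V) = F t" if "\<bar>t\<bar> < d" for t
  proof -
    have "ln (det (A + t *\<^sub>R V)) = ln (det A) + (\<Sum>i\<in>UNIV. ln (1 + t * v i))"
    proof -
      have "0 < (\<Prod>i\<in>UNIV. 1 + t * v i)" using pos[OF that] by (intro prod_pos) simp
      moreover have "ln (\<Prod>i\<in>UNIV. 1 + t * v i) = (\<Sum>i\<in>UNIV. ln (1 + t * v i))"
        using pos[OF that] by (intro ln_prod) (auto simp: less_imp_neq[symmetric])
      ultimately show ?thesis
        unfolding pert(3)[OF that] using ln_mult_pos[OF pos_def_det_pos[OF A]] by metis
    qed
    then show ?thesis by (simp add: obj_def F_def pert(2)[OF that] q_def)
  qed
  have wtq: "wt A z * ((matrix_inv A *v z) \<bullet> (V *v (matrix_inv A *v z))) = - a0 * (q' z / (lam + q 0 z))" for z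
    unfolding id(3) uw_def q0 q'_def a0[symmetric] by simp
  have "(F has_real_derivative (trace (matrix_inv A ** V) / 2
      + a0 / 2 * (\<integral>z. q' z / (lam + q 0 z) \<partial>M))) (at 0)"
    unfolding F_def id(2) using deriv by (auto intro!: derivative_eq_intros)
  also have "trace (matrix_inv A ** V) / 2 + a0 / 2 * (\<integral>z. q' z / (lam + q 0 z) \<partial>M) = dir_deriv A V"
    unfolding dir_deriv_def wtq Bochner_Integration.integral_mult_right_zero
    by (simp add: diff_divide_distrib)
  finally have FD: "(F has_real_derivative dir_deriv A V) (at 0)" .
  have ev: "eventually (\<lambda>t. F t = obj (A + t *\<^sub>R V)) (nhds 0)"
    unfolding eventually_nhds_metric using d objF by (intro exI[of _ d]) (auto simp: dist_real_def)
  have "((\<lambda>t. obj (A + t *\<^sub>R V)) has_real_derivative dir_deriv A V) (at 0)"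
    using DERIV_cong_ev[OF refl ev refl] FD by blast
  moreover have "integrable M (\<lambda>z. wt A z * ((matrix_inv A *v z) \<bullet> (V *v (matrix_inv A *v z))))"
  proof (rule integrable_wt_times[OF A, of _ m])
    fix z
    have "\<bar>\<Sum>i\<in>UNIV. v i * (e i \<bullet> z)\<^sup>2\<bar> \<le> (\<Sum>i\<in>UNIV. m * (e i \<bullet> z)\<^sup>2)"
      using m by (intro order_trans[OF sum_abs] sum_mono) (auto simp: abs_mult intro: mult_right_mono)
    then show "\<bar>(matrix_inv A *v z) \<bullet> (V *v (matrix_inv A *v z))\<bar> \<le> m * (z \<bullet> (matrix_inv A *v z))"
      unfolding id(1,3) by (simp add: sum_distrib_left)
  qed measurable
  ultimately show ?thesis using that d pert(1) by blast
qed

lemma obj_min_dir_deriv: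
  assumes A: "pos_def A" and V: "transpose V = V" and min: "\<And>B. pos_def B \<Longrightarrow> obj A \<le> obj B"
  shows "dir_deriv A V = 0"
proof -
  obtain d where "0 < d" "\<And>t. \<bar>t\<bar> < d \<Longrightarrow> pos_def (A + t *\<^sub>R V)"
    and "((\<lambda>t. obj (A + t *\<^sub>R V)) has_real_derivative dir_deriv A V) (at 0)"
    using obj_has_deriv[OF A V] by metis
  then show ?thesis using min by (intro DERIV_local_min[of _ _ _ d]) auto
qed

text \<open>\<open>crit_point\<close> asks for some real function agreeing near 0, and uniqueness of
  derivatives makes \<open>obj + k\<close> as good as any. The constant \<open>k\<close> is 0 for
  \<open>Qh\<close>, and for \<open>Ph\<close> at fixed \<open>mu\<close> it absorbs the change of
  reference term.\<close>

lemma crit_point_iff: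
  assumes f: "\<And>B. pos_def B \<Longrightarrow> f B = ereal (obj B + k)" and A: "pos_def A"
  shows "crit_point f mat_dirs A \<longleftrightarrow> (\<forall>i j. dir_deriv A (sym_unit i j) = 0)"
proof -
  have "(\<exists>g. (\<forall>\<^sub>F t in nhds 0. f (A + t *\<^sub>R V) = ereal (g t)) \<and> (g has_real_derivative 0) (at 0))
      \<longleftrightarrow> dir_deriv A V = 0" if V: "transpose V = V" for V
  proof -
    obtain d where d: "0 < d" "\<And>t. \<bar>t\<bar> < d \<Longrightarrow> pos_def (A + t *\<^sub>R V)"
      and D: "((\<lambda>t. obj (A + t *\<^sub>R V)) has_real_derivative dir_deriv A V) (at 0)"
      using obj_has_deriv[OF A V] by metis
    have D': "((\<lambda>t. obj (A + t *\<^sub>R V) + k) has_real_derivative dir_deriv A V) (at 0)"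
      using D by (auto intro!: derivative_eq_intros)
    have ev: "\<forall>\<^sub>F t in nhds 0. f (A + t *\<^sub>R V) = ereal (obj (A + t *\<^sub>R V) + k)"
      unfolding eventually_nhds_metric using d f by (intro exI[of _ d]) (auto simp: dist_real_def)
    show ?thesis
    proof
      assume "\<exists>g. (\<forall>\<^sub>F t in nhds 0. f (A + t *\<^sub>R V) = ereal (g t)) \<and> (g has_real_derivative 0) (at 0)"
      then obtain g where g: "\<forall>\<^sub>F t in nhds 0. f (A + t *\<^sub>R V) = ereal (g t)"
        "(g has_real_derivative 0) (at 0)" by blast
      have "\<forall>\<^sub>F t in nhds 0. g t = obj (A + t *\<^sub>R V) + k"
        using g(1) ev by eventually_elim simp
      then have "((\<lambda>t. obj (A + t *\<^sub>R V) + k) has_real_derivative 0) (at 0)"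
        by (rule DERIV_cong_ev[OF refl _ refl, THEN iffD1, OF _ g(2)])
      then show "dir_deriv A V = 0" using D' DERIV_unique by blast
    next
      assume "dir_deriv A V = 0"
      then show "\<exists>g. (\<forall>\<^sub>F t in nhds 0. f (A + t *\<^sub>R V) = ereal (g t)) \<and> (g has_real_derivative 0) (at 0)"
        using ev D' by (intro exI[of _ "\<lambda>t. obj (A + t *\<^sub>R V) + k"]) auto
    qed
  qed
  then show ?thesis unfolding crit_point_def mat_dirs_def using sym_unit_sym by blast
qed

text \<open>The coordinate equations say \<open>C = \<integral> u (Cz)(Cz)'\<close> for \<open>C = A\<inverse>\<close>; evaluate both sides at \<open>Ax\<close>.\<close>
lemma dir_deriv_zero_imp_crit_eq:
  assumes A: "pos_def A" and D: "\<And>i j. dir_deriv A (sym_unit i j) = 0"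
  shows "crit_eq A"
proof -
  let ?C = "matrix_inv A"
  have C: "pos_def ?C" by (rule pos_def_inv[OF A])
  have ent: "integrable M (\<lambda>z. wt A z * ((?C *v z) $ i * (?C *v z) $ j))
      \<and> ?C $ i $ j = (\<integral>z. wt A z * ((?C *v z) $ i * (?C *v z) $ j) \<partial>M)" for i j
  proof -
    \<comment> \<open>The multiplicity of the entry occurs in the trace and in the integral alike,
      and cancels.\<close>
    define \<kappa> :: real where "\<kappa> = (if i = j then 1 else 2)"
    have \<kappa>: "\<kappa> \<noteq> 0" by (simp add: \<kappa>_def)
    have form: "wt A z * ((?C *v z) \<bullet> (sym_unit i j *v (?C *v z)))
        = \<kappa> * (wt A z * ((?C *v z) $ i * (?C *v z) $ j))" for z
      unfolding sym_unit_form \<kappa>_def by simp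
    have "integrable M (\<lambda>z. wt A z * ((?C *v z) \<bullet> (sym_unit i j *v (?C *v z))))"
      by (rule obj_has_deriv[OF A sym_unit_sym[of i j]])
    then have "integrable M (\<lambda>z. wt A z * ((?C *v z) $ i * (?C *v z) $ j))"
      unfolding form using \<kappa> by simp
    moreover have "\<kappa> * ?C $ i $ j = \<kappa> * (\<integral>z. wt A z * ((?C *v z) $ i * (?C *v z) $ j) \<partial>M)"
      using D[of i j] unfolding dir_deriv_def form trace_sym_unit[OF pos_def_sym[OF C]]
      by (simp add: \<kappa>_def)
    ultimately show ?thesis using \<kappa> by simp
  qed
  have "x \<bullet> (A *v x) = (\<integral>z. wt A z * (x \<bullet> z)\<^sup>2 \<partial>M)" for x
  proof -
    let ?w = "A *v x"
    have "x \<bullet> (A *v x) = ?w \<bullet> (?C *v ?w)" using A by (simp add: inner_commute)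
    also have "\<dots> = (\<Sum>k\<in>UNIV. \<Sum>l\<in>UNIV. (\<integral>z. wt A z * ((?C *v z) $ k * (?C *v z) $ l) \<partial>M) * (?w $ k * ?w $ l))"
      unfolding form_double_sum[of "A *v x"]
      by (intro sum.cong refl arg_cong2[where f = "(*)"] ent[THEN conjunct2])
    also have "\<dots> = (\<integral>z. (\<Sum>k\<in>UNIV. \<Sum>l\<in>UNIV. wt A z * ((?C *v z) $ k * (?C *v z) $ l) * (?w $ k * ?w $ l)) \<partial>M)"
      using ent[THEN conjunct1] by simp
    also have "\<dots> = (\<integral>z. wt A z * (x \<bullet> z)\<^sup>2 \<partial>M)"
    proof (intro Bochner_Integration.integral_cong refl)
      fix z
      have "x \<bullet> z = ?w \<bullet> (?C *v z)"
        using sym_form_commute[OF pos_def_sym[OF A], of "?C *v z" x] A by (simp add: inner_commute)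
      then show "(\<Sum>k\<in>UNIV. \<Sum>l\<in>UNIV. wt A z * ((?C *v z) $ k * (?C *v z) $ l) * (?w $ k * ?w $ l))
          = wt A z * (x \<bullet> z)\<^sup>2"
        by (simp add: power2_eq_square inner_vec_def sum_product sum_distrib_left mult_ac)
    qed
    finally show ?thesis .
  qed
  with A show ?thesis unfolding crit_eq_def by blast
qed

section \<open>Solutions of the critical equation\<close>

lemma crit_eq_pos_def: "crit_eq A \<Longrightarrow> pos_def A"
  and crit_eq_form: "crit_eq A \<Longrightarrow> x \<bullet> (A *v x) = (\<integral>z. wt A z * (x \<bullet> z)\<^sup>2 \<partial>M)"
  unfolding crit_eq_def by auto

text \<open>A comparison principle: the relative eigenvalues \<open>b i\<close> of \<open>B\<close>
  are all at most 1, so the inverse forms are ordered. Exchanging \<open>A\<close> and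
  \<open>B\<close> then gives uniqueness.\<close>

lemma crit_eq_inverse_le:
  assumes A: "crit_eq A" and B: "crit_eq B"
  shows "z \<bullet> (matrix_inv A *v z) \<le> z \<bullet> (matrix_inv B *v z)"
proof -
  note pA = crit_eq_pos_def[OF A] and pB = crit_eq_pos_def[OF B]
  obtain e b where fA: "frame A e (\<lambda>_. 1)" and fB: "frame B e b"
    using simultaneous_diagonal[OF pA pos_def_sym[OF pB]] unfolding frame_def by metis
  have sA: "z \<bullet> (matrix_inv A *v z) = (\<Sum>i\<in>UNIV. (e i \<bullet> z)\<^sup>2)" for z
    by (rule frame_identity(1)[OF pA fA fA])
  have eA: "e i \<bullet> (A *v e i) = 1" and eB: "e i \<bullet> (B *v e i) = b i" for i
    using fA fB unfolding frame_def by auto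
  have bpos: "b i > 0" for i
    using pos_def_pos[OF pB, of "e i"] eB[of i] eA[of i] by (cases "e i = 0") auto
  have sB: "z \<bullet> (matrix_inv B *v z) = (\<Sum>i\<in>UNIV. (e i \<bullet> z)\<^sup>2 / b i)" for z
    by (rule frame_inverse_form(1)[OF fB less_imp_neq[symmetric, OF bpos] pos_def_sym[OF pB]])
  define c where "c = Max (range b)"
  have ble: "b i \<le> c" for i by (simp add: c_def)
  have "c \<in> range b" unfolding c_def by (intro Max_in) auto
  then obtain k where k: "b k = c" by blast
  have c0: "c > 0" using bpos k by metis
  have "c \<le> 1"
  proof (rule ccontr)
    assume "\<not> c \<le> 1"
    then have c1: "c > 1" by simp
    have strict: "0 < c * wt A z - wt B z" for z
    proof -
      let ?s = "z \<bullet> (matrix_inv A *v z)" and ?t = "z \<bullet> (matrix_inv B *v z)"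
      have s: "0 \<le> ?s" by (rule pos_def_nonneg[OF pos_def_inv[OF pA]])
      have t: "0 \<le> ?t" by (rule pos_def_nonneg[OF pos_def_inv[OF pB]])
      have "?s / c \<le> ?t"
        unfolding sA sB sum_divide_distrib using ble bpos c0 by (intro sum_mono divide_left_mono) auto
      then have "?s \<le> c * ?t" using c0 by (simp add: field_simps)
      \<comment> \<open>The positive constant \<open>lam\<close> makes the comparison of weights
        strict at every \<open>z\<close>, including those where both forms vanish.\<close>
      moreover have "lam < c * lam" using c1 lam by simp
      ultimately have "lam + ?s < c * (lam + ?t)" by (simp add: distrib_left)
      then have "a0 * (lam + ?s) < a0 * (c * (lam + ?t))" using a0_pos by (rule mult_strict_left_mono)
      then have "a0 / (lam + ?t) < c * (a0 / (lam + ?s))"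
        using s t lam by (simp add: field_simps)
      then show ?thesis by (simp add: uw_def a0)
    qed
    \<comment> \<open>The two equations at \<open>e k\<close> give this nonnegative function the
      integral \<open>c - b k = 0\<close>. Its first factor is positive, so
      \<open>e k \<bullet> z\<close> vanishes almost surely, against
      \<open>e k \<bullet> (A *v e k) = 1\<close>.\<close>
    let ?g = "\<lambda>z. (c * wt A z - wt B z) * (e k \<bullet> z)\<^sup>2"
    have iA: "integrable M (\<lambda>z. wt A z * (e k \<bullet> z)\<^sup>2)" and iB: "integrable M (\<lambda>z. wt B z * (e k \<bullet> z)\<^sup>2)"
      using integrable_wt_sq pA pB by auto
    have "?g = (\<lambda>z. c * (wt A z * (e k \<bullet> z)\<^sup>2) - wt B z * (e k \<bullet> z)\<^sup>2)"
      by (simp add: algebra_simps)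
    moreover have "(\<integral>z. c * (wt A z * (e k \<bullet> z)\<^sup>2) - wt B z * (e k \<bullet> z)\<^sup>2 \<partial>M) = 0"
      using iA iB crit_eq_form[OF A, of "e k"] crit_eq_form[OF B, of "e k"] eA[of k] eB[of k] k by simp
    ultimately have "integrable M ?g" "(\<integral>z. ?g z \<partial>M) = 0"
      using iA iB by auto
    moreover have "0 \<le> ?g z" for z
      using less_imp_le[OF strict[of z]] by (intro mult_nonneg_nonneg) auto
    ultimately have "AE z in M. ?g z = 0"
      using integral_nonneg_eq_0_iff_AE[of M ?g] by simp
    then have "AE z in M. wt A z * (e k \<bullet> z)\<^sup>2 = 0"
      using strict by (auto simp: less_imp_neq[symmetric] elim!: eventually_mono)
    then have "(\<integral>z. wt A z * (e k \<bullet> z)\<^sup>2 \<partial>M) = 0" by (rule integral_eq_zero_AE)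
    then show False using crit_eq_form[OF A, of "e k"] eA[of k] by simp
  qed
  then show ?thesis
    unfolding sA sB
  proof (intro sum_mono)
    fix i
    have "b i \<le> 1" using ble[of i] \<open>c \<le> 1\<close> by simp
    then show "(e i \<bullet> z)\<^sup>2 \<le> (e i \<bullet> z)\<^sup>2 / b i"
      using bpos[of i] by (simp add: pos_le_divide_eq mult_left_le)
  qed
qed

lemma crit_eq_unique:
  assumes A: "crit_eq A" and B: "crit_eq B" shows "A = B"
proof -
  note p = crit_eq_pos_def[OF A] crit_eq_pos_def[OF B]
  have "matrix_inv A = matrix_inv B"
  proof (rule sym_eq_by_form)
    show "x \<bullet> (matrix_inv A *v x) = x \<bullet> (matrix_inv B *v x)" for x
      using crit_eq_inverse_le[OF A B, of x] crit_eq_inverse_le[OF B A, of x] by linarith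
  qed (rule pos_def_sym[OF pos_def_inv], rule p)+
  then show ?thesis using pos_def_inv_inv[OF p(1)] pos_def_inv_inv[OF p(2)] by metis
qed

text \<open>Summed over an \<open>A\<close>-orthonormal frame, the equation reads
  \<open>n = a0 - lam * (\<integral> u)\<close> by \<open>wt_form\<close>, and
  \<open>a0 = lam + n\<close>.\<close>

lemma crit_eq_integral_wt:
  assumes "crit_eq A" shows "(\<integral>z. wt A z \<partial>M) = 1"
proof -
  note pA = crit_eq_pos_def[OF assms]
  obtain e where fA: "frame A e (\<lambda>_. 1)"
    using simultaneous_diagonal[OF pA pos_def_sym[OF pA]] unfolding frame_def by metis
  have "real CARD('n) = (\<Sum>i\<in>UNIV. e i \<bullet> (A *v e i))" using fA by (simp add: frame_def)
  also have "\<dots> = (\<Sum>i\<in>UNIV. \<integral>z. wt A z * (e i \<bullet> z)\<^sup>2 \<partial>M)"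
    using crit_eq_form[OF assms] by simp
  also have "\<dots> = (\<integral>z. (\<Sum>i\<in>UNIV. wt A z * (e i \<bullet> z)\<^sup>2) \<partial>M)"
    using integrable_wt_sq[OF pA] by simp
  also have "\<dots> = (\<integral>z. a0 - lam * wt A z \<partial>M)"
    by (simp only: sum_distrib_left[symmetric] frame_identity(1)[OF pA fA fA, symmetric] wt_form[OF pA])
  also have "\<dots> = a0 - lam * (\<integral>z. wt A z \<partial>M)"
    using integrable_wt[OF pA] by (simp add: prob_space)
  finally show ?thesis using lam a0 by simp
qed

text \<open>The linear counterpart of \<open>inV\<close>: for the lifted law, an affine set of
  dimension \<open>q\<close> corresponds to a subspace of dimension \<open>q + 1\<close>, with the
  same bound.\<close>

definition spread :: bool where
  "spread \<longleftrightarrow> (\<forall>H. subspace H \<and> dim H < CARD('n) \<longrightarrow>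
     measure M H < 1 - (real CARD('n) - real (dim H)) / a0)"

lemma subspace_sets: "subspace H \<Longrightarrow> H \<in> sets M"
  using closed_subspace[of H] sets_M by auto

text \<open>Trace of the critical equation over the \<open>A\<close>-orthonormal functionals vanishing on \<open>H\<close>.\<close>
lemma crit_eq_imp_spread:
  assumes crit: "crit_eq A" shows spread
  unfolding spread_def
proof (intro allI impI, elim conjE)
  fix H :: "(real^'n) set"
  assume H: "subspace H" and dim: "dim H < CARD('n)"
  note pA = crit_eq_pos_def[OF crit]
  define K where "K = {y \<in> UNIV. \<forall>x\<in>H. orthogonal x y}"
  have "subspace K" unfolding K_def by (simp add: subspace_def orthogonal_clauses)
  have dimK: "dim K + dim H = CARD('n)"
    unfolding K_def using dim_subspace_orthogonal_to_vectors[OF H subspace_UNIV] by simp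
  obtain B where B: "B \<subseteq> K" "finite B" "card B = dim K" "\<And>b. b \<in> B \<Longrightarrow> b \<bullet> (A *v b) = 1"
    "\<And>b c. b \<in> B \<Longrightarrow> c \<in> B \<Longrightarrow> b \<noteq> c \<Longrightarrow> b \<bullet> (A *v c) = 0"
    using simultaneous_diagonal_subspace[OF pA pos_def_sym[OF pA] \<open>subspace K\<close>] by blast
  have Bessel: "(\<Sum>b\<in>B. (b \<bullet> z)\<^sup>2) \<le> z \<bullet> (matrix_inv A *v z)" for z
  proof -
    \<comment> \<open>The \<open>A\<close>-projection of \<open>matrix_inv A *v z\<close> onto the
      span of \<open>B\<close>. Here \<open>x \<bullet> z\<close> and
      \<open>x \<bullet> (A *v x)\<close> coincide, so \<open>inverse_form_ge\<close> leaves a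
      single copy of the sum.\<close>
    define x where "x = (\<Sum>b\<in>B. (b \<bullet> z) *\<^sub>R b)"
    have 1: "x \<bullet> z = (\<Sum>b\<in>B. (b \<bullet> z)\<^sup>2)"
      by (simp add: x_def inner_sum_left power2_eq_square)
    have "b \<bullet> (A *v x) = b \<bullet> z" if "b \<in> B" for b
    proof -
      have "b \<bullet> (A *v x) = (\<Sum>c\<in>B. (c \<bullet> z) * (b \<bullet> (A *v c)))"
        unfolding x_def by (simp add: vec.linear_sum[OF matrix_vector_mul_linear_gen] inner_sum_right matrix_vector_mult_scaleR)
      also have "\<dots> = (\<Sum>c\<in>B. if c = b then c \<bullet> z else 0)"
        using B(4,5) that by (intro sum.cong) auto
      finally show ?thesis using that B(2) by simp
    qed
    then have "x \<bullet> (A *v x) = (\<Sum>b\<in>B. (b \<bullet> z)\<^sup>2)"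
      by (subst (1) x_def) (simp add: inner_sum_left power2_eq_square)
    with 1 show ?thesis using inverse_form_ge[OF pA, of x z] by simp
  qed
  define g where "g z = wt A z * (\<Sum>b\<in>B. (b \<bullet> z)\<^sup>2)" for z
  have g0: "g z = 0" if "z \<in> H" for z
    using that B(1) by (auto simp: g_def K_def orthogonal_def inner_commute intro!: sum.neutral)
  have gless: "g z < a0" for z
  proof -
    have "g z \<le> wt A z * (z \<bullet> (matrix_inv A *v z))"
      unfolding g_def using Bessel wt_pos[OF pA] by (intro mult_left_mono) (auto intro: less_imp_le)
    then show ?thesis using wt_form_less[OF pA, of z] by linarith
  qed
  have gint: "integrable M g" and gI: "(\<integral>z. g z \<partial>M) = real (card B)"
  proof -
    have g: "g = (\<lambda>z. \<Sum>b\<in>B. wt A z * (b \<bullet> z)\<^sup>2)"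
      by (intro ext) (simp add: g_def sum_distrib_left)
    show "integrable M g" unfolding g using integrable_wt_sq[OF pA] by auto
    show "(\<integral>z. g z \<partial>M) = real (card B)" unfolding g
      using integrable_wt_sq[OF pA] crit_eq_form[OF crit, symmetric] B(4) by simp
  qed
  have HM[measurable]: "H \<in> sets M" by (rule subspace_sets[OF H])
  \<comment> \<open>Nonnegative, as \<open>g\<close> vanishes on \<open>H\<close> and stays below
    \<open>a0\<close> elsewhere. Integral zero would put \<open>z\<close> in \<open>H\<close> almost
    surely, so \<open>g\<close> would integrate to 0 instead of the positive codimension of
    \<open>H\<close>.\<close>
  define h where "h z = a0 * (1 - indicator H z) - g z" for z
  have hint: "integrable M h" unfolding h_def using gint by (auto simp: less_top[symmetric])
  have h0: "0 \<le> h z" for z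
    using g0[of z] gless[of z] by (auto simp: h_def indicator_def split: if_splits)
  have hI: "(\<integral>z. h z \<partial>M) = a0 * (1 - measure M H) - real (card B)"
    unfolding h_def using gint gI by (simp add: prob_space less_top[symmetric])
  have "(\<integral>z. h z \<partial>M) \<noteq> 0"
  proof
    assume "(\<integral>z. h z \<partial>M) = 0"
    then have "AE z in M. h z = 0" using integral_nonneg_eq_0_iff_AE[OF hint] h0 by simp
    then have "AE z in M. g z = 0"
    proof eventually_elim
      case (elim z)
      then show ?case using g0[of z] gless[of z] by (cases "z \<in> H") (auto simp: h_def)
    qed
    then have "(\<integral>z. g z \<partial>M) = 0" by (rule integral_eq_zero_AE)
    then show False using gI B(3) dimK dim by linarith
  qed
  moreover have "0 \<le> (\<integral>z. h z \<partial>M)" using h0 by (intro integral_nonneg_AE) simp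
  ultimately have "real (card B) < a0 * (1 - measure M H)" using hI by simp
  moreover have "real (card B) = real CARD('n) - real (dim H)" using B(3) dimK by simp
  ultimately have "(real CARD('n) - real (dim H)) / a0 < 1 - measure M H"
    using a0_pos by (simp add: divide_less_eq mult.commute)
  then show "measure M H < 1 - (real CARD('n) - real (dim H)) / a0" by simp
qed

section \<open>Coercivity\<close>

lemma open_sets: "open S \<Longrightarrow> S \<in> sets M"
  using sets_M by simp

lemma space_M: "space M = UNIV"
  using sets_eq_imp_space_eq[OF sets_M] by simp

text \<open>\<open>spread\<close> for the orthogonal complement of the chosen vectors, whose
  codimension is \<open>card S\<close>, read on the complementary event.\<close>

lemma spread_orthonormal:
  fixes e :: "'n \<Rightarrow> real^'n"
  assumes spread and orth: "\<And>i j. e i \<bullet> e j = (if i = j then 1 else 0 :: real)" and S: "S \<noteq> {}"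
  shows "real (card S) / a0 < measure M {z. \<exists>i\<in>S. e i \<bullet> z \<noteq> 0}"
proof -
  define H where "H = {z \<in> UNIV. \<forall>x\<in>span (e ` S). orthogonal x z}"
  have H: "subspace H" unfolding H_def by (simp add: subspace_def orthogonal_clauses)
  have H_eq: "H = {z. \<forall>i\<in>S. e i \<bullet> z = 0}"
  proof -
    have "(\<forall>x\<in>span (e ` S). orthogonal x z) \<longleftrightarrow> (\<forall>i\<in>S. e i \<bullet> z = 0)" for z
    proof
      assume z: "\<forall>i\<in>S. e i \<bullet> z = 0"
      have "span (e ` S) \<subseteq> {x. orthogonal x z}"
        using z by (intro span_minimal) (auto simp: orthogonal_def subspace_def inner_add_left)
      then show "\<forall>x\<in>span (e ` S). orthogonal x z" by blast
    qed (auto simp: orthogonal_def span_base)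
    then show ?thesis by (simp add: H_def)
  qed
  have inj: "inj_on e S"
  proof (rule inj_onI)
    fix i j assume "e i = e j"
    then show "i = j" using orth[of i j] orth[of i i] by (simp split: if_splits)
  qed
  have "pairwise orthogonal (e ` S)"
    using orth by (auto simp: pairwise_def orthogonal_def)
  moreover have "0 \<notin> e ` S" using orth by (metis (no_types, lifting) imageE inner_zero_left zero_neq_one)
  ultimately have "independent (e ` S)" by (rule pairwise_orthogonal_independent)
  then have "dim (span (e ` S)) = card S"
    using inj by (simp add: dim_eq_card_independent card_image)
  then have dim: "dim H + card S = CARD('n)"
    unfolding H_def using dim_subspace_orthogonal_to_vectors[of "span (e ` S)" UNIV] by simp
  moreover have "card S > 0" using S by (simp add: card_gt_0_iff)
  ultimately have "measure M H < 1 - (real CARD('n) - real (dim H)) / a0"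
    using \<open>spread\<close> H unfolding spread_def by simp
  moreover have "real CARD('n) - real (dim H) = real (card S)" using dim by simp
  moreover have "{z. \<exists>i\<in>S. e i \<bullet> z \<noteq> 0} = space M - H" by (auto simp: H_eq space_M)
  ultimately show ?thesis using prob_compl[OF subspace_sets[OF H]] by simp
qed

text \<open>A quantitative version of leaving the orthogonal complement of the vectors
  \<open>e i\<close>, \<open>i \<in> S\<close>: some coordinate exceeds a fixed threshold.\<close>

definition slab :: "('n \<Rightarrow> real^'n) \<Rightarrow> 'n set \<Rightarrow> real \<Rightarrow> (real^'n) set" where
  "slab e S \<eta> = {z. \<exists>i\<in>S. \<eta> < \<bar>e i \<bullet> z\<bar>}"

lemma slab_sets [measurable]: "slab e S \<eta> \<in> sets M"
proof -
  have "slab e S \<eta> = (\<Union>i\<in>S. {z. \<eta> < \<bar>e i \<bullet> z\<bar>})" by (auto simp: slab_def)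
  moreover have "open {z. \<eta> < \<bar>e i \<bullet> z\<bar>}" for i by (intro open_Collect_less continuous_intros)
  ultimately show ?thesis by (intro open_sets) auto
qed

lemma slab_antimono: "\<eta> \<le> \<eta>' \<Longrightarrow> slab e S \<eta>' \<subseteq> slab e S \<eta>"
  by (force simp: slab_def)

lemma compact_orthonormal:
  "compact {X :: (real^'n)^'n. \<forall>i j. X $ i \<bullet> X $ j = (if i = j then 1 else 0)}" (is "compact ?K")
proof -
  have "closed ?K"
    by (intro closed_Collect_all closed_Collect_eq continuous_intros)
  moreover have "bounded ?K"
  proof (rule boundedI)
    fix X assume "X \<in> ?K"
    then have "norm (X $ i) = 1" for i by (simp add: norm_eq_1)
    then show "norm X \<le> real CARD('n)"
      using L2_set_le_sum[of UNIV "\<lambda>i. norm (X $ i)"] by (simp add: norm_vec_def)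
  qed
  ultimately show ?thesis by (simp add: compact_eq_bounded_closed)
qed

text \<open>The strict inequalities defining \<open>spread\<close> hold uniformly, since orthonormal frames
  form a compact set.\<close>
lemma spread_uniform:
  assumes spread
  obtains \<eta> where "0 < \<eta>"
    "\<And>e S. (\<And>i j. e i \<bullet> e j = (if i = j then 1 else 0 :: real)) \<Longrightarrow> S \<noteq> {} \<Longrightarrow>
       real (card S) / a0 + \<eta> \<le> measure M (slab e S \<eta>)"
proof -
  define K where "K = {X :: (real^'n)^'n. \<forall>i j. X $ i \<bullet> X $ j = (if i = j then 1 else 0)}"
  have each: "\<exists>\<eta>>0. \<forall>X\<in>K. real (card S) / a0 + \<eta> \<le> measure M (slab (($) X) S \<eta>)" if S: "S \<noteq> {}" for S
  proof (rule ccontr)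
    assume *: "\<not> (\<exists>\<eta>>0. \<forall>X\<in>K. real (card S) / a0 + \<eta> \<le> measure M (slab (($) X) S \<eta>))"
    let ?\<eta> = "\<lambda>n. inverse (real (Suc n))"
    have "\<forall>n. \<exists>X\<in>K. measure M (slab (($) X) S (?\<eta> n)) < real (card S) / a0 + ?\<eta> n"
      using * by (metis inverse_positive_iff_positive not_le of_nat_0_less_iff zero_less_Suc)
    then obtain X where X: "\<And>n. X n \<in> K"
      "\<And>n. measure M (slab (($) (X n)) S (?\<eta> n)) < real (card S) / a0 + ?\<eta> n" by metis
    obtain L r where L: "L \<in> K" "strict_mono r" "(X \<circ> r) \<longlonglongrightarrow> L"
      using compact_orthonormal X(1) unfolding compact_def K_def[symmetric] by metis
    define G where "G n = slab (($) (X (r n))) S (?\<eta> (r n))" for n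
    have G[measurable]: "G n \<in> sets M" for n unfolding G_def by (rule slab_sets)
    \<comment> \<open>The increasing sets whose union is the lower limit of the slabs. Each has mass
      at most \<open>card S / a0\<close> by the negated claim, while every \<open>z\<close> not
      orthogonal to the limit frame eventually enters; continuity from below contradicts the strict
      inequality for \<open>L\<close>.\<close>
    define T where "T N = (\<Inter>n\<in>{N..}. G n)" for N
    have T[measurable]: "T N \<in> sets M" for N
      unfolding T_def by (intro sets.countable_INT') (auto simp: G)
    have \<eta>r: "(\<lambda>n. ?\<eta> (r n)) \<longlonglongrightarrow> 0"
      using LIMSEQ_subseq_LIMSEQ[OF LIMSEQ_inverse_real_of_nat L(2)] by (simp add: comp_def)
    have sub: "{z. \<exists>i\<in>S. L $ i \<bullet> z \<noteq> 0} \<subseteq> (\<Union>N. T N)"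
    proof clarify
      fix z i assume i: "i \<in> S" "L $ i \<bullet> z \<noteq> 0"
      have "(\<lambda>n. \<bar>X (r n) $ i \<bullet> z\<bar> - ?\<eta> (r n)) \<longlonglongrightarrow> \<bar>L $ i \<bullet> z\<bar> - 0"
        using L(3) \<eta>r by (intro tendsto_intros) (simp_all add: comp_def)
      then have "eventually (\<lambda>n. 0 < \<bar>X (r n) $ i \<bullet> z\<bar> - ?\<eta> (r n)) sequentially"
        using i by (intro order_tendstoD) auto
      then obtain N where "\<And>n. n \<ge> N \<Longrightarrow> ?\<eta> (r n) < \<bar>X (r n) $ i \<bullet> z\<bar>"
        unfolding eventually_sequentially by auto
      then have "z \<in> T N" using i by (auto simp: T_def G_def slab_def)
      then show "z \<in> (\<Union>N. T N)" by blast
    qed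
    have Tle: "measure M (T N) \<le> real (card S) / a0" for N
    proof (rule LIMSEQ_le_const[of "\<lambda>n. real (card S) / a0 + ?\<eta> (r n)"])
      show "(\<lambda>n. real (card S) / a0 + ?\<eta> (r n)) \<longlonglongrightarrow> real (card S) / a0"
        using tendsto_add[OF tendsto_const \<eta>r] by simp
      have "measure M (T N) \<le> real (card S) / a0 + ?\<eta> (r n)" if "n \<ge> N" for n
      proof -
        have "measure M (T N) \<le> measure M (G n)"
          using that by (intro finite_measure_mono G) (auto simp: T_def)
        then show ?thesis using X(2)[of "r n"] by (simp add: G_def)
      qed
      then show "\<exists>N'. \<forall>n\<ge>N'. measure M (T N) \<le> real (card S) / a0 + ?\<eta> (r n)" by blast
    qed
    have "(\<lambda>N. measure M (T N)) \<longlonglongrightarrow> measure M (\<Union>N. T N)"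
      by (intro finite_Lim_measure_incseq) (auto simp: incseq_def T_def)
    then have "measure M (\<Union>N. T N) \<le> real (card S) / a0"
      using Tle by (intro LIMSEQ_le_const2) auto
    moreover have "measure M {z. \<exists>i\<in>S. L $ i \<bullet> z \<noteq> 0} \<le> measure M (\<Union>N. T N)"
      using sub by (intro finite_measure_mono) auto
    moreover have "real (card S) / a0 < measure M {z. \<exists>i\<in>S. L $ i \<bullet> z \<noteq> 0}"
      using L(1) S by (intro spread_orthonormal[OF \<open>spread\<close>]) (auto simp: K_def)
    ultimately show False by linarith
  qed
  then obtain \<eta> where \<eta>: "\<And>S. S \<noteq> {} \<Longrightarrow> 0 < \<eta> S"
    "\<And>S X. S \<noteq> {} \<Longrightarrow> X \<in> K \<Longrightarrow> real (card S) / a0 + \<eta> S \<le> measure M (slab (($) X) S (\<eta> S))"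
    by metis
  \<comment> \<open>There are finitely many index sets, and slabs only grow when the threshold is
    lowered.\<close>
  define \<eta>' where "\<eta>' = Min (\<eta> ` {S. S \<noteq> {}})"
  have fin: "finite (\<eta> ` {S. S \<noteq> {}})" by simp
  have ne: "\<eta> ` {S. S \<noteq> {}} \<noteq> {}" by auto
  show ?thesis
  proof
    show "0 < \<eta>'" unfolding \<eta>'_def using Min_in[OF fin ne] \<eta>(1)
      by (metis (mono_tags, lifting) imageE mem_Collect_eq)
    fix e :: "'n \<Rightarrow> real^'n" and S :: "'n set"
    assume e: "\<And>i j. e i \<bullet> e j = (if i = j then 1 else 0)" and S: "S \<noteq> {}"
    have le: "\<eta>' \<le> \<eta> S" unfolding \<eta>'_def using S by (intro Min_le[OF fin]) auto
    define X where "X = (\<chi> i. e i)"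
    have "($) X = e" by (auto simp: X_def)
    moreover have "X \<in> K" using e by (simp add: K_def X_def)
    ultimately have "real (card S) / a0 + \<eta> S \<le> measure M (slab e S (\<eta> S))" using \<eta>(2)[OF S] by metis
    also have "\<dots> \<le> measure M (slab e S \<eta>')"
      using slab_antimono[OF le] by (intro finite_measure_mono slab_sets)
    finally show "real (card S) / a0 + \<eta>' \<le> measure M (slab e S \<eta>')" using le by linarith
  qed
qed

text \<open>Discrete layer-cake estimate, by peeling off the smallest level.\<close>
lemma layer_cake_le:
  fixes y :: "'b \<Rightarrow> real"
  assumes "finite B" "0 \<le> c" "0 \<le> \<epsilon>"
    and "\<And>b. b \<in> B \<Longrightarrow> E b \<in> sets M" "\<And>b. b \<in> B \<Longrightarrow> 0 \<le> y b"
    and "\<And>S. S \<subseteq> B \<Longrightarrow> S \<noteq> {} \<Longrightarrow> c * real (card S) + \<epsilon> \<le> measure M (\<Union>b\<in>S. E b)"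
    and "integrable M F" "\<And>z. 0 \<le> F z" "\<And>b z. b \<in> B \<Longrightarrow> z \<in> E b \<Longrightarrow> y b \<le> F z"
  shows "c * (\<Sum>b\<in>B. y b) \<le> (\<integral>z. F z \<partial>M)
    \<and> (\<forall>b\<in>B. c * (\<Sum>b\<in>B. y b) + \<epsilon> * y b \<le> (\<integral>z. F z \<partial>M))"
  using assms
proof (induction "card B" arbitrary: B y F)
  case 0
  then show ?case by simp
next
  case (Suc n)
  note prems = Suc.prems
  have "B \<noteq> {}" using Suc.hyps(2) by auto
  have "Min (y ` B) \<in> y ` B" using prems(1) \<open>B \<noteq> {}\<close> by (intro Min_in) auto
  then obtain a where a: "a \<in> B" "y a = Min (y ` B)" by auto
  have min: "y a \<le> y b" if "b \<in> B" for b using that prems(1) a(2) by simp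
  define U where "U = (\<Union>b\<in>B. E b)"
  have U: "U \<in> sets M" unfolding U_def using prems(1,4) by auto
  \<comment> \<open>The layer of height \<open>y a\<close> over the union of all events is removed;
    the remainder still dominates the reduced levels \<open>y b - y a\<close>.\<close>
  define F' where "F' z = F z - y a * indicator U z" for z
  have F': "integrable M F'" "(\<integral>z. F' z \<partial>M) = (\<integral>z. F z \<partial>M) - y a * measure M U"
    unfolding F'_def using prems(7) U by (auto simp: less_top[symmetric])
  have yaF: "y a \<le> F z" if "z \<in> U" for z
    using that prems(9) min unfolding U_def by fastforce
  \<comment> \<open>When \<open>B - {a}\<close> is empty the quantified part says nothing, which is
    why the bound without \<epsilon> is carried along.\<close>
  have IH: "c * (\<Sum>b\<in>B - {a}. y b - y a) \<le> (\<integral>z. F' z \<partial>M)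
    \<and> (\<forall>b\<in>B - {a}. c * (\<Sum>b\<in>B - {a}. y b - y a) + \<epsilon> * (y b - y a) \<le> (\<integral>z. F' z \<partial>M))"
  proof (rule Suc.hyps(1))
    show "n = card (B - {a})" using Suc.hyps(2) a(1) prems(1) by simp
    show "0 \<le> F' z" for z using yaF[of z] prems(8)[of z] by (simp add: F'_def indicator_def)
    show "y b - y a \<le> F' z" if "b \<in> B - {a}" "z \<in> E b" for b z
      using that prems(9)[of b z] by (auto simp: F'_def U_def indicator_def)
    show "0 \<le> y b - y a" if "b \<in> B - {a}" for b using that min by simp
    show "c * real (card S) + \<epsilon> \<le> measure M (\<Union>b\<in>S. E b)" if "S \<subseteq> B - {a}" "S \<noteq> {}" for S
      using that prems(6)[of S] by auto
  qed (use prems F' in auto)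
  have "(\<Sum>b\<in>B. y b) = (\<Sum>b\<in>B. y b - y a) + real (card B) * y a" by (simp add: sum_subtractf)
  also have "(\<Sum>b\<in>B. y b - y a) = (\<Sum>b\<in>B - {a}. y b - y a)"
    using a(1) prems(1) by (simp add: sum.remove[of B a])
  finally have sum: "(\<Sum>b\<in>B. y b) = (\<Sum>b\<in>B - {a}. y b - y a) + real (card B) * y a" .
  have mU: "y a * (c * real (card B) + \<epsilon>) \<le> y a * measure M U"
    using prems(6)[of B] \<open>B \<noteq> {}\<close> prems(5)[OF a(1)] unfolding U_def by (intro mult_left_mono) auto
  have ya: "0 \<le> \<epsilon> * y a" using prems(3,5) a(1) by simp
  have main: "c * (\<Sum>b\<in>B. y b) + \<epsilon> * y a \<le> (\<integral>z. F z \<partial>M)"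
    using IH F'(2) mU unfolding sum by (simp add: algebra_simps)
  moreover have "c * (\<Sum>b\<in>B. y b) + \<epsilon> * y b \<le> (\<integral>z. F z \<partial>M)" if "b \<in> B" for b
  proof (cases "b = a")
    case False
    then have "c * (\<Sum>b\<in>B - {a}. y b - y a) + \<epsilon> * (y b - y a) \<le> (\<integral>z. F' z \<partial>M)" using IH that by simp
    then show ?thesis using F'(2) mU unfolding sum by (simp add: algebra_simps)
  qed (use main in simp)
  ultimately show ?case using ya by auto
qed

lemma tail_small:
  assumes "0 < \<epsilon>" obtains T where "0 < T" "measure M {z. T < norm z} \<le> \<epsilon>"
proof -
  have "(\<lambda>n. measure M {z. real n < norm z}) \<longlonglongrightarrow> measure M (\<Inter>n. {z. real n < norm z})"
    by (intro finite_Lim_measure_decseq)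
      (auto simp: decseq_def intro!: open_sets open_Collect_less continuous_intros)
  moreover have "(\<Inter>n. {z::real^'n. real n < norm z}) = {}"
    by (auto simp: not_less) (metis not_less real_arch_simple)
  ultimately have "(\<lambda>n. measure M {z. real n < norm z}) \<longlonglongrightarrow> 0" by simp
  then have "eventually (\<lambda>n. measure M {z. real n < norm z} < \<epsilon>) sequentially"
    using assms by (intro order_tendstoD) auto
  then obtain N where "measure M {z. real (Suc N) < norm z} < \<epsilon>"
    unfolding eventually_sequentially by (meson le_SucI order_refl)
  then show ?thesis by (intro that[of "real (Suc N)"]) auto
qed

end

section \<open>Compactness and spectral data of positive definite matrices\<close>

lemma det_inverse:
  fixes A :: "real^'n::finite^'n"
  assumes "pos_def A" shows "det A * det (matrix_inv A) = 1"
  using det_mul[of A "matrix_inv A"] invertible_inv_right[OF pos_def_invertible[OF assms]] by simp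

lemma form_entry: "C $ i $ j = axis i 1 \<bullet> (C *v axis j 1)" for C :: "real^'n::finite^'n"
  by (simp add: matrix_vector_mul_component inner_axis' column_def matrix_vector_mult_basis)

text \<open>The conditions are closed, being linear in the entries. The lower bound makes
  \<open>C\<close> positive definite, so Cauchy-Schwarz bounds each entry by diagonal ones, hence by
  \<open>R\<close>.\<close>

lemma compact_form_bounds:
  assumes "0 < r"
  shows "compact {C :: real^'n::finite^'n. transpose C = C \<and>
    (\<forall>x. r * (x \<bullet> x) \<le> x \<bullet> (C *v x) \<and> x \<bullet> (C *v x) \<le> R * (x \<bullet> x))}" (is "compact ?K")
proof -
  have "?K = {C. \<forall>i j. C $ j $ i = C $ i $ j} \<inter> {C. \<forall>x. r * (x \<bullet> x) \<le> x \<bullet> (C *v x)}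
      \<inter> {C. \<forall>x. x \<bullet> (C *v x) \<le> R * (x \<bullet> x)}"
    by (auto simp: transpose_def vec_eq_iff)
  moreover have "closed {C :: real^'n^'n. \<forall>i j. C $ j $ i = C $ i $ j}"
    by (intro closed_Collect_all closed_Collect_eq continuous_intros)
  moreover have "closed {C :: real^'n^'n. \<forall>x. r * (x \<bullet> x) \<le> x \<bullet> (C *v x)}"
    "closed {C :: real^'n^'n. \<forall>x. x \<bullet> (C *v x) \<le> R * (x \<bullet> x)}"
    unfolding form_double_sum by (intro closed_Collect_all closed_Collect_le continuous_intros)+
  ultimately have "closed ?K" by (simp only: closed_Int)
  moreover have "bounded ?K"
  proof (rule boundedI)
    fix C assume C: "C \<in> ?K"
    have pC: "pos_def C" unfolding pos_def_def
    proof (intro conjI allI impI)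
      show "0 < x \<bullet> (C *v x)" if "x \<noteq> 0" for x
      proof -
        have "0 < r * (x \<bullet> x)" using assms that by simp
        then show ?thesis using C by (auto intro: less_le_trans)
      qed
    qed (use C in auto)
    have le: "\<bar>C $ i $ j\<bar> \<le> R" for i j
    proof -
      have R: "axis k 1 \<bullet> (C *v axis k 1) \<le> R" for k
      proof -
        have "axis k 1 \<bullet> (C *v axis k 1) \<le> R * (axis k 1 \<bullet> (axis k 1 :: real^'n))" using C by blast
        then show ?thesis by simp
      qed
      have R0: "0 \<le> R" using R pos_def_nonneg[OF pC] order_trans by blast
      have "(C $ i $ j)\<^sup>2 \<le> (axis i 1 \<bullet> (C *v axis i 1)) * (axis j 1 \<bullet> (C *v axis j 1))"
        using form_Cauchy_Schwarz[OF pC, of "axis i 1" "C *v axis j 1"] pC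
        by (simp add: form_entry inner_commute)
      also have "\<dots> \<le> R * R" using R R0 pos_def_nonneg[OF pC] by (intro mult_mono) auto
      finally have "(C $ i $ j)\<^sup>2 \<le> R\<^sup>2" by (simp add: power2_eq_square)
      then show ?thesis using R0 by (simp add: abs_le_square_iff[symmetric])
    qed
    have "norm C \<le> (\<Sum>i\<in>UNIV. norm (C $ i))"
      using L2_set_le_sum[of UNIV "\<lambda>i. norm (C $ i)"] by (simp add: norm_vec_def)
    also have "\<dots> \<le> (\<Sum>i\<in>(UNIV::'n set). \<Sum>j\<in>(UNIV::'n set). R)"
      using le by (intro sum_mono order_trans[OF norm_le_l1_cart]) auto
    finally show "norm C \<le> (\<Sum>i\<in>(UNIV::'n set). \<Sum>j\<in>(UNIV::'n set). R)" .
  qed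
  ultimately show ?thesis by (simp add: compact_eq_bounded_closed)
qed

text \<open>The spectral theorem, as simultaneous diagonalisation of \<open>C\<close> with the
  identity.\<close>

lemma orthonormal_frame:
  fixes C :: "real^'n::finite^'n"
  assumes C: "pos_def C"
  shows "\<exists>(e :: 'n \<Rightarrow> real^'n) \<gamma>. (\<forall>i j. e i \<bullet> e j = (if i = j then 1 else 0)) \<and> (\<forall>i. 0 < \<gamma> i)
    \<and> (\<forall>z. z \<bullet> z = (\<Sum>i\<in>UNIV. (e i \<bullet> z)\<^sup>2)) \<and> (\<forall>z. z \<bullet> (C *v z) = (\<Sum>i\<in>UNIV. \<gamma> i * (e i \<bullet> z)\<^sup>2))
    \<and> det C = (\<Prod>i\<in>UNIV. \<gamma> i)"
proof -
  obtain e \<gamma> where fI: "frame (mat 1 :: real^'n^'n) e (\<lambda>_. 1)" and fC: "frame C e \<gamma>"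
    using simultaneous_diagonal[OF pos_def_mat1 pos_def_sym[OF C]] unfolding frame_def by metis
  have inv1: "matrix_inv (mat 1 :: real^'n^'n) = mat 1" by (rule matrix_inv_eqI) simp
  note id = frame_identity[OF pos_def_mat1 fI fC, unfolded inv1 matrix_vector_mul_lid]
  have orth: "e i \<bullet> e j = (if i = j then 1 else 0)" for i j using fI by (simp add: frame_def)
  show ?thesis
  proof (intro exI conjI allI)
    show "0 < \<gamma> i" for i
    proof -
      have "e i \<noteq> 0" using orth[of i i] by auto
      then show ?thesis using fC pos_def_pos[OF C, of "e i"] by (simp add: frame_def)
    qed
    have "(det (cols e))\<^sup>2 = 1" using frame_det[OF fI] by simp
    then show "det C = (\<Prod>i\<in>UNIV. \<gamma> i)" using frame_det[OF fC] by simp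
  qed (rule id orth)+
qed

context law
begin

text \<open>With \<open>x\<^sub>i\<close> the logarithms of the eigenvalues of \<open>C\<close>, the layer-cake estimate bounds the
  integral from below by \<open>\<Sum> max(0,x\<^sub>i)/a0\<close> plus a strictly positive multiple of each \<open>max(0,x\<^sub>i)\<close>;
  mass far from the origin only costs a small multiple of \<open>\<Sum> max(0,-x\<^sub>i)\<close>.\<close>
lemma obj_coercive:
  assumes spread
  obtains r R where "0 < r" "r \<le> 1" "1 \<le> R"
    "\<And>A x. pos_def A \<Longrightarrow> obj A \<le> 0 \<Longrightarrow> r * (x \<bullet> x) \<le> x \<bullet> (matrix_inv A *v x) \<and>
       x \<bullet> (matrix_inv A *v x) \<le> R * (x \<bullet> x)"
proof -
  obtain \<eta> where \<eta>: "0 < \<eta>" and slab: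
    "\<And>e S. (\<And>i j. e i \<bullet> e j = (if i = j then 1 else 0 :: real)) \<Longrightarrow> S \<noteq> {} \<Longrightarrow>
       real (card S) / a0 + \<eta> \<le> measure M (slab e S \<eta>)"
    using spread_uniform[OF assms] by blast
  \<comment> \<open>The first bound leaves half of the gain \<eta> after the tail is discarded; the
    second keeps the tail cost below half of the term \<open>m / 2\<close> supplied by
    \<open>ln (det A)\<close>.\<close>
  define \<epsilon> where "\<epsilon> = min (\<eta> / 2) (1 / (2 * a0))"
  have \<epsilon>: "0 < \<epsilon>" "\<epsilon> \<le> \<eta> / 2" "a0 * \<epsilon> \<le> 1 / 2"
  proof -
    show "0 < \<epsilon>" "\<epsilon> \<le> \<eta> / 2" using \<eta> a0_pos by (auto simp: \<epsilon>_def)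
    have "a0 * \<epsilon> \<le> a0 * (1 / (2 * a0))" using a0_pos by (intro mult_left_mono) (auto simp: \<epsilon>_def)
    then show "a0 * \<epsilon> \<le> 1 / 2" using a0_pos by simp
  qed
  obtain T where T: "0 < T" "measure M {z. T < norm z} \<le> \<epsilon>" using tail_small[OF \<epsilon>(1)] .
  define out where "out = {z::real^'n. T < norm z}"
  have out[measurable]: "out \<in> sets M"
    unfolding out_def by (intro open_sets open_Collect_less continuous_intros)
  \<comment> \<open>\<open>\<eta>\<^sup>2\<close> makes \<open>\<gamma> i * \<delta>\<close> a lower
    bound for the form on a slab; \<open>lam\<close> makes the truncated integrand \<open>F\<close>
    nonnegative.\<close>
  define \<delta> where "\<delta> = min (\<eta>\<^sup>2) lam"
  have \<delta>: "0 < \<delta>" "\<delta> \<le> \<eta>\<^sup>2" "\<delta> \<le> lam" using \<eta> lam by (auto simp: \<delta>_def)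
  define c0 where "c0 = \<bar>ln (lam + T\<^sup>2)\<bar> + \<bar>ln \<delta>\<bar>"
  have c0: "0 \<le> c0" by (simp add: c0_def)
  \<comment> \<open>Both exponents are read off \<open>key\<close> below: it yields
    \<open>m \<le> 2 * a0 * c0\<close> and \<open>y i \<le> 2 * c0 / \<eta>\<close>.\<close>
  define r where "r = exp (- (2 * a0 * c0))"
  define R where "R = exp (2 * c0 / \<eta>)"
  show ?thesis
  proof
    show "0 < r" "r \<le> 1" "1 \<le> R" using c0 a0_pos \<eta> by (auto simp: r_def R_def)
    fix A :: "real^'n^'n" and x :: "real^'n"
    assume A: "pos_def A" and obj: "obj A \<le> 0"
    define C where "C = matrix_inv A"
    have C: "pos_def C" unfolding C_def by (rule pos_def_inv[OF A])
    obtain e :: "'n \<Rightarrow> real^'n" and \<gamma> :: "'n \<Rightarrow> real" where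
      spec: "(\<forall>i j. e i \<bullet> e j = (if i = j then 1 else 0)) \<and> (\<forall>i. 0 < \<gamma> i)
        \<and> (\<forall>z. z \<bullet> z = (\<Sum>i\<in>UNIV. (e i \<bullet> z)\<^sup>2)) \<and> (\<forall>z. z \<bullet> (C *v z) = (\<Sum>i\<in>UNIV. \<gamma> i * (e i \<bullet> z)\<^sup>2))
        \<and> det C = (\<Prod>i\<in>UNIV. \<gamma> i)"
      using orthonormal_frame[OF C] by (elim exE)
    then have e: "\<And>i j. e i \<bullet> e j = (if i = j then 1 else 0)" and \<gamma>: "\<And>i. 0 < \<gamma> i"
      and zz: "\<And>z. z \<bullet> z = (\<Sum>i\<in>UNIV. (e i \<bullet> z)\<^sup>2)"
      and zCz: "\<And>z. z \<bullet> (C *v z) = (\<Sum>i\<in>UNIV. \<gamma> i * (e i \<bullet> z)\<^sup>2)"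
      and det: "det C = (\<Prod>i\<in>UNIV. \<gamma> i)"
      by blast+
    define X where "X i = ln (\<gamma> i)" for i
    have \<gamma>X: "\<gamma> i = exp (X i)" for i using \<gamma>[of i] by (simp add: X_def)
    define y where "y i = max 0 (X i)" for i
    define m where "m = (\<Sum>i\<in>UNIV. max 0 (- X i))"
    have m: "- m \<le> X i" for i
    proof -
      have "max 0 (- X i) \<le> m" unfolding m_def by (intro member_le_sum) auto
      then show ?thesis by simp
    qed
    have m0: "0 \<le> m" unfolding m_def by (intro sum_nonneg) auto
    have form0: "0 \<le> z \<bullet> (C *v z)" for z by (rule pos_def_nonneg[OF C])
    define g where "g z = ln (lam + z \<bullet> (C *v z)) - ln (lam + z \<bullet> z)" for z
    have gint: "integrable M g" unfolding g_def by (rule integrable_ln_form[OF C])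
    \<comment> \<open>Inside the ball the reference logarithm is at most a constant, absorbed in
      \<open>c0\<close>. Outside, only the crude bound \<open>- m\<close> from the smallest
      eigenvalue is kept.\<close>
    define F where "F z = (if z \<in> out then 0 else ln (lam + z \<bullet> (C *v z)) - ln \<delta>)" for z
    have F0: "0 \<le> F z" for z
    proof -
      have "ln \<delta> \<le> ln (lam + z \<bullet> (C *v z))" using \<delta> form0[of z] by (intro ln_mono) auto
      then show ?thesis by (simp add: F_def)
    qed
    have gF: "F z - c0 - m * indicator out z \<le> g z" for z
    proof (cases "z \<in> out")
      case True
      have "exp (- m) * (z \<bullet> z) \<le> z \<bullet> (C *v z)"
        unfolding zz zCz sum_distrib_left using m by (intro sum_mono mult_right_mono) (auto simp: \<gamma>X)
      then have "ln (exp (- m)) \<le> g z"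
        unfolding g_def using m0 lam by (intro ln_ratio_ge) auto
      then show ?thesis using True c0 by (simp add: F_def)
    next
      case False
      then have "z \<bullet> z \<le> T\<^sup>2"
        by (metis linorder_not_less mem_Collect_eq norm_ge_zero out_def power2_norm_eq_inner power_mono)
      then have "ln (lam + z \<bullet> z) \<le> ln (lam + T\<^sup>2)" using lam by (intro ln_mono) (auto simp: add_pos_nonneg)
      then show ?thesis using False by (simp add: F_def g_def c0_def)
    qed
    have Fint: "integrable M F"
    proof (rule Bochner_Integration.integrable_bound)
      show "integrable M (\<lambda>z. \<bar>g z\<bar> + c0)" using gint by auto
      show "F \<in> borel_measurable M" unfolding F_def by measurable
      show "AE z in M. norm (F z) \<le> norm (\<bar>g z\<bar> + c0)"
      proof (rule AE_I2)
        fix z show "norm (F z) \<le> norm (\<bar>g z\<bar> + c0)"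
          using gF[of z] F0[of z] c0 by (cases "z \<in> out") (auto simp: F_def)
      qed
    qed
    have layer: "(1 / a0) * (\<Sum>i\<in>UNIV. y i) \<le> (\<integral>z. F z \<partial>M)
      \<and> (\<forall>i\<in>UNIV. (1 / a0) * (\<Sum>i\<in>UNIV. y i) + \<eta> / 2 * y i \<le> (\<integral>z. F z \<partial>M))"
    proof (rule layer_cake_le[where E = "\<lambda>i. slab e {i} \<eta> - out"])
      fix S :: "'n set" assume S: "S \<noteq> {}"
      have "real (card S) / a0 + \<eta> \<le> measure M (slab e S \<eta>)" by (rule slab[OF e S])
      also have "slab e S \<eta> \<subseteq> (\<Union>i\<in>S. slab e {i} \<eta> - out) \<union> out" by (auto simp: slab_def)
      then have "measure M (slab e S \<eta>) \<le> measure M ((\<Union>i\<in>S. slab e {i} \<eta> - out) \<union> out)"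
        by (intro finite_measure_mono) auto
      also have "\<dots> \<le> measure M (\<Union>i\<in>S. slab e {i} \<eta> - out) + measure M out"
        by (intro measure_Un_le) auto
      finally show "1 / a0 * real (card S) + \<eta> / 2 \<le> measure M (\<Union>i\<in>S. slab e {i} \<eta> - out)"
        using T(2) \<epsilon>(2) by (simp add: out_def)
    next
      fix i z assume z: "z \<in> slab e {i} \<eta> - out"
      have "\<eta>\<^sup>2 \<le> (e i \<bullet> z)\<^sup>2" using z \<eta> by (intro abs_le_square_iff[THEN iffD1]) (auto simp: slab_def)
      then have "\<gamma> i * \<delta> \<le> \<gamma> i * (e i \<bullet> z)\<^sup>2" using \<delta>(2) \<gamma>[of i] by (intro mult_left_mono) auto
      also have "\<dots> \<le> z \<bullet> (C *v z)"
        unfolding zCz using less_imp_le[OF \<gamma>] by (intro member_le_sum mult_nonneg_nonneg) auto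
      finally have "\<gamma> i * \<delta> \<le> lam + z \<bullet> (C *v z)" using lam by simp
      then have "ln (\<gamma> i * \<delta>) \<le> ln (lam + z \<bullet> (C *v z))" using \<gamma>[of i] \<delta> by (intro ln_mono) auto
      then have "X i \<le> F z" using z ln_mult_pos[OF \<gamma>[of i] \<delta>(1)] by (simp add: F_def X_def)
      then show "y i \<le> F z" using F0[of z] by (simp add: y_def)
    qed (use a0_pos \<eta> Fint F0 in \<open>auto simp: y_def\<close>)
    have "(\<integral>z. F z - c0 - m * indicator out z \<partial>M) \<le> (\<integral>z. g z \<partial>M)"
      using Fint gint gF by (intro integral_mono) (auto simp: less_top[symmetric])
    then have "(\<integral>z. F z \<partial>M) - c0 - m * measure M out \<le> (\<integral>z. g z \<partial>M)"
      using Fint by (simp add: prob_space less_top[symmetric])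
    moreover have "m * measure M out \<le> m * \<epsilon>" using T(2) m0 by (intro mult_left_mono) (auto simp: out_def)
    ultimately have gI: "(1 / a0) * (\<Sum>i\<in>UNIV. y i) + \<eta> / 2 * y i - c0 - m * \<epsilon> \<le> (\<integral>z. g z \<partial>M)" for i
      using layer by (smt (verit, best) UNIV_I)
    have "det A = inverse (det C)"
      using det_inverse[OF A] by (metis C_def inverse_unique mult.commute)
    then have "ln (det A) = - ln (det C)" by (simp add: ln_inverse)
    also have "ln (det C) = (\<Sum>i\<in>UNIV. X i)"
      unfolding det X_def using \<gamma> by (intro ln_prod) (auto simp: less_imp_neq[symmetric])
    also have "\<dots> = (\<Sum>i\<in>UNIV. y i) - m"
      unfolding m_def y_def sum_subtractf[symmetric] by (intro sum.cong) auto
    finally have lndet: "ln (det A) = m - (\<Sum>i\<in>UNIV. y i)" by simp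
    \<comment> \<open>The layer-cake term \<open>(\<Sum>i\<in>UNIV. y i) / 2\<close> cancels exactly
      its counterpart in \<open>ln (det A) / 2\<close>, so only the surplus in \<open>y i\<close>
      and part of \<open>m\<close> remain.\<close>
    have key: "m / 4 + a0 * \<eta> / 4 * y i \<le> a0 * c0 / 2" for i
    proof -
      have "a0 / 2 * ((1 / a0) * (\<Sum>i\<in>UNIV. y i) + \<eta> / 2 * y i - c0 - m * \<epsilon>) \<le> a0 / 2 * (\<integral>z. g z \<partial>M)"
        using gI[of i] a0_pos by (intro mult_left_mono) auto
      moreover have "a0 / 2 * ((1 / a0) * (\<Sum>i\<in>UNIV. y i) + \<eta> / 2 * y i - c0 - m * \<epsilon>)
          = (\<Sum>i\<in>UNIV. y i) / 2 + a0 * \<eta> / 4 * y i - a0 * c0 / 2 - m * (a0 * \<epsilon>) / 2"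
        using a0_pos by (simp add: field_simps)
      moreover have "m * (a0 * \<epsilon>) \<le> m * (1 / 2)" using \<epsilon>(3) m0 by (intro mult_left_mono)
      moreover have "ln (det A) / 2 + a0 / 2 * (\<integral>z. g z \<partial>M) \<le> 0"
        using obj by (simp add: obj_def g_def C_def)
      ultimately show ?thesis using lndet by linarith
    qed
    have y0: "0 \<le> y i" for i by (simp add: y_def)
    have "m \<le> 2 * a0 * c0"
    proof -
      have "0 \<le> a0 * \<eta> / 4 * y (SOME i. True)" using y0 a0_pos \<eta> by (intro mult_nonneg_nonneg) auto
      then have "m / 4 \<le> a0 * c0 / 2" using key[of "SOME i. True"] by linarith
      then show ?thesis by simp
    qed
    moreover have Xle: "X i \<le> 2 * c0 / \<eta>" for i
    proof -
      have "a0 * (\<eta> * y i) = 4 * (a0 * \<eta> / 4 * y i)" "a0 * (2 * c0) = 4 * (a0 * c0 / 2)" by simp_all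
      then have "a0 * (\<eta> * y i) \<le> a0 * (2 * c0)" using key[of i] m0 by linarith
      then have "\<eta> * y i \<le> 2 * c0" using a0_pos by simp
      then have "y i \<le> 2 * c0 / \<eta>" using \<eta> by (simp add: field_simps)
      then show ?thesis by (simp add: y_def)
    qed
    ultimately have "r \<le> \<gamma> i" "\<gamma> i \<le> R" for i
      using m[of i] Xle[of i] by (auto simp: r_def R_def \<gamma>X)
    then show "r * (x \<bullet> x) \<le> x \<bullet> (matrix_inv A *v x) \<and> x \<bullet> (matrix_inv A *v x) \<le> R * (x \<bullet> x)"
      unfolding C_def[symmetric] zz zCz sum_distrib_left by (auto intro!: sum_mono mult_right_mono)
  qed
qed

section \<open>Existence and strictness of the minimum\<close>

text \<open>Minimisation runs over \<open>C = matrix_inv A\<close>, for which the coercivity bounds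
  describe a compact set. Level 0 is the value at the identity, which lies in that set because
  \<open>r \<le> 1 \<le> R\<close>.\<close>

lemma obj_minimum_exists:
  assumes spread
  obtains A where "pos_def A" "\<And>B. pos_def B \<Longrightarrow> obj A \<le> obj B"
proof -
  obtain r R where r: "0 < r" "r \<le> 1" "1 \<le> R"
    and sub: "\<And>A x. pos_def A \<Longrightarrow> obj A \<le> 0 \<Longrightarrow> r * (x \<bullet> x) \<le> x \<bullet> (matrix_inv A *v x) \<and>
       x \<bullet> (matrix_inv A *v x) \<le> R * (x \<bullet> x)"
    using obj_coercive[OF assms] by blast
  define K where "K = {C :: real^'n^'n. transpose C = C \<and>
    (\<forall>x. r * (x \<bullet> x) \<le> x \<bullet> (C *v x) \<and> x \<bullet> (C *v x) \<le> R * (x \<bullet> x))}"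
  define G where "G C = (\<integral>z. ln (lam + z \<bullet> (C *v z)) - ln (lam + z \<bullet> z) \<partial>M)" for C
  define f where "f C = - ln (det C) / 2 + a0 / 2 * G C" for C
  have obj_f: "obj A = f (matrix_inv A)" if "pos_def A" for A
  proof -
    have "det A = inverse (det (matrix_inv A))"
      using det_inverse[OF that] by (metis inverse_unique mult.commute)
    then show ?thesis by (simp add: obj_def f_def G_def ln_inverse)
  qed
  have pK: "pos_def C" if "C \<in> K" for C
    unfolding pos_def_def
  proof (intro conjI allI impI)
    show "0 < x \<bullet> (C *v x)" if "x \<noteq> 0" for x
    proof -
      have "0 < r * (x \<bullet> x)" using r that by simp
      then show ?thesis using \<open>C \<in> K\<close> by (auto simp: K_def intro: less_le_trans)
    qed
  qed (use that in \<open>auto simp: K_def\<close>)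
  have "continuous_on K G"
  proof (rule continuous_on_sequentiallyI)
    fix X L assume X: "\<forall>n::nat. X n \<in> K" and L: "L \<in> K" "X \<longlonglongrightarrow> L"
    show "(\<lambda>n. G (X n)) \<longlonglongrightarrow> G L"
      unfolding G_def
    proof (rule integral_dominated_convergence[where w = "\<lambda>_. \<bar>ln r\<bar> + \<bar>ln R\<bar>"])
      show "AE z in M. (\<lambda>n. ln (lam + z \<bullet> (X n *v z)) - ln (lam + z \<bullet> z))
          \<longlonglongrightarrow> ln (lam + z \<bullet> (L *v z)) - ln (lam + z \<bullet> z)"
      proof (rule AE_I2)
        fix z
        have "(\<lambda>n. z \<bullet> (X n *v z)) \<longlonglongrightarrow> z \<bullet> (L *v z)"
          unfolding form_double_sum by (intro tendsto_intros L)
        moreover have "lam + z \<bullet> (L *v z) \<noteq> 0" using pos_def_nonneg[OF pK[OF L(1)], of z] lam by simp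
        ultimately show "(\<lambda>n. ln (lam + z \<bullet> (X n *v z)) - ln (lam + z \<bullet> z))
          \<longlonglongrightarrow> ln (lam + z \<bullet> (L *v z)) - ln (lam + z \<bullet> z)"
          by (intro tendsto_diff tendsto_ln tendsto_add tendsto_const)
      qed
      show "AE z in M. norm (ln (lam + z \<bullet> (X n *v z)) - ln (lam + z \<bullet> z)) \<le> \<bar>ln r\<bar> + \<bar>ln R\<bar>" for n
      proof (rule AE_I2)
        fix z
        have "r * (z \<bullet> z) \<le> z \<bullet> (X n *v z)" "z \<bullet> (X n *v z) \<le> R * (z \<bullet> z)" "0 \<le> z \<bullet> (X n *v z)"
          using X pos_def_nonneg[OF pK[of "X n"]] by (auto simp: K_def)
        then have "ln r \<le> ln (lam + z \<bullet> (X n *v z)) - ln (lam + z \<bullet> z)"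
          "ln (lam + z \<bullet> (X n *v z)) - ln (lam + z \<bullet> z) \<le> ln R"
          using r lam by (auto intro: ln_ratio_ge ln_ratio_le)
        then show "norm (ln (lam + z \<bullet> (X n *v z)) - ln (lam + z \<bullet> z)) \<le> \<bar>ln r\<bar> + \<bar>ln R\<bar>"
          by simp
      qed
    qed auto
  qed
  moreover have "continuous_on K (\<lambda>C. ln (det C))"
  proof (intro continuous_on_ln ballI)
    show "continuous_on K det" unfolding det_def[abs_def] by (intro continuous_intros)
    show "det C \<noteq> 0" if "C \<in> K" for C using pos_def_det_pos[OF pK[OF that]] by simp
  qed
  ultimately have "continuous_on K f" unfolding f_def[abs_def]
    by (intro continuous_on_add continuous_on_mult_left continuous_on_divide continuous_on_minus
        continuous_on_const) auto
  moreover have "compact K" unfolding K_def by (rule compact_form_bounds[OF r(1)])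
  moreover have I: "mat 1 \<in> K"
    using mult_right_mono[OF r(2) inner_ge_zero] mult_right_mono[OF r(3) inner_ge_zero]
    by (auto simp: K_def)
  ultimately obtain C where C: "C \<in> K" "\<And>D. D \<in> K \<Longrightarrow> f C \<le> f D"
    using continuous_attains_inf[of K f] by blast
  have "f (mat 1) = 0" by (simp add: f_def G_def)
  then have "f C \<le> 0" using C(2)[OF I] by simp
  show ?thesis
  proof
    show "pos_def (matrix_inv C)" by (rule pos_def_inv[OF pK[OF C(1)]])
    have fC: "obj (matrix_inv C) = f C"
      using obj_f[OF pos_def_inv[OF pK[OF C(1)]]] pos_def_inv_inv[OF pK[OF C(1)]] by simp
    fix B :: "real^'n^'n" assume B: "pos_def B"
    show "obj (matrix_inv C) \<le> obj B"
    proof (cases "obj B \<le> 0")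
      case True
      then have "matrix_inv B \<in> K"
        using sub[OF B] pos_def_sym[OF pos_def_inv[OF B]] by (simp add: K_def)
      then show ?thesis using C(2) obj_f[OF B] fC by simp
    next
      case False
      then show ?thesis using fC \<open>f C \<le> 0\<close> by simp
    qed
  qed
qed

text \<open>Strictness comes from uniqueness: a second matrix with the minimal value would itself be
  a minimiser, hence solve the critical equation.\<close>

lemma obj_minimizer:
  assumes spread
  obtains A where "crit_eq A" "\<And>i j. dir_deriv A (sym_unit i j) = 0"
    "\<And>B. pos_def B \<Longrightarrow> obj A \<le> obj B" "\<And>B. pos_def B \<Longrightarrow> B \<noteq> A \<Longrightarrow> obj A < obj B"
proof -
  have crit: "dir_deriv A (sym_unit i j) = 0" if "pos_def A" "\<And>B. pos_def B \<Longrightarrow> obj A \<le> obj B" for A i j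
    using obj_min_dir_deriv[OF that(1) sym_unit_sym that(2)] .
  obtain A where A: "pos_def A" "\<And>B. pos_def B \<Longrightarrow> obj A \<le> obj B"
    using obj_minimum_exists[OF assms] by blast
  note critA = dir_deriv_zero_imp_crit_eq[OF A(1) crit[OF A]]
  show ?thesis
  proof
    show "crit_eq A" by (rule critA)
    show "dir_deriv A (sym_unit i j) = 0" for i j by (rule crit[OF A])
    show "obj A \<le> obj B" if "pos_def B" for B by (rule A(2)[OF that])
    show "obj A < obj B" if B: "pos_def B" "B \<noteq> A" for B
    proof (rule ccontr)
      assume "\<not> obj A < obj B"
      then have "\<And>D. pos_def D \<Longrightarrow> obj B \<le> obj D" using A(2) by (meson order_trans not_less)
      from dir_deriv_zero_imp_crit_eq[OF B(1) crit[OF B(1) this]] have "crit_eq B" .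
      then show False using crit_eq_unique[OF _ critA] B(2) by blast
    qed
  qed
qed

end

section \<open>Location and scatter as a scatter matrix in one more dimension\<close>

definition lift :: "real^'d::finite \<Rightarrow> real \<Rightarrow> real^('d option)" where
  "lift x c = (\<chi> i. case i of Some j \<Rightarrow> x $ j | None \<Rightarrow> c)"

lemma lift_nth [simp]: "lift x c $ Some j = x $ j" "lift x c $ None = c"
  by (simp_all add: lift_def)

lemma T1_lift: "T1 y = lift y 1"
  by (simp add: T1_def lift_def)

lemma vec_option_eq_iff: "v = w \<longleftrightarrow> (\<forall>j. v $ Some j = w $ Some j) \<and> v $ None = w $ None"
  by (simp add: vec_eq_iff) (metis not_None_eq)

lemma lift_cases: obtains x c where "v = lift x c"
proof
  show "v = lift (\<chi> j. v $ Some j) (v $ None)" by (simp add: vec_option_eq_iff)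
qed

lemma UNIV_option: "(UNIV :: 'd::finite option set) = insert None (range Some)"
  by (auto intro: option.exhaust)

lemma sum_UNIV_option: "(\<Sum>i\<in>UNIV. f i) = f None + (\<Sum>j\<in>UNIV. f (Some j))"
  for f :: "'d::finite option \<Rightarrow> 'c::comm_monoid_add"
  unfolding UNIV_option by (subst sum.insert) (auto simp: sum.reindex)

lemma prod_UNIV_option: "(\<Prod>i\<in>UNIV. f i) = f None * (\<Prod>j\<in>UNIV. f (Some j))"
  for f :: "'d::finite option \<Rightarrow> 'c::comm_monoid_mult"
  unfolding UNIV_option by (subst prod.insert) (auto simp: prod.reindex)

lemma inner_lift: "lift x c \<bullet> lift y d = x \<bullet> y + c * d"
  by (simp add: inner_vec_def sum_UNIV_option)

lemma lift_eq_0_iff: "lift x c = 0 \<longleftrightarrow> x = 0 \<and> c = 0"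
  by (auto simp: vec_option_eq_iff vec_eq_iff)

lemma Amat_nth [simp]:
  "Amat S mu $ Some a $ Some b = S $ a $ b + mu $ a * mu $ b"
  "Amat S mu $ Some a $ None = mu $ a" "Amat S mu $ None $ Some b = mu $ b"
  "Amat S mu $ None $ None = 1"
  by (simp_all add: Amat_def)

lemma Amat_lift:
  "Amat S mu *v lift x c = lift (S *v x + (mu \<bullet> x + c) *\<^sub>R mu) (mu \<bullet> x + c)"
  by (simp add: vec_option_eq_iff matrix_vector_mult_def sum_UNIV_option inner_vec_def
      algebra_simps sum.distrib sum_distrib_left)

lemma Amat_form: "lift x c \<bullet> (Amat S mu *v lift x c) = x \<bullet> (S *v x) + (mu \<bullet> x + c)\<^sup>2"
  by (simp add: Amat_lift inner_lift inner_add_right inner_commute power2_eq_square algebra_simps)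

lemma Amat_sym: "transpose (Amat S mu) = Amat S mu \<longleftrightarrow> transpose S = S"
  by (simp add: vec_eq_iff transpose_def split_option_all mult.commute)

lemma Amat_pos_def_iff: "pos_def (Amat S mu) \<longleftrightarrow> pos_def S"
proof
  assume A: "pos_def (Amat S mu)"
  show "pos_def S" unfolding pos_def_def
  proof (intro conjI allI impI)
    show "transpose S = S" using pos_def_sym[OF A] by (simp add: Amat_sym)
    fix x :: "real^'a" assume "x \<noteq> 0"
    \<comment> \<open>The last coordinate \<open>- (mu \<bullet> x)\<close> annihilates the square
      in \<open>Amat_form\<close>.\<close>
    then show "0 < x \<bullet> (S *v x)"
      using pos_def_pos[OF A, of "lift x (- (mu \<bullet> x))"] by (simp add: Amat_form lift_eq_0_iff)
  qed
next
  assume S: "pos_def S"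
  show "pos_def (Amat S mu)" unfolding pos_def_def
  proof (intro conjI allI impI)
    show "transpose (Amat S mu) = Amat S mu" using pos_def_sym[OF S] by (simp add: Amat_sym)
    fix v :: "real^('a option)" assume v: "v \<noteq> 0"
    obtain x c where xc: "v = lift x c" by (rule lift_cases)
    show "0 < v \<bullet> (Amat S mu *v v)"
    proof (cases "x = 0")
      case True
      then show ?thesis using v by (simp add: xc Amat_form lift_eq_0_iff)
    next
      case False
      then show ?thesis using pos_def_pos[OF S False] by (simp add: xc Amat_form add_pos_nonneg)
    qed
  qed
qed

text \<open>\<open>lift x (1 - mu \<bullet> x)\<close> with
  \<open>x = matrix_inv S *v (y - mu)\<close> solves the linear system for \<open>T1 y\<close>. The
  summand 1 is what turns \<open>nu - 1\<close> into \<open>nu\<close>.\<close>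

lemma Amat_inverse_form:
  assumes S: "pos_def S"
  shows "T1 y \<bullet> (matrix_inv (Amat S mu) *v T1 y) = 1 + (y - mu) \<bullet> (matrix_inv S *v (y - mu))"
proof -
  define x where "x = matrix_inv S *v (y - mu)"
  have "Amat S mu *v lift x (1 - mu \<bullet> x) = T1 y"
    using S by (simp add: Amat_lift T1_lift x_def)
  then have "matrix_inv (Amat S mu) *v T1 y = lift x (1 - mu \<bullet> x)"
    using pos_def_inv_mult(2)[OF Amat_pos_def_iff[THEN iffD2, OF S, of mu], of "lift x (1 - mu \<bullet> x)"]
    by simp
  then show ?thesis by (simp add: T1_lift inner_lift x_def[symmetric] inner_diff_left)
qed

text \<open>\<open>S\<close> is the Schur complement of the last diagonal entry.\<close>

lemma Amat_eqI:
  assumes "pos_def A" "A $ None $ None = 1"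
  obtains S mu where "pos_def S" "A = Amat S mu"
proof -
  define mu where "mu = (\<chi> j. A $ Some j $ None)"
  define S where "S = (\<chi> a b. A $ Some a $ Some b - mu $ a * mu $ b)"
  have sym: "A $ i $ j = A $ j $ i" for i j
    using arg_cong[OF pos_def_sym[OF assms(1)], of "\<lambda>B. B $ j $ i"] by (simp add: transpose_def)
  have "A = Amat S mu"
    unfolding vec_eq_iff
  proof (intro allI)
    fix i j show "A $ i $ j = Amat S mu $ i $ j"
      using assms(2) sym by (cases i; cases j) (auto simp: S_def mu_def)
  qed
  moreover then have "pos_def S" using assms(1) by (simp add: Amat_pos_def_iff)
  ultimately show ?thesis using that by blast
qed

lemma Amat_inj: "Amat S mu = Amat S' mu' \<longleftrightarrow> S = S' \<and> mu = mu'"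
proof
  assume eq: "Amat S mu = Amat S' mu'"
  have "mu $ a = mu' $ a" for a using arg_cong[OF eq, of "\<lambda>A. A $ Some a $ None"] by simp
  then have mu: "mu = mu'" by (simp add: vec_eq_iff)
  have "S $ a $ b = S' $ a $ b" for a b
    using arg_cong[OF eq, of "\<lambda>A. A $ Some a $ Some b"] by (simp add: mu)
  then show "S = S' \<and> mu = mu'" using mu by (simp add: vec_eq_iff)
qed simp

text \<open>Each \<open>e j\<close> is lifted so that the square in \<open>Amat_form\<close>
  vanishes; together with the last basis vector this diagonalises \<open>Amat S mu\<close> with the
  entries of \<open>S\<close> and a 1.\<close>

definition lift_frame :: "real^'d::finite \<Rightarrow> ('d \<Rightarrow> real^'d) \<Rightarrow> 'd option \<Rightarrow> real^('d option)" where
  "lift_frame mu e i = (case i of Some j \<Rightarrow> lift (e j) (- (mu \<bullet> e j)) | None \<Rightarrow> lift 0 1)"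

lemma frame_Amat:
  assumes "frame S e g"
  shows "frame (Amat S mu) (lift_frame mu e) (case_option 1 g)"
  using assms unfolding frame_def split_option_all
  by (auto simp: lift_frame_def Amat_lift inner_lift inner_commute)

text \<open>All rows but the last are those of the identity, so a permutation contributes only if it
  fixes every \<open>Some a\<close>; by injectivity it then fixes \<open>None\<close> too.\<close>

lemma det_unipotent:
  "det (cols (lift_frame mu (\<lambda>j. axis j 1))) = 1"
proof -
  let ?U = "cols (lift_frame mu (\<lambda>j. axis j 1))"
  let ?t = "\<lambda>p. of_int (sign p) * (\<Prod>i\<in>UNIV. ?U $ i $ p i)"
  have U: "?U $ Some a $ j = (if j = Some a then 1 else 0)" "?U $ None $ None = 1" for a j
    by (cases j) (auto simp: cols_def lift_frame_def axis_def)
  have zero: "?t p = 0" if p: "p permutes UNIV" "p \<noteq> id" for p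
  proof -
    have "\<exists>a. p (Some a) \<noteq> Some a"
    proof (rule ccontr)
      assume "\<not> ?thesis"
      then have S: "p (Some a) = Some a" for a by simp
      then have "p None = None"
        using permutes_inj[OF p(1)] by (metis injD not_None_eq)
      with S have "p = id" by (auto simp: fun_eq_iff) (metis not_None_eq)
      with p(2) show False ..
    qed
    then obtain a where "p (Some a) \<noteq> Some a" by blast
    then have "(\<Prod>i\<in>UNIV. ?U $ i $ p i) = 0"
      by (intro prod_zero bexI[of _ "Some a"]) (auto simp: U)
    then show ?thesis by simp
  qed
  have "det ?U = (\<Sum>p\<in>{id}. ?t p)"
    unfolding det_def using zero
    by (intro sum.mono_neutral_right) (auto simp: permutes_id finite_permutations)
  also have "\<dots> = 1" by (simp add: prod_UNIV_option U sign_id)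
  finally show ?thesis .
qed

text \<open>The standard basis settles \<open>S = mat 1\<close>. That value shows that lifting an
  orthonormal frame keeps the squared determinant 1, so a frame diagonalising \<open>S\<close> gives
  both determinants as the same product.\<close>

lemma det_Amat:
  fixes S :: "real^'d::finite^'d"
  assumes S: "pos_def S"
  shows "det (Amat S mu) = det S"
proof -
  have axis: "frame (mat 1 :: real^'d^'d) (\<lambda>j. axis j 1) (\<lambda>_. 1)"
    by (simp add: frame_def inner_axis_axis)
  have I: "det (Amat (mat 1) mu) = 1"
    using frame_det[OF frame_Amat[OF axis, of mu]] by (simp add: det_unipotent prod_UNIV_option)
  obtain e g where fI: "frame (mat 1 :: real^'d^'d) e (\<lambda>_. 1)" and fS: "frame S e g"
    using simultaneous_diagonal[OF pos_def_mat1 pos_def_sym[OF S]] unfolding frame_def by metis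
  have "(det (cols (lift_frame mu e)))\<^sup>2 = 1"
    using frame_det[OF frame_Amat[OF fI, of mu]] by (simp add: I prod_UNIV_option)
  moreover have "(det (cols e))\<^sup>2 = 1" using frame_det[OF fI] by simp
  ultimately show ?thesis
    using frame_det[OF frame_Amat[OF fS, of mu]] frame_det[OF fS] by (simp add: prod_UNIV_option)
qed

section \<open>Affine subspaces and linear subspaces of the lifted law\<close>

lemma T1_affine_sum:
  assumes "sum u B = 1" shows "T1 (\<Sum>b\<in>B. u b *\<^sub>R b) = (\<Sum>b\<in>B. u b *\<^sub>R T1 b)"
  using assms by (simp add: vec_option_eq_iff T1_lift)

lemma inj_T1: "inj T1"
  by (auto simp: inj_def T1_lift vec_option_eq_iff vec_eq_iff)

text \<open>The last coordinate of a vanishing combination says that the coefficients sum to 0; the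
  other coordinates then make it an affine dependence.\<close>

lemma independent_T1_image:
  assumes "\<not> affine_dependent B" "finite B"
  shows "independent (T1 ` B)"
proof
  assume "dependent (T1 ` B)"
  then obtain u v where u: "v \<in> B" "u (T1 v) \<noteq> 0" "(\<Sum>w\<in>T1 ` B. u w *\<^sub>R w) = 0"
    using assms(2) by (auto simp: dependent_finite)
  have inj: "inj_on T1 B" using inj_T1 by (rule inj_on_subset) simp
  have eq: "(\<Sum>b\<in>B. u (T1 b) *\<^sub>R T1 b) = 0" using u(3) by (simp add: sum.reindex[OF inj])
  have "(\<Sum>b\<in>B. u (T1 b)) = 0"
    using arg_cong[OF eq, of "\<lambda>v. v $ None"] by (simp add: T1_lift)
  moreover have "(\<Sum>b\<in>B. u (T1 b) *\<^sub>R b) = 0"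
    unfolding vec_eq_iff
  proof
    fix j show "(\<Sum>b\<in>B. u (T1 b) *\<^sub>R b) $ j = 0 $ j"
      using arg_cong[OF eq, of "\<lambda>v. v $ Some j"] by (simp add: T1_lift)
  qed
  ultimately have "affine_dependent B"
    using u(1,2) assms(2) unfolding affine_dependent_explicit_finite[OF assms(2)]
    by (intro exI[of _ "u \<circ> T1"]) auto
  with assms(1) show False ..
qed

lemma borel_measurable_T1 [measurable]: "(T1 :: real^'d::finite \<Rightarrow> _) \<in> borel_measurable borel"
proof (rule borel_measurable_continuous_onI)
  show "continuous_on UNIV (T1 :: real^'d \<Rightarrow> _)"
    unfolding T1_def
  proof (rule continuous_on_vec_lambda)
    show "continuous_on UNIV (\<lambda>y. case i of Some j \<Rightarrow> y $ j | None \<Rightarrow> 1)" for i :: "'d option"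
      by (cases i) (auto intro: continuous_intros)
  qed
qed

lemma rho_diff:
  assumes "0 < lam" "0 \<le> s" "0 \<le> t"
  shows "rho lam k s - rho lam k t = (lam + k) / 2 * (ln (lam + s) - ln (lam + t))"
  using assms by (simp add: rho_def ln_div add_pos_nonneg right_diff_distrib)

lemma continuous_centred_form:
  "continuous_on UNIV (\<lambda>y. (y - mu) \<bullet> (C *v (y - mu)))" for C :: "real^'n::finite^'n"
  by (rule continuous_on_compose2[OF continuous_form[of UNIV C]]) (auto intro: continuous_intros)

section \<open>The lifted law and the location-scatter functional\<close>

locale location_scatter = prob_space P for P :: "(real^'d::finite) measure" +
  fixes nu :: real
  assumes sets_P: "sets P = sets borel" and nu: "1 < nu"
begin

abbreviation Q :: "(real^('d option)) measure" where "Q \<equiv> distr P borel T1"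

lemma measurable_P: "f \<in> borel_measurable borel \<Longrightarrow> f \<in> borel_measurable P"
  using measurable_cong_sets[OF sets_P refl] by blast

lemma measurable_continuous_P: "continuous_on UNIV f \<Longrightarrow> f \<in> borel_measurable P"
  by (intro measurable_P borel_measurable_continuous_onI)

lemma T1_P [measurable]: "T1 \<in> borel_measurable P"
  by (rule measurable_P[OF borel_measurable_T1])

lemma card_option_real: "real CARD('d option) = real CARD('d) + 1"
  by simp

sublocale L: law Q "nu - 1" "nu + real CARD('d)"
proof (intro law.intro law_axioms.intro)
  show "prob_space Q" by (rule prob_space_distr) measurable
qed (use nu in \<open>auto simp: card_option_real\<close>)

lemma integral_Q: "f \<in> borel_measurable Q \<Longrightarrow> (\<integral>z. f z \<partial>Q) = (\<integral>y. f (T1 y) \<partial>P)"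
  for f :: "_ \<Rightarrow> real"
  by (rule integral_distr) (auto simp: T1_P)

text \<open>Lifting adds 1 to the argument, which \<open>nu - 1\<close> lacks in the denominator,
  and the extra dimension restores the numerator.\<close>

lemma uw_Amat:
  fixes S :: "real^'d^'d"
  assumes "pos_def S"
  shows "uw (nu - 1) (real CARD('d option)) (T1 y \<bullet> (matrix_inv (Amat S mu) *v T1 y))
    = uw nu (real CARD('d)) ((y - mu) \<bullet> (matrix_inv S *v (y - mu)))"
  unfolding Amat_inverse_form[OF assms] uw_def card_option_real by (simp add: algebra_simps)

lemma Qh_eq_obj:
  assumes A: "pos_def A" shows "Qh (nu - 1) Q A = ereal (L.obj A)"
proof -
  have rho: "rho (nu - 1) (real CARD('d option)) (z \<bullet> (matrix_inv A *v z)) - rho (nu - 1) (real CARD('d option)) (z \<bullet> z)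
      = (nu + real CARD('d)) / 2 * (ln (nu - 1 + z \<bullet> (matrix_inv A *v z)) - ln (nu - 1 + z \<bullet> z))" for z
    using nu pos_def_nonneg[OF pos_def_inv[OF A], of z] by (subst rho_diff) (auto simp: card_option_real)
  show ?thesis
    unfolding Qh_def rho L.obj_def
      ext_int_integrable[OF integrable_mult_right[OF L.integrable_ln_form[OF pos_def_inv[OF A]]]]
    by simp
qed

lemma hfun_eq:
  fixes S :: "real^'d^'d"
  assumes S: "pos_def S"
  shows "hfun nu y mu S = ln (det S) / 2 + (nu + real CARD('d)) / 2
    * (ln (nu + (y - mu) \<bullet> (matrix_inv S *v (y - mu))) - ln (nu + y \<bullet> y))"
  unfolding hfun_def
  using nu pos_def_nonneg[OF pos_def_inv[OF S], of "y - mu"]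
    rho_diff[of nu "(y - mu) \<bullet> (matrix_inv S *v (y - mu))" "y \<bullet> y" "real CARD('d)"] by simp

text \<open>The reference term matches as well:
  \<open>T1 y \<bullet> T1 y = y \<bullet> y + 1\<close>, so the two integrands agree
  pointwise.\<close>

lemma integrable_ln_scatter:
  assumes S: "pos_def S"
  shows "integrable P (\<lambda>y. ln (nu + (y - mu) \<bullet> (matrix_inv S *v (y - mu))) - ln (nu + y \<bullet> y))"
    and "(\<integral>y. ln (nu + (y - mu) \<bullet> (matrix_inv S *v (y - mu))) - ln (nu + y \<bullet> y) \<partial>P)
      = (\<integral>z. ln (nu - 1 + z \<bullet> (matrix_inv (Amat S mu) *v z)) - ln (nu - 1 + z \<bullet> z) \<partial>Q)"
proof -
  let ?f = "\<lambda>z. ln (nu - 1 + z \<bullet> (matrix_inv (Amat S mu) *v z)) - ln (nu - 1 + z \<bullet> z)"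
  have int: "integrable Q ?f"
    by (intro L.integrable_ln_form pos_def_inv) (simp add: Amat_pos_def_iff S)
  have eq: "?f (T1 y) = ln (nu + (y - mu) \<bullet> (matrix_inv S *v (y - mu))) - ln (nu + y \<bullet> y)" for y
    unfolding Amat_inverse_form[OF S] by (simp add: T1_lift inner_lift algebra_simps)
  show "integrable P (\<lambda>y. ln (nu + (y - mu) \<bullet> (matrix_inv S *v (y - mu))) - ln (nu + y \<bullet> y))"
    using integrable_distr[OF T1_P int] unfolding eq .
  show "(\<integral>y. ln (nu + (y - mu) \<bullet> (matrix_inv S *v (y - mu))) - ln (nu + y \<bullet> y) \<partial>P) = (\<integral>z. ?f z \<partial>Q)"
    using integral_Q[OF borel_measurable_integrable[OF int]] unfolding eq by simp
qed

lemma integrable_hfun: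
  assumes S: "pos_def S" shows "integrable P (\<lambda>y. hfun nu y mu S)"
  unfolding hfun_eq[OF S] using integrable_ln_scatter(1)[OF S, of mu] by auto

lemma Ph_eq:
  assumes S: "pos_def S"
  shows "Ph nu P mu S = ereal (ln (det S) / 2 + (nu + real CARD('d)) / 2
    * (\<integral>y. ln (nu + (y - mu) \<bullet> (matrix_inv S *v (y - mu))) - ln (nu + y \<bullet> y) \<partial>P))"
proof -
  have "Ph nu P mu S = ereal (\<integral>y. hfun nu y mu S \<partial>P)"
    unfolding Ph_def by (rule ext_int_integrable[OF integrable_hfun[OF S]])
  then show ?thesis
    unfolding hfun_eq[OF S] using integrable_ln_scatter(1)[OF S, of mu] by (simp add: prob_space)
qed

lemma Ph_eq_obj:
  assumes S: "pos_def S" shows "Ph nu P mu S = ereal (L.obj (Amat S mu))"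
  unfolding Ph_eq[OF S] L.obj_def integrable_ln_scatter(2)[OF S] det_Amat[OF S] ..

lemma hfun_negative_part_finite:
  assumes S: "pos_def S" shows "(\<integral>\<^sup>+ y. ennreal (- hfun nu y mu S) \<partial>P) < \<infinity>"
  using integrable_hfun[OF S, of mu] unfolding real_integrable_def by (simp add: less_top)

lemma measure_Q: "H \<in> sets borel \<Longrightarrow> measure Q H = measure P (T1 -` H)"
  using measure_distr[OF T1_P, of H] sets_eq_imp_space_eq[OF sets_P] by simp

text \<open>The preimage of \<open>H\<close> under \<open>T1\<close> is affine. Lifting an affine
  basis of it gives independent vectors in \<open>H\<close>, so its dimension is at most
  \<open>dim H - 1\<close>.\<close>

lemma inV_imp_spread:
  assumes "inV P (nu + real CARD('d))" shows L.spread
  unfolding L.spread_def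
proof (intro allI impI, elim conjE)
  fix H :: "(real^('d option)) set" assume H: "subspace H" and dimH: "dim H < CARD('d option)"
  let ?a = "nu + real CARD('d)"
  define J where "J = (T1 -` H :: (real^'d) set)"
  have a: "0 < ?a" using nu by (simp add: add_pos_nonneg)
  have HJ: "measure Q H = measure P J"
    unfolding J_def using closed_subspace[OF H] by (intro measure_Q) simp
  show "measure Q H < 1 - (real CARD('d option) - real (dim H)) / ?a"
  proof (cases "J = {}")
    \<comment> \<open>A subspace that misses the lifted hyperplane carries no mass; the bound then
      amounts to \<open>d + 1 < nu + d\<close>, that is \<open>nu > 1\<close>.\<close>
    case True
    have "(real CARD('d option) - real (dim H)) / ?a \<le> (real CARD('d) + 1) / ?a"
      using a by (intro divide_right_mono) (auto simp: card_option_real)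
    also have "\<dots> < 1" using a nu by simp
    finally show ?thesis using HJ True by simp
  next
    case False
    have "affine J"
      unfolding affine_def
    proof (intro ballI allI impI)
      fix x y :: "real^'d" and u v :: real
      assume "x \<in> J" "y \<in> J" "u + v = 1"
      moreover have "T1 (u *\<^sub>R x + v *\<^sub>R y) = u *\<^sub>R T1 x + v *\<^sub>R T1 y"
        using \<open>u + v = 1\<close> by (simp add: vec_option_eq_iff T1_lift)
      ultimately show "u *\<^sub>R x + v *\<^sub>R y \<in> J"
        using H by (simp add: J_def subspace_add subspace_scale)
    qed
    obtain B where B: "affine hull B = affine hull J" "\<not> affine_dependent B" "of_nat (card B) = aff_dim J + 1"
      using aff_dim_basis_exists[of J] by blast
    have finB: "finite B" by (rule aff_independent_finite[OF B(2)])
    have "B \<subseteq> J" using B(1) \<open>affine J\<close> hull_subset[of B affine] by (simp add: affine_hull_eq[THEN iffD2])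
    then have "T1 ` B \<subseteq> H" by (auto simp: J_def)
    then have "card (T1 ` B) \<le> dim H"
      using independent_T1_image[OF B(2) finB] by (intro independent_card_le_dim)
    moreover have "card (T1 ` B) = card B"
      using inj_T1 by (intro card_image) (auto simp: inj_def inj_on_def)
    ultimately have le: "aff_dim J + 1 \<le> int (dim H)" using B(3) by simp
    have "dim H \<le> CARD('d)" using dimH by simp
    then have "aff_dim J < int CARD('d)" using le by simp
    then have "measure P J < 1 - (real CARD('d) - real_of_int (aff_dim J)) / ?a"
      using assms \<open>affine J\<close> False unfolding inV_def by blast
    also have "\<dots> \<le> 1 - (real CARD('d option) - real (dim H)) / ?a"
    proof -
      have "real_of_int (aff_dim J) + 1 \<le> real (dim H)"
        using le by (metis (mono_tags) of_int_add of_int_le_iff of_int_of_nat_eq of_int_1)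
      then show ?thesis using a by (intro diff_left_mono divide_right_mono) (auto simp: card_option_real)
    qed
    finally show ?thesis using HJ by simp
  qed
qed

text \<open>The lifted points of an affine basis of \<open>J\<close> span a subspace of dimension at
  most \<open>aff_dim J + 1\<close> whose preimage contains \<open>J\<close>.\<close>

lemma spread_imp_inV:
  assumes L.spread shows "inV P (nu + real CARD('d))"
  unfolding inV_def
proof (intro allI impI, elim conjE)
  fix J :: "(real^'d) set" assume J: "affine J" "J \<noteq> {}" "aff_dim J < int CARD('d)"
  let ?a = "nu + real CARD('d)"
  have a: "0 < ?a" using nu by (simp add: add_pos_nonneg)
  obtain B where B: "affine hull B = affine hull J" "\<not> affine_dependent B" "of_nat (card B) = aff_dim J + 1"
    using aff_dim_basis_exists[of J] by blast
  have finB: "finite B" by (rule aff_independent_finite[OF B(2)])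
  define H where "H = span (T1 ` B)"
  have H: "subspace H" by (simp add: H_def)
  have "dim H \<le> card (T1 ` B)" unfolding H_def using finB by (simp add: dim_le_card')
  also have "\<dots> \<le> card B" by (rule card_image_le[OF finB])
  finally have le: "int (dim H) \<le> aff_dim J + 1" using B(3) by linarith
  then have "dim H < CARD('d option)" using J(3) by simp
  then have "measure Q H < 1 - (real CARD('d option) - real (dim H)) / ?a"
    using assms H unfolding L.spread_def by blast
  also have "\<dots> \<le> 1 - (real CARD('d) - real_of_int (aff_dim J)) / ?a"
  proof -
    have "real (dim H) \<le> real_of_int (aff_dim J) + 1"
      using le by (metis (mono_tags) of_int_add of_int_le_iff of_int_of_nat_eq of_int_1)
    then show ?thesis using a by (intro diff_left_mono divide_right_mono) (auto simp: card_option_real)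
  qed
  finally have "measure Q H < 1 - (real CARD('d) - real_of_int (aff_dim J)) / ?a" .
  moreover have "J \<subseteq> T1 -` H"
  proof
    fix y assume "y \<in> J"
    then have "y \<in> affine hull B" using B(1) hull_subset[of J affine] by blast
    then obtain u where "sum u B = 1" "(\<Sum>v\<in>B. u v *\<^sub>R v) = y"
      unfolding affine_hull_finite[OF finB] by blast
    then have "T1 y = (\<Sum>b\<in>B. u b *\<^sub>R T1 b)" 
      using T1_affine_sum[of u B] by simp
    then have "T1 y \<in> H"
      unfolding H_def by (simp only:) (intro span_sum span_scale span_base imageI)
    then show "y \<in> T1 -` H" by simp
  qed
  moreover have HB: "H \<in> sets borel" using closed_subspace[OF H] by simp
  moreover have "T1 -` H \<in> sets P"
    using measurable_sets[OF T1_P HB] sets_eq_imp_space_eq[OF sets_P] by simp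
  ultimately show "measure P J < 1 - (real CARD('d) - real_of_int (aff_dim J)) / ?a"
    using measure_Q[of H] finite_measure_mono[of J "T1 -` H"] by linarith
qed

text \<open>The scatter equations are those of the law of \<open>y - mu\<close>; their trace gives \<open>\<integral> u = 1\<close>, and
  with the location equations \<open>\<integral> u (y - mu) = 0\<close> they add up to the lifted critical equation.\<close>
lemma Ph_critical_imp_crit_eq:
  assumes S: "pos_def S" and crit: "crit_point (\<lambda>(m, s). Ph nu P m s) loc_scat_dirs (mu, S)"
  shows "L.crit_eq (Amat S mu)"
proof -
  let ?a = "nu + real CARD('d)" and ?C = "matrix_inv S"
  have a: "0 < ?a" using nu by (simp add: add_pos_nonneg)
  have C: "pos_def ?C" by (rule pos_def_inv[OF S])
  have shift: "(\<lambda>y. y - mu) \<in> borel_measurable P"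
    by (intro measurable_P borel_measurable_continuous_onI continuous_intros)
  interpret Lm: law "distr P borel (\<lambda>y. y - mu)" nu ?a
  proof (intro law.intro law_axioms.intro)
    show "prob_space (distr P borel (\<lambda>y. y - mu))" by (rule prob_space_distr[OF shift])
  qed (use nu in auto)
  have Lm_int: "(\<integral>z. f z \<partial>distr P borel (\<lambda>y. y - mu)) = (\<integral>y. f (y - mu) \<partial>P)"
    if "f \<in> borel_measurable borel" for f :: "_ \<Rightarrow> real"
    by (rule integral_distr[OF shift that])
  have Lm_meas: "f \<in> borel_measurable borel" if "f \<in> borel_measurable (distr P borel (\<lambda>y. y - mu))"
    for f :: "_ \<Rightarrow> real"
    using that by simp
  define q where "q y = (y - mu) \<bullet> (?C *v (y - mu))" for y
  define u where "u y = uw nu (real CARD('d)) (q y)" for y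
  have q0: "0 \<le> q y" for y unfolding q_def by (rule pos_def_nonneg[OF C])
  \<comment> \<open>Centring replaces the reference \<open>y \<bullet> y\<close> by that of
    \<open>y - mu\<close>; the discrepancy does not depend on the scatter matrix.\<close>
  define k where "k = ?a / 2 * (\<integral>y. ln (nu + (y - mu) \<bullet> (y - mu)) - ln (nu + y \<bullet> y) \<partial>P)"
  have inv1: "matrix_inv (mat 1 :: real^'d^'d) = mat 1" by (rule matrix_inv_eqI) simp
  have Ph_obj: "Ph nu P mu B = ereal (Lm.obj B + k)" if B: "pos_def B" for B
  proof -
    let ?f = "\<lambda>z. ln (nu + z \<bullet> (matrix_inv B *v z)) - ln (nu + z \<bullet> z)"
    have intB: "integrable (distr P borel (\<lambda>y. y - mu)) ?f"
      by (rule Lm.integrable_ln_form[OF pos_def_inv[OF B]])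
    have "integrable P (\<lambda>y. ?f (y - mu))" by (rule integrable_distr[OF shift intB])
    moreover have "integrable P (\<lambda>y. ln (nu + (y - mu) \<bullet> (y - mu)) - ln (nu + y \<bullet> y))"
      using integrable_ln_scatter(1)[OF pos_def_mat1, of mu] by (simp add: inv1)
    ultimately have "(\<integral>y. ?f (y - mu) \<partial>P) + (\<integral>y. ln (nu + (y - mu) \<bullet> (y - mu)) - ln (nu + y \<bullet> y) \<partial>P)
        = (\<integral>y. ?f (y - mu) + (ln (nu + (y - mu) \<bullet> (y - mu)) - ln (nu + y \<bullet> y)) \<partial>P)"
      by (rule Bochner_Integration.integral_add[symmetric])
    moreover have "(\<integral>z. ?f z \<partial>distr P borel (\<lambda>y. y - mu)) = (\<integral>y. ?f (y - mu) \<partial>P)"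
      by (rule Lm_int[OF Lm_meas[OF borel_measurable_integrable[OF intB]]])
    ultimately show ?thesis
      unfolding Ph_eq[OF B] Lm.obj_def k_def by (simp add: distrib_left[symmetric])
  qed
  have "crit_point (\<lambda>B. Ph nu P mu B) mat_dirs S"
    unfolding crit_point_def mat_dirs_def
  proof clarify
    fix i j :: 'd
    have "(0, sym_unit i j) \<in> loc_scat_dirs" by (auto simp: loc_scat_dirs_def)
    from crit[unfolded crit_point_def, rule_format, OF this]
    show "\<exists>g. (\<forall>\<^sub>F t in nhds 0. Ph nu P mu (S + t *\<^sub>R sym_unit i j) = ereal (g t))
        \<and> (g has_real_derivative 0) (at 0)" by simp
  qed
  then have critS: "Lm.crit_eq S"
    using Lm.crit_point_iff[OF Ph_obj S] by (intro Lm.dir_deriv_zero_imp_crit_eq[OF S]) blast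
  have u_int: "integrable P u" and u1: "(\<integral>y. u y \<partial>P) = 1"
  proof -
    note int = Lm.integrable_wt[OF S]
    show "integrable P u" using integrable_distr[OF shift int] by (simp add: u_def[abs_def] q_def)
    show "(\<integral>y. u y \<partial>P) = 1"
      using Lm.crit_eq_integral_wt[OF critS] Lm_int[OF Lm_meas[OF borel_measurable_integrable[OF int]]]
      by (simp add: u_def q_def)
  qed
  have sq_int: "integrable P (\<lambda>y. u y * (x \<bullet> (y - mu))\<^sup>2)"
    and form: "x \<bullet> (S *v x) = (\<integral>y. u y * (x \<bullet> (y - mu))\<^sup>2 \<partial>P)" for x
  proof -
    note int = Lm.integrable_wt_sq[OF S, of x]
    show "integrable P (\<lambda>y. u y * (x \<bullet> (y - mu))\<^sup>2)"
      using integrable_distr[OF shift int] by (simp add: u_def q_def)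
    show "x \<bullet> (S *v x) = (\<integral>y. u y * (x \<bullet> (y - mu))\<^sup>2 \<partial>P)"
      using Lm.crit_eq_form[OF critS, of x] Lm_int[OF Lm_meas[OF borel_measurable_integrable[OF int]]]
      by (simp add: u_def q_def)
  qed
  have u_pos: "0 \<le> u y" for y using q0[of y] a nu by (simp add: u_def uw_def)
  have inner_meas: "(\<lambda>y. x \<bullet> (y - mu)) \<in> borel_measurable P" for x
    by (intro measurable_continuous_P continuous_intros)
  \<comment> \<open>The linear moment lies between the weight and the quadratic one, as
    \<open>\<bar>w\<bar> \<le> 1 + w\<^sup>2\<close>.\<close>
  have lin_int: "integrable P (\<lambda>y. u y * (x \<bullet> (y - mu)))" for x
  proof (rule Bochner_Integration.integrable_bound)
    show "integrable P (\<lambda>y. u y + u y * (x \<bullet> (y - mu))\<^sup>2)" using u_int sq_int by auto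
    show "(\<lambda>y. u y * (x \<bullet> (y - mu))) \<in> borel_measurable P"
      using borel_measurable_integrable[OF u_int] inner_meas by (rule borel_measurable_times)
    show "AE y in P. norm (u y * (x \<bullet> (y - mu))) \<le> norm (u y + u y * (x \<bullet> (y - mu))\<^sup>2)"
    proof (rule AE_I2)
      fix y
      have "\<bar>w\<bar> \<le> 1 + w\<^sup>2" for w :: real
        using zero_le_power2[of "\<bar>w\<bar> - 1 / 2"] by (simp add: power2_eq_square algebra_simps)
      then have "u y * \<bar>x \<bullet> (y - mu)\<bar> \<le> u y * (1 + (x \<bullet> (y - mu))\<^sup>2)"
        using u_pos by (intro mult_left_mono)
      then show "norm (u y * (x \<bullet> (y - mu))) \<le> norm (u y + u y * (x \<bullet> (y - mu))\<^sup>2)"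
        using u_pos[of y] by (simp add: abs_mult distrib_left)
    qed
  qed
  have grad: "(\<integral>y. u y * ((?C *v e) \<bullet> (y - mu)) \<partial>P) = 0" if e: "e = axis j 1" for e and j :: 'd
  proof -
    define w where "w y = (?C *v e) \<bullet> (y - mu)" for y
    define \<kappa> where "\<kappa> = e \<bullet> (?C *v e)"
    have \<kappa>: "0 \<le> \<kappa>" unfolding \<kappa>_def by (rule pos_def_nonneg[OF C])
    define qt where "qt t y = (y - (mu + t *\<^sub>R e)) \<bullet> (?C *v (y - (mu + t *\<^sub>R e)))" for t y
    have qt: "qt t y = q y - 2 * t * w y + t\<^sup>2 * \<kappa>" for t y
    proof -
      have "qt t y = ((y - mu) - t *\<^sub>R e) \<bullet> (?C *v ((y - mu) - t *\<^sub>R e))"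
        unfolding qt_def by (simp add: diff_diff_eq)
      then show ?thesis
        using sym_form_commute[OF pos_def_sym[OF C], of "y - mu" e]
        unfolding q_def w_def \<kappa>_def
        by (simp only: form_simps inner_scaleR_left inner_scaleR_right inner_commute[of _ "y - mu"]
            inner_commute[of "?C *v e"])
          (simp add: power2_eq_square algebra_simps inner_commute)
    qed
    \<comment> \<open>The shifted form is nonnegative at \<open>t = 1\<close> and
      \<open>t = -1\<close>; this bounds the cross term by quantities free of its sign.\<close>
    have wle: "2 * \<bar>w y\<bar> \<le> \<kappa> + q y" for y
    proof -
      have "0 \<le> qt 1 y" "0 \<le> qt (-1) y" unfolding qt_def by (rule pos_def_nonneg[OF C])+
      then show ?thesis unfolding qt by simp
    qed
    have D: "((\<lambda>t. \<integral>y. ln (nu + qt t y) - ln (nu + y \<bullet> y) \<partial>P)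
        has_real_derivative (\<integral>y. (- 2 * w y) / (nu + qt 0 y) \<partial>P)) (at 0)"
    \<comment> \<open>For \<open>\<bar>t\<bar> < 1\<close> the change is at most
      \<open>\<bar>t\<bar> * (2 * \<kappa> + q y)\<close>; division by \<open>nu\<close> makes this
      relative to \<open>nu + q y\<close>, whence \<open>K\<close>.\<close>
    proof (rule has_derivative_integral_ln[where d = 1 and K = "2 * \<kappa> / nu + 1"])
      show "finite_measure P" by unfold_locales
      show "qt t \<in> borel_measurable P" for t
        unfolding qt_def[abs_def] by (intro measurable_continuous_P continuous_centred_form)
      show "(\<lambda>y. - 2 * w y) \<in> borel_measurable P"
        unfolding w_def by (intro measurable_continuous_P continuous_intros)
      show "(\<lambda>y. ln (nu + y \<bullet> y)) \<in> borel_measurable P"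
        using nu by (intro measurable_continuous_P continuous_intros) (auto simp: add_nonneg_eq_0_iff)
      show "0 \<le> qt 0 y" for y unfolding qt using q0[of y] by simp
      show "integrable P (\<lambda>y. ln (nu + qt 0 y) - ln (nu + y \<bullet> y))"
        unfolding qt_def using integrable_ln_scatter(1)[OF S, of mu] by simp
      show "((\<lambda>t. qt t y) has_real_derivative - 2 * w y) (at 0)" for y
        unfolding qt by (auto intro!: derivative_eq_intros)
      show "\<bar>qt t y - qt 0 y\<bar> \<le> (2 * \<kappa> / nu + 1) * \<bar>t\<bar> * (nu + qt 0 y)" if t: "\<bar>t\<bar> < 1" for t y
      proof -
        have "\<bar>qt t y - qt 0 y\<bar> \<le> \<bar>t\<bar> * (2 * \<bar>w y\<bar>) + \<bar>t\<bar> * (\<bar>t\<bar> * \<kappa>)"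
          unfolding qt using \<kappa> abs_triangle_ineq[of "- 2 * t * w y" "t\<^sup>2 * \<kappa>"]
          by (simp add: abs_mult power2_eq_square mult_ac)
        also have "\<dots> \<le> \<bar>t\<bar> * (\<kappa> + q y) + \<bar>t\<bar> * \<kappa>"
          using wle[of y] t \<kappa> by (intro add_mono mult_left_mono) (auto intro: mult_left_le_one_le)
        also have "\<dots> = \<bar>t\<bar> * (2 * \<kappa> + q y)" by (simp add: algebra_simps)
        also have "\<dots> \<le> \<bar>t\<bar> * ((2 * \<kappa> / nu + 1) * (nu + q y))"
        proof (rule mult_left_mono)
          have "(2 * \<kappa> / nu + 1) * (nu + q y) = 2 * \<kappa> + q y + (nu + 2 * \<kappa> / nu * q y)"
            using nu by (simp add: field_simps)
          then show "2 * \<kappa> + q y \<le> (2 * \<kappa> / nu + 1) * (nu + q y)" using nu \<kappa> q0[of y] by simp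
        qed simp
        finally show ?thesis by (simp add: qt mult_ac)
      qed
    qed (use nu \<kappa> in auto)
    have PhF: "Ph nu P (mu + t *\<^sub>R e) S = ereal (ln (det S) / 2 + ?a / 2 * (\<integral>y. ln (nu + qt t y) - ln (nu + y \<bullet> y) \<partial>P))" for t
      unfolding Ph_eq[OF S] qt_def ..
    have "(e, 0) \<in> loc_scat_dirs" by (auto simp: loc_scat_dirs_def e)
    from crit[unfolded crit_point_def, rule_format, OF this]
    obtain g where g: "\<forall>\<^sub>F t in nhds 0. Ph nu P (mu + t *\<^sub>R e) S = ereal (g t)"
      "(g has_real_derivative 0) (at 0)" by auto
    have ev: "\<forall>\<^sub>F t in nhds 0. g t = ln (det S) / 2 + ?a / 2 * (\<integral>y. ln (nu + qt t y) - ln (nu + y \<bullet> y) \<partial>P)"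
      using g(1) unfolding PhF by eventually_elim simp
    have "((\<lambda>t. ln (det S) / 2 + ?a / 2 * (\<integral>y. ln (nu + qt t y) - ln (nu + y \<bullet> y) \<partial>P))
        has_real_derivative 0) (at 0)"
      by (rule DERIV_cong_ev[OF refl ev refl, THEN iffD1, OF g(2)])
    moreover have "((\<lambda>t. ln (det S) / 2 + ?a / 2 * (\<integral>y. ln (nu + qt t y) - ln (nu + y \<bullet> y) \<partial>P))
        has_real_derivative ?a / 2 * (\<integral>y. (- 2 * w y) / (nu + qt 0 y) \<partial>P)) (at 0)"
      using D by (auto intro!: derivative_eq_intros)
    ultimately have "?a / 2 * (\<integral>y. (- 2 * w y) / (nu + qt 0 y) \<partial>P) = 0"
      using DERIV_unique by blast
    then have "(\<integral>y. ?a / 2 * ((- 2 * w y) / (nu + qt 0 y)) \<partial>P) = 0"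
      by (simp only: Bochner_Integration.integral_mult_right_zero)
    moreover have "?a / 2 * ((- 2 * w y) / (nu + qt 0 y)) = - (u y * w y)" for y
      by (simp add: u_def uw_def qt)
    ultimately show ?thesis by (simp add: w_def)
  qed
  \<comment> \<open>The location equations concern the vectors \<open>?C *v axis j 1\<close>, and
    any \<open>x\<close> is their combination with coefficients \<open>(S *v x) $ j\<close>.\<close>
  have mean0: "(\<integral>y. u y * (x \<bullet> (y - mu)) \<partial>P) = 0" for x
  proof -
    have "u y * (x \<bullet> (y - mu)) = (\<Sum>j\<in>UNIV. (S *v x) $ j * (u y * ((?C *v axis j 1) \<bullet> (y - mu))))" for y
    proof -
      have "x \<bullet> (y - mu) = (S *v x) \<bullet> (?C *v (y - mu))"
        using sym_form_commute[OF pos_def_sym[OF S], of x "?C *v (y - mu)"] S by (simp add: inner_commute)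
      also have "\<dots> = (\<Sum>j\<in>UNIV. (S *v x) $ j * (?C *v (y - mu)) $ j)" by (simp add: inner_vec_def)
      also have "\<dots> = (\<Sum>j\<in>UNIV. (S *v x) $ j * ((?C *v axis j 1) \<bullet> (y - mu)))"
      proof (intro sum.cong refl)
        fix j
        have "(?C *v (y - mu)) $ j = axis j 1 \<bullet> (?C *v (y - mu))" by (simp add: inner_axis')
        also have "\<dots> = (?C *v axis j 1) \<bullet> (y - mu)"
          using sym_form_commute[OF pos_def_sym[OF C], of "axis j 1" "y - mu"] by (simp add: inner_commute)
        finally show "(S *v x) $ j * (?C *v (y - mu)) $ j = (S *v x) $ j * ((?C *v axis j 1) \<bullet> (y - mu))"
          by simp
      qed
      finally show ?thesis by (simp add: sum_distrib_left mult_ac)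
    qed
    then have "(\<integral>y. u y * (x \<bullet> (y - mu)) \<partial>P)
        = (\<Sum>j\<in>UNIV. (S *v x) $ j * (\<integral>y. u y * ((?C *v axis j 1) \<bullet> (y - mu)) \<partial>P))"
      using lin_int by simp
    then show ?thesis using grad by simp
  qed
  have A: "pos_def (Amat S mu)" using S by (simp add: Amat_pos_def_iff)
  have "v \<bullet> (Amat S mu *v v) = (\<integral>z. L.wt (Amat S mu) z * (v \<bullet> z)\<^sup>2 \<partial>Q)" for v
  proof -
    obtain x c where v: "v = lift x c" by (rule lift_cases)
    define m where "m = mu \<bullet> x + c"
    \<comment> \<open>With \<open>v \<bullet> T1 y = x \<bullet> (y - mu) + m\<close>, the three
      terms integrate to \<open>x \<bullet> (S *v x)\<close>, 0 and \<open>m\<^sup>2\<close>: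
      scatter, location and normalisation, which together are \<open>Amat_form\<close>.\<close>
    have expand: "a * (w + m)\<^sup>2 = a * w\<^sup>2 + 2 * m * (a * w) + m\<^sup>2 * a" for a w :: real
      by (simp add: power2_eq_square algebra_simps)
    have "(\<integral>z. L.wt (Amat S mu) z * (v \<bullet> z)\<^sup>2 \<partial>Q)
        = (\<integral>y. L.wt (Amat S mu) (T1 y) * (v \<bullet> T1 y)\<^sup>2 \<partial>P)"
      by (rule integral_Q[OF borel_measurable_integrable[OF L.integrable_wt_sq[OF A]]])
    also have "\<dots> = (\<integral>y. u y * (x \<bullet> (y - mu))\<^sup>2 + 2 * m * (u y * (x \<bullet> (y - mu))) + m\<^sup>2 * u y \<partial>P)"
    proof (intro Bochner_Integration.integral_cong refl)
      fix y
      have "v \<bullet> T1 y = x \<bullet> (y - mu) + m"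
        by (simp add: v T1_lift inner_lift m_def inner_diff_right inner_commute)
      then show "L.wt (Amat S mu) (T1 y) * (v \<bullet> T1 y)\<^sup>2
          = u y * (x \<bullet> (y - mu))\<^sup>2 + 2 * m * (u y * (x \<bullet> (y - mu))) + m\<^sup>2 * u y"
        using expand[of "u y" "x \<bullet> (y - mu)"] unfolding uw_Amat[OF S] u_def q_def by simp
    qed
    also have "\<dots> = x \<bullet> (S *v x) + m\<^sup>2"
      using sq_int[of x] lin_int[of x] u_int u1 mean0[of x] form[of x] by simp
    finally show ?thesis unfolding v Amat_form m_def by simp
  qed
  with A show ?thesis unfolding L.crit_eq_def by blast
qed

end

theorem theorem12:
  fixes P :: "(real^'d::finite) measure" and nu :: real
  assumes law: "prob_space P" and borel: "sets P = sets borel" and nu: "nu > 1"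
  defines "nu' \<equiv> nu - 1"
  defines "Q \<equiv> distr P borel T1"
  shows "(\<forall>(mu::real^'d) (S::real^'d^'d) y. pos_def S \<longrightarrow>
            uw nu' (real CARD('d option)) (T1 y \<bullet> (matrix_inv (Amat S mu) *v T1 y))
              = uw nu (real CARD('d)) ((y - mu) \<bullet> (matrix_inv S *v (y - mu))))
    \<and> (inV P (nu + real CARD('d)) \<longrightarrow>
        (\<exists>A. pos_def A \<and> crit_point (Qh nu' Q) mat_dirs A
           \<and> (\<forall>B. pos_def B \<and> crit_point (Qh nu' Q) mat_dirs B \<longrightarrow> B = A)
           \<and> (\<forall>B. pos_def B \<longrightarrow> Qh nu' Q A \<le> Qh nu' Q B)
           \<and> A $ None $ None = 1
           \<and> (\<integral>z. uw nu' (real CARD('d option)) (z \<bullet> (matrix_inv A *v z)) \<partial>Q) = 1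
           \<and> (\<exists>mu_nu S_nu. pos_def S_nu \<and> A = Amat S_nu mu_nu
               \<and> (\<integral>y. uw nu (real CARD('d)) ((y - mu_nu) \<bullet> (matrix_inv S_nu *v (y - mu_nu))) \<partial>P) = 1
               \<and> (\<forall>mu S. pos_def S \<longrightarrow> (\<integral>\<^sup>+ y. ennreal (- hfun nu y mu S) \<partial>P) < \<infinity>)
               \<and> (\<forall>mu S. pos_def S \<and> (mu, S) \<noteq> (mu_nu, S_nu) \<longrightarrow>
                     Ph nu P mu_nu S_nu < Ph nu P mu S))))
    \<and> (\<not> inV P (nu + real CARD('d)) \<longrightarrow>
        \<not> (\<exists>mu S. pos_def S \<and> crit_point (\<lambda>(m, s). Ph nu P m s) loc_scat_dirs (mu, S)))"
proof -
  interpret LS: location_scatter P nu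
    using law borel nu by (intro location_scatter.intro location_scatter_axioms.intro)
  note defs = nu'_def Q_def
  have crit_iff: "crit_point (Qh nu' Q) mat_dirs B \<longleftrightarrow> (\<forall>i j. LS.L.dir_deriv B (sym_unit i j) = 0)"
    if "pos_def B" for B
    unfolding defs using LS.Qh_eq_obj that by (intro LS.L.crit_point_iff[where k = 0]) auto
  have main: "\<exists>A. pos_def A \<and> crit_point (Qh nu' Q) mat_dirs A
           \<and> (\<forall>B. pos_def B \<and> crit_point (Qh nu' Q) mat_dirs B \<longrightarrow> B = A)
           \<and> (\<forall>B. pos_def B \<longrightarrow> Qh nu' Q A \<le> Qh nu' Q B)
           \<and> A $ None $ None = 1
           \<and> (\<integral>z. uw nu' (real CARD('d option)) (z \<bullet> (matrix_inv A *v z)) \<partial>Q) = 1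
           \<and> (\<exists>mu_nu S_nu. pos_def S_nu \<and> A = Amat S_nu mu_nu
               \<and> (\<integral>y. uw nu (real CARD('d)) ((y - mu_nu) \<bullet> (matrix_inv S_nu *v (y - mu_nu))) \<partial>P) = 1
               \<and> (\<forall>mu S. pos_def S \<longrightarrow> (\<integral>\<^sup>+ y. ennreal (- hfun nu y mu S) \<partial>P) < \<infinity>)
               \<and> (\<forall>mu S. pos_def S \<and> (mu, S) \<noteq> (mu_nu, S_nu) \<longrightarrow>
                     Ph nu P mu_nu S_nu < Ph nu P mu S))"
    if inV: "inV P (nu + real CARD('d))"
  proof -
    obtain A where A: "LS.L.crit_eq A" "\<And>i j. LS.L.dir_deriv A (sym_unit i j) = 0"
      "\<And>B. pos_def B \<Longrightarrow> LS.L.obj A \<le> LS.L.obj B" "\<And>B. pos_def B \<Longrightarrow> B \<noteq> A \<Longrightarrow> LS.L.obj A < LS.L.obj B"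
      using LS.L.obj_minimizer[OF LS.inV_imp_spread[OF inV]] by blast
    note pA = LS.L.crit_eq_pos_def[OF A(1)]
    have wtA: "(\<integral>z. LS.L.wt A z \<partial>LS.Q) = 1" by (rule LS.L.crit_eq_integral_wt[OF A(1)])
    \<comment> \<open>The last diagonal entry of the critical equation: the last coordinate of
      \<open>T1 y\<close> is 1, so only the integral of the weight remains.\<close>
    have "A $ None $ None = axis None 1 \<bullet> (A *v axis None 1)" by (rule form_entry)
    also have "\<dots> = (\<integral>z. LS.L.wt A z * (axis None 1 \<bullet> z)\<^sup>2 \<partial>LS.Q)" by (rule LS.L.crit_eq_form[OF A(1)])
    also have "\<dots> = (\<integral>y. LS.L.wt A (T1 y) * (axis None 1 \<bullet> T1 y)\<^sup>2 \<partial>P)"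
      by (rule LS.integral_Q[OF borel_measurable_integrable[OF LS.L.integrable_wt_sq[OF pA]]])
    also have "\<dots> = (\<integral>y. LS.L.wt A (T1 y) \<partial>P)" by (simp add: inner_axis' T1_lift)
    also have "\<dots> = (\<integral>z. LS.L.wt A z \<partial>LS.Q)"
      by (rule LS.integral_Q[OF borel_measurable_integrable[OF LS.L.integrable_wt[OF pA]], symmetric])
    finally have A1: "A $ None $ None = 1" using wtA by simp
    obtain S mu where S: "pos_def S" "A = Amat S mu" using Amat_eqI[OF pA A1] by blast
    have "(\<integral>y. uw nu (real CARD('d)) ((y - mu) \<bullet> (matrix_inv S *v (y - mu))) \<partial>P)
        = (\<integral>y. LS.L.wt A (T1 y) \<partial>P)"
      unfolding S(2) LS.uw_Amat[OF S(1)] ..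
    also have "\<dots> = 1"
      using wtA LS.integral_Q[OF borel_measurable_integrable[OF LS.L.integrable_wt[OF pA]]] by simp
    finally have d: "(\<integral>y. uw nu (real CARD('d)) ((y - mu) \<bullet> (matrix_inv S *v (y - mu))) \<partial>P) = 1" .
    have strict: "Ph nu P mu S < Ph nu P m s" if "pos_def s" "(m, s) \<noteq> (mu, S)" for m s
      unfolding LS.Ph_eq_obj[OF S(1)] LS.Ph_eq_obj[OF that(1)] S(2)[symmetric]
      using A(4)[of "Amat s m"] that by (simp add: Amat_pos_def_iff S(2) Amat_inj) blast
    show ?thesis
    proof (intro exI[of _ A] exI[of _ mu] exI[of _ S] conjI allI impI)
      show "crit_point (Qh nu' Q) mat_dirs A" using crit_iff[OF pA] A(2) by simp
      show "B = A" if "pos_def B \<and> crit_point (Qh nu' Q) mat_dirs B" for B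
        using that crit_iff[of B] LS.L.dir_deriv_zero_imp_crit_eq[of B] LS.L.crit_eq_unique[OF _ A(1)]
        by blast
      show "Qh nu' Q A \<le> Qh nu' Q B" if "pos_def B" for B
        unfolding defs LS.Qh_eq_obj[OF pA] LS.Qh_eq_obj[OF that] using A(3)[OF that] by simp
      show "(\<integral>z. uw nu' (real CARD('d option)) (z \<bullet> (matrix_inv A *v z)) \<partial>Q) = 1"
        unfolding defs by (rule wtA)
      show "Ph nu P mu S < Ph nu P m s" if "pos_def s \<and> (m, s) \<noteq> (mu, S)" for m s
        by (rule strict[OF conjunct1[OF that] conjunct2[OF that]])
    qed (rule pA A1 S d LS.hfun_negative_part_finite | assumption)+
  qed
  show ?thesis
  proof (intro conjI impI allI notI)
    show "uw nu' (real CARD('d option)) (T1 y \<bullet> (matrix_inv (Amat S mu) *v T1 y))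
        = uw nu (real CARD('d)) ((y - mu) \<bullet> (matrix_inv S *v (y - mu)))"
      if "pos_def S" for mu y :: "real^'d" and S
      unfolding defs by (rule LS.uw_Amat[OF that])
  next
    assume "\<not> inV P (nu + real CARD('d))"
      and "\<exists>mu S. pos_def S \<and> crit_point (\<lambda>(m, s). Ph nu P m s) loc_scat_dirs (mu, S)"
    \<comment> \<open>Contrapositive: a critical point of \<open>Ph\<close> lifts to a solution of
      the critical equation, which forces \<open>spread\<close> and hence
      \<open>inV\<close>.\<close>
    then show False
      using LS.spread_imp_inV LS.L.crit_eq_imp_spread LS.Ph_critical_imp_crit_eq by blast
  qed (rule main)
qed

end
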